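(* Let $f:M\to Q_2$ be a minimal Lagrangian (conformal) immersion of a Riemann surface $M$, with induced metric $2e^u\,\mathrm dz\,\mathrm d\bar z$ and holomorphic quadratic differential $\hat\alpha\,\mathrm dz^2$. Then there exists a family of minimal Lagrangian immersions $\{f^\lambda\}$ parameterized by $\lambda\in\mathbb S^1$, which has the same induced metric $2e^u\,\mathrm dz\,\mathrm d\bar z$ and the holomorphic quadratic differential $\hat\alpha^\lambda\,\mathrm dz^2=\lambda^{-2}\hat\alpha\,\mathrm dz^2$.
   Context: Let $\langle \boldsymbol z,\boldsymbol w\rangle=\sum_{k=1}^4 z_kw_k$ be the complex bilinear form on $\mathbb C^4$. $\mathbb CP^3$ carries the Fubini–Study metric of constant holomorphic sectional curvature $4$, and $Q_2=\{[\boldsymbol z]\in\mathbb CP^3:\langle\boldsymbol z,\boldsymbol z\rangle=0\}$ carries the induced Kähler structure. An immersion of a surface into $Q_2$ is Lagrangian if the Kähler form pulls back to zero, and minimal if its mean curvature vector in $Q_2$ vanishes. $z=x+iy$ is a conformal coordinate on a simply connected domain $\mathbb D\subset M$, $\partial_z=\frac12(\partial_x-i\partial_y)$, $\partial_{\bar z}=\frac12(\partial_x+i\partial_y)$. A (local) horizontal lift of $f$ is a map $\mathfrak f:\mathbb D\to\mathbb S^7\subset\mathbb C^4$ with $f=[\mathfrak f]$ and $\langle\mathfrak f_z,\bar{\mathfrak f}\rangle=\langle\mathfrak f_{\bar z},\bar{\mathfrak f}\rangle=0$. For minimal $f$ the argument $\varphi$ of $\beta=\langle\mathfrak f_z,\mathfrak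 f_{\bar z}\rangle$ is constant, and one uses the local horizontal lift $\hat{\mathfrak f}=e^{-i\varphi/2}\mathfrak f$, for which $\hat\beta:=\langle\hat{\mathfrak f}_z,\hat{\mathfrak f}_{\bar z}\rangle=|\beta|$ is a non-negative real function. The function $\hat\alpha:=\langle\hat{\mathfrak f}_z,\hat{\mathfrak f}_z\rangle$ is holomorphic, $\hat\beta=\sqrt{e^{2u}-|\hat\alpha|^2}$, and $\hat\alpha\,\mathrm dz^2$ is the holomorphic quadratic differential of $f$; $\hat\alpha^\lambda\,\mathrm dz^2$ is the corresponding differential of $f^\lambda$. *)

theory Defs
  imports "HOL-Complex_Analysis.Complex_Analysis"
begin

subsection \<open>Bilinear and Hermitian products on \<open>\<complex>\<^sup>4\<close>\<close>

definition bil :: "complex ^ 4 \<Rightarrow> complex ^ 4 \<Rightarrow> complex" where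
  "bil v w = (\<Sum>k\<in>UNIV. v $ k * w $ k)"

definition cnjv :: "complex ^ 4 \<Rightarrow> complex ^ 4" where
  "cnjv v = (\<chi> k. cnj (v $ k))"

text \<open>The library's real inner product on \<open>complex ^ 4\<close> is the real part of the following one.\<close>

definition herm :: "complex ^ 4 \<Rightarrow> complex ^ 4 \<Rightarrow> complex" where
  "herm v w = bil v (cnjv w)"


subsection \<open>The projective space and the quadric\<close>

text \<open>A point of the projective space is a complex line in \<open>\<complex>\<^sup>4\<close>, as a set of vectors.\<close>

definition cline :: "complex ^ 4 \<Rightarrow> (complex ^ 4) set" where
  "cline v = range (\<lambda>c. c *s v)"

definition CP3 :: "(complex ^ 4) set set" where
  "CP3 = cline ` (- {0})"

definition Q2 :: "(complex ^ 4) set set" where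
  "Q2 = {cline v | v. v \<noteq> 0 \<and> bil v v = 0}"


subsection \<open>Smooth maps of a plane domain\<close>

text \<open>\<open>ddir X F p\<close> is the derivative of \<open>F\<close> at \<open>p\<close> in the real direction \<open>X\<close>; thus
  \<open>ddir 1\<close> and \<open>ddir \<i>\<close> are the partial derivatives in \<open>x\<close> and \<open>y\<close>, where \<open>z = x + \<i>y\<close>.\<close>

definition ddir :: "complex \<Rightarrow> (complex \<Rightarrow> 'b::real_normed_vector) \<Rightarrow> complex \<Rightarrow> 'b" where
  "ddir X F p = frechet_derivative F (at p) X"

text \<open>The next two definitions are meant for open \<open>V\<close>.\<close>

primrec Ck_on :: "nat \<Rightarrow> (complex \<Rightarrow> 'b::real_normed_vector) \<Rightarrow> complex set \<Rightarrow> bool" where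
  "Ck_on 0 F V \<longleftrightarrow> continuous_on V F"
| "Ck_on (Suc k) F V \<longleftrightarrow>
     F differentiable_on V \<and> Ck_on k (ddir 1 F) V \<and> Ck_on k (ddir \<i> F) V"

definition smooth_on :: "(complex \<Rightarrow> 'b::real_normed_vector) \<Rightarrow> complex set \<Rightarrow> bool" where
  "smooth_on F V \<longleftrightarrow> (\<forall>k. Ck_on k F V)"

definition dz :: "(complex \<Rightarrow> complex ^ 4) \<Rightarrow> complex \<Rightarrow> complex ^ 4" where
  "dz F p = (1 / 2) *s (ddir 1 F p - \<i> *s ddir \<i> F p)"

definition dzbar :: "(complex \<Rightarrow> complex ^ 4) \<Rightarrow> complex \<Rightarrow> complex ^ 4" where
  "dzbar F p = (1 / 2) *s (ddir 1 F p + \<i> *s ddir \<i> F p)"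


subsection \<open>Lifts to the unit sphere, smooth maps into the quadric\<close>

definition unit_lift ::
  "(complex \<Rightarrow> (complex ^ 4) set) \<Rightarrow> complex set \<Rightarrow> (complex \<Rightarrow> complex ^ 4) \<Rightarrow> bool" where
  "unit_lift g V F \<longleftrightarrow> smooth_on F V \<and> (\<forall>p\<in>V. norm (F p) = 1 \<and> g p = cline (F p))"

text \<open>Projective space carries the smooth structure of the quotient of the unit sphere
  \<open>S\<^sup>7\<close> by the unit circle. As the projection is a principal bundle, a map into the
  quotient is smooth iff it has smooth lifts to \<open>S\<^sup>7\<close> near every point.\<close>

definition smooth_into_Q2 :: "(complex \<Rightarrow> (complex ^ 4) set) \<Rightarrow> complex set \<Rightarrow> bool" where
  "smooth_into_Q2 g V \<longleftrightarrow>
     (\<forall>p\<in>V. g p \<in> Q2) \<and>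
     (\<forall>p\<in>V. \<exists>W F. open W \<and> p \<in> W \<and> W \<subseteq> V \<and> unit_lift g W F)"


subsection \<open>Fubini--Study geometry of a map, computed from a unit lift\<close>

text \<open>In this part \<open>F\<close> is a unit lift of \<open>g\<close>. The tangent space of projective space at
  \<open>cline (F p)\<close> is identified with the Hermitian complement of \<open>F p\<close> (the horizontal space of
  \<open>S\<^sup>7\<close> at \<open>F p\<close>), and the Fubini--Study metric of holomorphic sectional curvature \<open>4\<close> is
  the one that makes the projection of \<open>S\<^sup>7\<close> a Riemannian submersion.
  \<open>tang X F p\<close> represents the image of the tangent vector \<open>X\<close> under the differential of \<open>g\<close>.
  The quantities \<open>fs_metric\<close>, \<open>fs_kahler\<close> do not depend on the choice of \<open>F\<close>, and replacing
  \<open>F\<close> by \<open>c F\<close> with \<open>\<bar>c\<bar> = 1\<close> multiplies \<open>tang\<close>, \<open>cov_Q2\<close>, \<open>mean_curv\<close> by \<open>c\<close>.\<close>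

definition tang :: "complex \<Rightarrow> (complex \<Rightarrow> complex ^ 4) \<Rightarrow> complex \<Rightarrow> complex ^ 4" where
  "tang X F p = ddir X F p - herm (ddir X F p) (F p) *s F p"

definition fs_metric :: "(complex \<Rightarrow> complex ^ 4) \<Rightarrow> complex \<Rightarrow> complex \<Rightarrow> complex \<Rightarrow> real" where
  "fs_metric F p X Y = inner (tang X F p) (tang Y F p)"

definition fs_kahler :: "(complex \<Rightarrow> complex ^ 4) \<Rightarrow> complex \<Rightarrow> complex \<Rightarrow> complex \<Rightarrow> real" where
  "fs_kahler F p X Y = inner (\<i> *s tang X F p) (tang Y F p)"

text \<open>\<open>cov_Q2 X Y F p\<close> is the Levi-Civita derivative in \<open>Q2\<close>, in the direction \<open>X\<close>, of the vector
  field along \<open>g\<close> that is the image of the constant coordinate field \<open>Y\<close>. For a submersion the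
  covariant derivative downstairs is the horizontal part of the derivative upstairs along a
  horizontal lift; with a lift \<open>F\<close> that need not be horizontal, the vertical component
  \<open>herm (ddir X F p) (F p)\<close> (which is imaginary) has to be compensated by the term subtracted in
  the first line. The final projection removes \<open>F p\<close> (vertical) and \<open>cnjv (F p)\<close>, which spans over
  the complex numbers the normal space of \<open>Q2\<close> in projective space.\<close>

definition cov_Q2 ::
  "complex \<Rightarrow> complex \<Rightarrow> (complex \<Rightarrow> complex ^ 4) \<Rightarrow> complex \<Rightarrow> complex ^ 4" where
  "cov_Q2 X Y F p =
     (let v = ddir X (tang Y F) p - herm (ddir X F p) (F p) *s tang Y F p
      in v - herm v (F p) *s F p - herm v (cnjv (F p)) *s cnjv (F p))"

text \<open>For \<open>g\<close> conformal with conformal factor \<open>\<rho>\<close>, the vectors \<open>tang 1 F p\<close> and \<open>tang \<i> F p\<close>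
  are orthogonal of squared length \<open>\<rho>\<close>. The following are the component of \<open>v\<close> normal to the
  surface, and half the trace of the second fundamental form.\<close>

definition normal_part :: "(complex \<Rightarrow> complex ^ 4) \<Rightarrow> complex \<Rightarrow> complex ^ 4 \<Rightarrow> complex ^ 4" where
  "normal_part F p v =
     v - (inner v (tang 1 F p) / fs_metric F p 1 1) *\<^sub>R tang 1 F p
       - (inner v (tang \<i> F p) / fs_metric F p \<i> \<i>) *\<^sub>R tang \<i> F p"

definition mean_curv :: "(complex \<Rightarrow> complex ^ 4) \<Rightarrow> complex \<Rightarrow> complex ^ 4" where
  "mean_curv F p = (1 / 2) *\<^sub>R
     (normal_part F p (cov_Q2 1 1 F p) /\<^sub>R fs_metric F p 1 1
      + normal_part F p (cov_Q2 \<i> \<i> F p) /\<^sub>R fs_metric F p \<i> \<i>)"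


subsection \<open>Minimal Lagrangian immersions in a conformal coordinate\<close>

text \<open>The induced metric is \<open>2 e\<^sup>u dz dz\<bar> = 2 e\<^sup>u (dx\<^sup>2 + dy\<^sup>2)\<close>.\<close>

definition induced_metric ::
  "(complex \<Rightarrow> (complex ^ 4) set) \<Rightarrow> complex set \<Rightarrow> (complex \<Rightarrow> real) \<Rightarrow> bool" where
  "induced_metric g V u \<longleftrightarrow>
     (\<forall>W F. open W \<and> W \<subseteq> V \<and> unit_lift g W F \<longrightarrow>
        (\<forall>p\<in>W. \<forall>X Y. fs_metric F p X Y = 2 * exp (u p) * Re (X * cnj Y)))"

definition conformal_immersion :: "(complex \<Rightarrow> (complex ^ 4) set) \<Rightarrow> complex set \<Rightarrow> bool" where
  "conformal_immersion g V \<longleftrightarrow> smooth_into_Q2 g V \<and> (\<exists>u. induced_metric g V u)"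

definition lagrangian :: "(complex \<Rightarrow> (complex ^ 4) set) \<Rightarrow> complex set \<Rightarrow> bool" where
  "lagrangian g V \<longleftrightarrow>
     (\<forall>W F. open W \<and> W \<subseteq> V \<and> unit_lift g W F \<longrightarrow> (\<forall>p\<in>W. \<forall>X Y. fs_kahler F p X Y = 0))"

definition minimal :: "(complex \<Rightarrow> (complex ^ 4) set) \<Rightarrow> complex set \<Rightarrow> bool" where
  "minimal g V \<longleftrightarrow>
     (\<forall>W F. open W \<and> W \<subseteq> V \<and> unit_lift g W F \<longrightarrow> (\<forall>p\<in>W. mean_curv F p = 0))"


subsection \<open>Horizontal lifts and the holomorphic quadratic differential\<close>

definition horizontal_lift ::
  "(complex \<Rightarrow> (complex ^ 4) set) \<Rightarrow> complex set \<Rightarrow> (complex \<Rightarrow> complex ^ 4) \<Rightarrow> bool" where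
  "horizontal_lift g V F \<longleftrightarrow>
     unit_lift g V F \<and>
     (\<forall>p\<in>V. bil (dz F p) (cnjv (F p)) = 0 \<and> bil (dzbar F p) (cnjv (F p)) = 0)"

text \<open>\<open>hat_lift g V F\<close>: \<open>F = e\<^bsup>-\<i>\<phi>/2\<^esup> G\<close> for a horizontal lift \<open>G\<close> for which \<open>bil G\<^sub>z G\<^sub>z\<^sub>\<bar>\<close> has
  constant argument \<open>\<phi>\<close> on \<open>V\<close>.\<close>

definition hat_lift ::
  "(complex \<Rightarrow> (complex ^ 4) set) \<Rightarrow> complex set \<Rightarrow> (complex \<Rightarrow> complex ^ 4) \<Rightarrow> bool" where
  "hat_lift g V F \<longleftrightarrow>
     (\<exists>G \<phi>. horizontal_lift g V G \<and>
        (\<forall>p\<in>V. bil (dz G p) (dzbar G p) = of_real (cmod (bil (dz G p) (dzbar G p))) * cis \<phi>) \<and>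
        F = (\<lambda>p. cis (- \<phi> / 2) *s G p))"

text \<open>Stated as a relation, since the lift, hence \<open>\<alpha>\<close>, is not unique when
  \<open>bil F\<^sub>z F\<^sub>z\<^sub>\<bar>\<close> vanishes identically.\<close>

definition quadratic_differential ::
  "(complex \<Rightarrow> (complex ^ 4) set) \<Rightarrow> complex set \<Rightarrow> (complex \<Rightarrow> complex) \<Rightarrow> bool" where
  "quadratic_differential g V \<alpha> \<longleftrightarrow>
     (\<exists>F. hat_lift g V F \<and> (\<forall>p\<in>V. \<alpha> p = bil (dz F p) (dz F p)))"


subsection \<open>Riemann surfaces\<close>

text \<open>A Riemann surface whose set of points is the type \<open>'m\<close>, given by an atlas of
  charts \<open>(U, z)\<close>. Only the values of \<open>z\<close> on \<open>U\<close> matter.\<close>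

definition riemann_surface :: "('m::t2_space set \<times> ('m \<Rightarrow> complex)) set \<Rightarrow> bool" where
  "riemann_surface A \<longleftrightarrow>
     connected (UNIV :: 'm set) \<and>
     \<Union> (fst ` A) = UNIV \<and>
     (\<forall>(U, z)\<in>A. open U \<and> open (z ` U) \<and> homeomorphism U (z ` U) z (inv_into U z)) \<and>
     (\<forall>(U, z)\<in>A. \<forall>(V, w)\<in>A. (w \<circ> inv_into U z) holomorphic_on (z ` (U \<inter> V)))"

text \<open>The restriction of \<open>f\<close> to the open set \<open>D\<close> is a (conformal) minimal Lagrangian immersion.\<close>

definition minimal_lagrangian_immersion ::
  "('m::t2_space set \<times> ('m \<Rightarrow> complex)) set \<Rightarrow> 'm set \<Rightarrow> ('m \<Rightarrow> (complex ^ 4) set) \<Rightarrow> bool" where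
  "minimal_lagrangian_immersion A D f \<longleftrightarrow>
     (\<forall>(U, z)\<in>A.
        conformal_immersion (f \<circ> inv_into U z) (z ` (U \<inter> D)) \<and>
        lagrangian (f \<circ> inv_into U z) (z ` (U \<inter> D)) \<and>
        minimal (f \<circ> inv_into U z) (z ` (U \<inter> D)))"

end

theory Submission
  imports Defs
begin

text \<open>Let \<open>F\<close> be a unit lift of \<open>f\<close>, and let \<open>P\<close> be the real matrix of the orthogonal projection
  onto the real plane spanned by \<open>Re F\<close> and \<open>Im F\<close>; it depends on \<open>f\<close> only. The real 1-form \<open>\<eta> = [dP, P]\<close>
  is the Maurer--Cartan form of the symmetric space \<open>Q\<^sub>2\<close> pulled back by \<open>f\<close>, and minimality makes it
  coclosed. Therefore the connection with matrix \<open>X \<mapsto> \<eta> ((cnj l - 1) X)\<close> is flat whenever \<open>cmod l = 1\<close>,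
  and over the simply connected \<open>D\<close> there is an orthogonal-matrix valued \<open>T\<close> with
  \<open>dT X = T \<eta> ((cnj l - 1) X)\<close>. The associated family is \<open>f\<^sup>l = T f\<close>: its lift \<open>T F\<close> has the
  differential \<open>X \<mapsto> T (dF (cnj l X))\<close> on horizontal vectors, so the metric and the Kaehler form are unchanged,
  the second fundamental form is only rotated, and \<open>(T F)\<^sub>z = cnj l T F\<^sub>z\<close> for horizontal \<open>F\<close> gives
  the factor \<open>(cnj l)\<^sup>2 = l powi (-2)\<close>.\<close>

text \<open>For an isotropic unit vector \<open>F\<close> the real vectors Re F and Im F are
  orthogonal of equal length, so \<open>Q2\<close> is the Grassmannian of oriented planes in real
  4-space. Real orthogonal matrices act on it and preserve both \<open>bil\<close> and
  \<open>herm\<close>; this is why \<open>T\<close> is sought among them. The obstacle is that only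
  local unit lifts are given, none of them preferred, and that the notions applied to
  \<open>f\<close> quantify over all of them. The connection is therefore written in terms of the
  lines alone, and the phase of a lift has to be seen to cancel at each step. Flatness rests on two
  facts. Minimality and conformality make the covariant Hessian of \<open>f\<close> trace-free,
  which disposes of its covariant derivative terms. The Lagrangian condition makes Hermitian
  products of tangent vectors real, which reduces the remaining terms to a multiple of one fixed
  matrix, with a coefficient proportional to |1 + \<mu>|^2 - 1 for \<mu> = \<open>cnj l - 1\<close>.
  The factor \<open>cnj l - 1\<close> commutes with the complex derivative of a chart change, so the
  equation for \<open>T\<close> makes sense on the surface. Continuation over \<open>D\<close> is
  purely topological; calculus enters only in local existence and uniqueness.\<close>

section \<open>The linear Frobenius theorem\<close>

text \<open>The homotopy operator of the Poincare lemma on a ball about 0, applied to a 1-form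
  \<open>g\<close> with values in \<open>'e\<close>. It yields a candidate primitive in all
  variables at once, whose derivative can be estimated.\<close>

definition radial_integral ::
  "('a::real_normed_vector \<Rightarrow> 'a \<Rightarrow>\<^sub>L 'e::banach) \<Rightarrow> 'a \<Rightarrow> 'e" where
  "radial_integral g p = integral {0..1} (\<lambda>t. blinfun_apply (g (t *\<^sub>R p)) p)"

text \<open>The integrand is the derivative in \<open>p\<close> of
  \<open>g (t *\<^sub>R p) p\<close>; the map \<open>blinfun.prod_left p\<close> evaluates a 1-form
  at \<open>p\<close>.\<close>

definition radial_integral_deriv ::
  "('a::real_normed_vector \<Rightarrow> 'a \<Rightarrow>\<^sub>L 'e::banach) \<Rightarrow> ('a \<Rightarrow> 'a \<Rightarrow>\<^sub>L 'a \<Rightarrow>\<^sub>L 'e) \<Rightarrow> 'a \<Rightarrow> 'a \<Rightarrow>\<^sub>L 'e" where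
  "radial_integral_deriv g g' p =
     integral {0..1} (\<lambda>t. g (t *\<^sub>R p) + t *\<^sub>R (blinfun.prod_left p o\<^sub>L g' (t *\<^sub>R p)))"

lemma scaleR_in_ball_0:
  fixes p :: "'a::real_normed_vector"
  assumes "p \<in> ball 0 r" "t \<in> {0..1}"
  shows "t *\<^sub>R p \<in> ball 0 r"
proof -
  have "norm (t *\<^sub>R p) \<le> 1 * norm p"
    unfolding norm_scaleR using assms by (intro mult_right_mono) auto
  then show ?thesis using assms by simp
qed

context
  fixes g :: "'a::banach \<Rightarrow> 'a \<Rightarrow>\<^sub>L 'e::banach"
    and g' :: "'a \<Rightarrow> 'a \<Rightarrow>\<^sub>L 'a \<Rightarrow>\<^sub>L 'e"
    and r :: real
  assumes der: "\<And>p. p \<in> ball 0 r \<Longrightarrow> (g has_derivative blinfun_apply (g' p)) (at p)"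
    and cont: "continuous_on (ball 0 r) g'"
begin

lemma radial_cont_g: "continuous_on (ball 0 r) g"
  using der by (meson continuous_at_imp_continuous_on has_derivative_continuous)

lemma radial_cont1:
  "continuous_on (ball 0 r \<times> {0..1}) (\<lambda>(p, t). g (t *\<^sub>R p))"
proof -
  have "continuous_on (ball 0 r \<times> {0..1}) (\<lambda>x. g (snd x *\<^sub>R fst x))"
    by (rule continuous_on_compose2[OF radial_cont_g])
      (intro continuous_intros, use scaleR_in_ball_0 in fastforce)
  then show ?thesis by (simp add: split_beta)
qed

lemma radial_cont2:
  "continuous_on (ball 0 r \<times> {0..1}) (\<lambda>(p, t). g' (t *\<^sub>R p))"
proof -
  have "continuous_on (ball 0 r \<times> {0..1}) (\<lambda>x. g' (snd x *\<^sub>R fst x))"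
    by (rule continuous_on_compose2[OF cont])
      (intro continuous_intros, use scaleR_in_ball_0 in fastforce)
  then show ?thesis by (simp add: split_beta)
qed

lemma radial_cont3:
  "continuous_on (ball 0 r \<times> {0..1})
     (\<lambda>(p, t). g (t *\<^sub>R p) + t *\<^sub>R (blinfun.prod_left p o\<^sub>L g' (t *\<^sub>R p)))"
  using radial_cont1 radial_cont2 by (auto simp: split_beta intro!: continuous_intros)

lemma radial_fixed_cont:
  assumes "p \<in> ball 0 r"
  shows "continuous_on {0..1} (\<lambda>t. g (t *\<^sub>R p))" "continuous_on {0..1} (\<lambda>t. g' (t *\<^sub>R p))"
proof -
  have *: "(\<lambda>t. t *\<^sub>R p) ` {0..1} \<subseteq> ball 0 r"
    using scaleR_in_ball_0[OF assms] by blast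
  show "continuous_on {0..1} (\<lambda>t. g (t *\<^sub>R p))"
    by (rule continuous_on_compose2[OF radial_cont_g _ *]) (intro continuous_intros)
  show "continuous_on {0..1} (\<lambda>t. g' (t *\<^sub>R p))"
    by (rule continuous_on_compose2[OF cont _ *]) (intro continuous_intros)
qed

lemma has_derivative_radial_integral:
  assumes p: "p \<in> ball 0 r"
  shows "(radial_integral g has_derivative blinfun_apply (radial_integral_deriv g g' p)) (at p)"
proof -
  let ?fx = "\<lambda>p t. g (t *\<^sub>R p) + t *\<^sub>R (blinfun.prod_left p o\<^sub>L g' (t *\<^sub>R p))"
  have fx: "((\<lambda>x. blinfun_apply (g (t *\<^sub>R x)) x) has_derivative blinfun_apply (?fx x t)) (at x within ball 0 r)"
    if x: "x \<in> ball 0 r" and t: "t \<in> cbox 0 1" for x t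
  proof -
    have "((\<lambda>x. g (t *\<^sub>R x)) has_derivative (\<lambda>X. g' (t *\<^sub>R x) (t *\<^sub>R X))) (at x within ball 0 r)"
      by (rule has_derivative_compose[where f="\<lambda>x. t *\<^sub>R x" and g=g, OF _ der])
        (use scaleR_in_ball_0[OF x, of t] t in \<open>auto intro!: has_derivative_scaleR_right\<close>)
    then show ?thesis
      by (auto intro!: derivative_eq_intros simp: blinfun.bilinear_simps fun_eq_iff)
  qed
  have "((\<lambda>x. integral (cbox 0 1) (\<lambda>t. blinfun_apply (g (t *\<^sub>R x)) x))
      has_derivative integral (cbox 0 1) (?fx p)) (at p within ball 0 r)"
  proof (rule leibniz_rule[where U="ball 0 r" and f="\<lambda>x t. blinfun_apply (g (t *\<^sub>R x)) x" and fx="?fx"])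
    show "((\<lambda>x. blinfun_apply (g (t *\<^sub>R x)) x) has_derivative blinfun_apply (?fx x t)) (at x within ball 0 r)"
      if "x \<in> ball 0 r" "t \<in> cbox 0 1" for x t
      using fx that by blast
    show "(\<lambda>t. blinfun_apply (g (t *\<^sub>R x)) x) integrable_on cbox 0 1" if "x \<in> ball 0 r" for x
      using radial_fixed_cont(1)[OF that]
      by (auto intro!: integrable_continuous_real continuous_intros)
  qed (use radial_cont3 p in auto)
  moreover have "at p within ball 0 r = at p"
    using p by (intro at_within_open) auto
  ultimately show ?thesis
    by (simp add: radial_integral_def[abs_def] radial_integral_deriv_def)
qed

lemma continuous_on_radial_integral_deriv:
  "continuous_on (ball 0 r) (radial_integral_deriv g g')"
  using integral_continuous_on_param[of "ball 0 r" 0 1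
      "\<lambda>p t. g (t *\<^sub>R p) + t *\<^sub>R (blinfun.prod_left p o\<^sub>L g' (t *\<^sub>R p))"] radial_cont3
  by (simp add: radial_integral_deriv_def[abs_def])

lemma norm_radial_integral_le:
  assumes p: "p \<in> ball 0 r" and a: "\<And>q. q \<in> ball 0 r \<Longrightarrow> norm (g q) \<le> a"
  shows "norm (radial_integral g p) \<le> r * a"
proof -
  have "norm (radial_integral g p) \<le> r * a * (1 - 0)"
    unfolding radial_integral_def
  proof (rule integral_bound)
    show "continuous_on {0..1} (\<lambda>t. blinfun_apply (g (t *\<^sub>R p)) p)"
      using radial_fixed_cont(1)[OF p] by (auto intro!: continuous_intros)
    fix t :: real assume t: "t \<in> {0..1}"
    have "norm (blinfun_apply (g (t *\<^sub>R p)) p) \<le> norm (g (t *\<^sub>R p)) * norm p"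
      by (rule norm_blinfun)
    also have "\<dots> \<le> a * r"
      using a[OF scaleR_in_ball_0[OF p t]] p order_trans[OF norm_ge_zero a[OF scaleR_in_ball_0[OF p t]]]
      by (intro mult_mono) auto
    finally show "norm (blinfun_apply (g (t *\<^sub>R p)) p) \<le> r * a" by (simp add: mult.commute)
  qed auto
  then show ?thesis by simp
qed

lemma norm_radial_integral_deriv_le:
  assumes p: "p \<in> ball 0 r" and a: "\<And>q. q \<in> ball 0 r \<Longrightarrow> norm (g q) \<le> a"
    and b: "\<And>q. q \<in> ball 0 r \<Longrightarrow> norm (g' q) \<le> b"
  shows "norm (radial_integral_deriv g g' p) \<le> a + r * b"
proof -
  have "norm (radial_integral_deriv g g' p) \<le> (a + r * b) * (1 - 0)"
    unfolding radial_integral_deriv_def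
  proof (rule integral_bound)
    show "continuous_on {0..1} (\<lambda>t. g (t *\<^sub>R p) + t *\<^sub>R (blinfun.prod_left p o\<^sub>L g' (t *\<^sub>R p)))"
      using radial_fixed_cont[OF p] by (auto intro!: continuous_intros)
    fix t :: real assume t: "t \<in> {0..1}"
    have np: "norm (blinfun.prod_left p :: ('a \<Rightarrow>\<^sub>L 'e) \<Rightarrow>\<^sub>L 'e) \<le> norm p"
      by (rule norm_blinfun_bound) (use norm_blinfun in \<open>auto simp: mult.commute\<close>)
    have "norm (blinfun.prod_left p o\<^sub>L g' (t *\<^sub>R p)) \<le> norm p * norm (g' (t *\<^sub>R p))"
      by (rule order_trans[OF norm_blinfun_compose]) (use np in \<open>auto intro!: mult_right_mono\<close>)
    also have "\<dots> \<le> r * b"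
      using b[OF scaleR_in_ball_0[OF p t]] p order_trans[OF norm_ge_zero[of p], of r]
      by (intro mult_mono) (auto intro: order_trans[OF norm_ge_zero])
    finally have 1: "norm (blinfun.prod_left p o\<^sub>L g' (t *\<^sub>R p)) \<le> r * b" .
    have "norm (t *\<^sub>R (blinfun.prod_left p o\<^sub>L g' (t *\<^sub>R p))) \<le> 1 * (r * b)"
      unfolding norm_scaleR using t 1 by (intro mult_mono) auto
    then show "norm (g (t *\<^sub>R p) + t *\<^sub>R (blinfun.prod_left p o\<^sub>L g' (t *\<^sub>R p))) \<le> a + r * b"
      using a[OF scaleR_in_ball_0[OF p t]] by (intro norm_triangle_mono) auto
  qed auto
  then show ?thesis by simp
qed

text \<open>The radial integral is a primitive of \<open>g\<close> up to the exterior derivative of \<open>g\<close>.\<close>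

lemma radial_integral_deriv_apply:
  assumes p: "p \<in> ball 0 r"
  shows "((\<lambda>t. t *\<^sub>R (g' (t *\<^sub>R p) X p - g' (t *\<^sub>R p) p X)) has_integral
          radial_integral_deriv g g' p X - g p X) {0..1}"
proof -
  let ?fx = "\<lambda>t. g (t *\<^sub>R p) + t *\<^sub>R (blinfun.prod_left p o\<^sub>L g' (t *\<^sub>R p))"
  have "continuous_on {0..1} ?fx"
    using radial_fixed_cont[OF p] by (auto intro!: continuous_intros)
  then have "?fx integrable_on {0..1}"
    by (rule integrable_continuous_real)
  then have "(?fx has_integral radial_integral_deriv g g' p) {0..1}"
    by (simp add: radial_integral_deriv_def has_integral_integral)
  from has_integral_linear[OF this blinfun.bounded_linear_left[of X]]
  have 1: "((\<lambda>t. g (t *\<^sub>R p) X + t *\<^sub>R g' (t *\<^sub>R p) X p) has_integral radial_integral_deriv g g' p X) {0..1}"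
    by (simp add: o_def blinfun.bilinear_simps)
  \<comment> \<open>This integrand is the derivative of
    \<open>t *\<^sub>R g (t *\<^sub>R p) X\<close>, so it integrates to \<open>g p X\<close>. Its
    difference from the integrand of \<open>1\<close> is the antisymmetrised derivative of
    \<open>g\<close>.\<close>
  have 2: "((\<lambda>t. g (t *\<^sub>R p) X + t *\<^sub>R g' (t *\<^sub>R p) p X) has_integral
     (1 *\<^sub>R g (1 *\<^sub>R p) X - 0 *\<^sub>R g (0 *\<^sub>R p) X)) {0..1}"
  proof (rule fundamental_theorem_of_calculus)
    fix t :: real assume t: "t \<in> {0..1}"
    have "((\<lambda>t. g (t *\<^sub>R p)) has_derivative (\<lambda>s. g' (t *\<^sub>R p) (s *\<^sub>R p))) (at t within {0..1})"
      by (rule has_derivative_compose[where f="\<lambda>t. t *\<^sub>R p" and g=g, OF _ der[OF scaleR_in_ball_0[OF p t]]])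
        (auto intro!: derivative_eq_intros)
    then show "((\<lambda>t. t *\<^sub>R g (t *\<^sub>R p) X) has_vector_derivative g (t *\<^sub>R p) X + t *\<^sub>R g' (t *\<^sub>R p) p X) (at t within {0..1})"
      unfolding has_vector_derivative_def
      by (auto intro!: derivative_eq_intros simp: blinfun.bilinear_simps fun_eq_iff algebra_simps)
  qed auto
  from has_integral_diff[OF 1 2] show ?thesis
    by (simp add: algebra_simps)
qed

end

text \<open>The assumption \<open>flat\<close> is the integrability condition d\<omega> + \<omega>
  \<and> \<omega> = 0, tested on every \<open>w\<close>. A Picard series solves the integral
  equation v = v0 + K (B v \<omega>) with K the radial integral, but this prescribes the derivative
  of v along rays only. Flatness supplies the other directions: the defect v' - B v \<omega>
  satisfies a homogeneous integral equation and must vanish. The bound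
  \<open>r * Q \<le> 1/8\<close> makes both iterations contract by 1/2.\<close>

lemma linear_frobenius_small_ball:
  fixes B :: "'e::banach \<Rightarrow> 'f::real_normed_vector \<Rightarrow> ('a::banach \<Rightarrow>\<^sub>L 'e)"
    and \<omega> :: "'a \<Rightarrow> 'f" and \<omega>' :: "'a \<Rightarrow> 'a \<Rightarrow>\<^sub>L 'f"
  assumes B: "bounded_bilinear B"
    and r: "0 < r" and Q: "1 \<le> Q" "r * Q \<le> 1/8"
    and der: "\<And>p. p \<in> ball 0 r \<Longrightarrow> (\<omega> has_derivative blinfun_apply (\<omega>' p)) (at p)"
    and cont: "continuous_on (ball 0 r) \<omega>'"
    and Q1: "\<And>p w. p \<in> ball 0 r \<Longrightarrow> norm (B w (\<omega> p)) \<le> Q * norm w"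
    and Q2: "\<And>p w X. p \<in> ball 0 r \<Longrightarrow> norm (B w (\<omega>' p X)) \<le> Q * norm w * norm X"
    and flat: "\<And>p w X Y. p \<in> ball 0 r \<Longrightarrow>
      B w (\<omega>' p X) Y + B (B w (\<omega> p) X) (\<omega> p) Y = B w (\<omega>' p Y) X + B (B w (\<omega> p) Y) (\<omega> p) X"
  shows "\<exists>v. v 0 = v0 \<and> (\<forall>p\<in>ball 0 r. (v has_derivative blinfun_apply (B (v p) (\<omega> p))) (at p))"
proof -
  interpret B: bounded_bilinear B by fact
  define U where "U = ball (0::'a) r"
  define G where "G = (\<lambda>u p. B (u p) (\<omega> p))"
  define G' where "G' = (\<lambda>u u' p. (B.prod_left (\<omega> p) o\<^sub>L u' p) + (B.prod_right (u p) o\<^sub>L \<omega>' p))"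
  have G': "(G u has_derivative blinfun_apply (G' u u' p)) (at p)"
    if "p \<in> U" "(u has_derivative blinfun_apply (u' p)) (at p)" for u u' p
    unfolding G_def using B.FDERIV[OF that(2) der] that(1)
    by (auto simp: G'_def U_def blinfun.bilinear_simps add.commute fun_eq_iff
        elim!: has_derivative_eq_rhs)
  have contw: "continuous_on U \<omega>"
    unfolding U_def using der by (meson continuous_at_imp_continuous_on has_derivative_continuous)
  have contw': "continuous_on U \<omega>'"
    unfolding U_def by (rule cont)
  have contG': "continuous_on U (G' u u')"
    if "continuous_on U u" "continuous_on U u'" for u u'
    unfolding G'_def using that contw contw' by (intro continuous_intros)
  have nG: "norm (G u p) \<le> Q * norm (u p)" if "p \<in> U" for u p
    using Q1 that by (simp add: G_def U_def)
  have nG': "norm (G' u u' p) \<le> Q * norm (u' p) + Q * norm (u p)" if p: "p \<in> U" for u u' p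
  proof (rule norm_blinfun_bound)
    fix X
    have "norm (B (u' p X) (\<omega> p)) \<le> Q * (norm (u' p) * norm X)"
      by (rule order_trans[OF Q1]) (use p Q norm_blinfun in \<open>auto simp: U_def intro!: mult_left_mono\<close>)
    moreover have "norm (B (u p) (\<omega>' p X)) \<le> Q * norm (u p) * norm X"
      using Q2 p by (auto simp: U_def)
    ultimately show "norm (G' u u' p X) \<le> (Q * norm (u' p) + Q * norm (u p)) * norm X"
      by (auto simp: G'_def blinfun.bilinear_simps algebra_simps intro!: norm_triangle_le)
  qed (use Q in auto)
  \<comment> \<open>Each iterate is carried together with its derivative, since
    \<open>radial_integral_deriv\<close> needs the derivative of the previous integrand.\<close>
  define uu where "uu = rec_nat ((\<lambda>_. v0), (\<lambda>_. 0))
     (\<lambda>_ (u, u'). (radial_integral (G u), radial_integral_deriv (G u) (G' u u')))"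
  define u where "u n = fst (uu n)" for n
  define u' where "u' n = snd (uu n)" for n
  have u0: "u 0 = (\<lambda>_. v0)" "u' 0 = (\<lambda>_. 0)" by (auto simp: u_def u'_def uu_def)
  have uS: "u (Suc n) = radial_integral (G (u n))"
    "u' (Suc n) = radial_integral_deriv (G (u n)) (G' (u n) (u' n))" for n
    by (auto simp: u_def u'_def uu_def split_beta)
  \<comment> \<open>The factor 8 closes the induction: with C = \<open>norm v0 * (1/2)^n\<close> the
    new derivative is at most Q C + (8 Q C + C) / 8, hence at most 4 Q C because
    \<open>1 \<le> Q\<close>, and 4 Q C is half of 8 Q C.\<close>
  have I: "(\<forall>p\<in>U. (u n has_derivative blinfun_apply (u' n p)) (at p)) \<and> continuous_on U (u' n) \<and>
      (\<forall>p\<in>U. norm (u n p) \<le> norm v0 * (1/2)^n) \<and>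
      (\<forall>p\<in>U. norm (u' n p) \<le> 8 * Q * norm v0 * (1/2)^n)" for n
  proof (induction n)
    case 0
    then show ?case using Q by (auto simp: u0 zero_blinfun.rep_eq intro!: derivative_eq_intros)
  next
    case (Suc n)
    define C where "C = norm v0 * (1/2)^n"
    have C0: "0 \<le> C" by (simp add: C_def)
    have d: "\<And>p. p \<in> ball 0 r \<Longrightarrow> (G (u n) has_derivative blinfun_apply (G' (u n) (u' n) p)) (at p)"
      using G' Suc by (auto simp: U_def)
    have cu: "continuous_on U (u n)"
      using Suc by (meson continuous_at_imp_continuous_on has_derivative_continuous)
    have c: "continuous_on (ball 0 r) (G' (u n) (u' n))"
      using contG'[OF cu] Suc by (auto simp: U_def)
    have b1: "norm (G (u n) p) \<le> Q * C" if "p \<in> ball 0 r" for p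
      by (rule order_trans[OF nG]) (use that Suc Q in \<open>auto simp: U_def C_def intro!: mult_left_mono\<close>)
    have b2: "norm (G' (u n) (u' n) p) \<le> Q * (8 * Q * C) + Q * C" if "p \<in> ball 0 r" for p
      by (rule order_trans[OF nG'])
        (use that Suc Q in \<open>auto simp: U_def C_def mult.assoc intro!: mult_left_mono add_mono\<close>)
    have e1: "norm (u (Suc n) p) \<le> norm v0 * (1/2)^Suc n" if p: "p \<in> U" for p
    proof -
      have "norm (u (Suc n) p) \<le> r * (Q * C)"
        unfolding uS by (rule norm_radial_integral_le[OF d c _ b1]) (use p in \<open>auto simp: U_def\<close>)
      also have "\<dots> \<le> 1/8 * C"
        using mult_right_mono[OF Q(2) C0] by (simp add: mult.assoc)
      also have "\<dots> \<le> norm v0 * (1/2)^Suc n" using C0 by (simp add: C_def)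
      finally show ?thesis .
    qed
    have e2: "norm (u' (Suc n) p) \<le> 8 * Q * norm v0 * (1/2)^Suc n" if p: "p \<in> U" for p
    proof -
      have "norm (u' (Suc n) p) \<le> Q * C + r * (Q * (8 * Q * C) + Q * C)"
        unfolding uS by (rule norm_radial_integral_deriv_le[OF d c _ b1 b2]) (use p in \<open>auto simp: U_def\<close>)
      also have "\<dots> = Q * C + (r * Q) * (8 * Q * C + C)" by (simp add: algebra_simps)
      also have "\<dots> \<le> Q * C + 1/8 * (8 * Q * C + C)"
        using C0 Q by (intro add_left_mono mult_right_mono) auto
      also have "\<dots> \<le> 4 * (Q * C)"
        using mult_right_mono[OF Q(1) C0] C0 by (simp only: distrib_left)
      also have "\<dots> = 8 * Q * norm v0 * (1/2)^Suc n" by (simp add: C_def)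
      finally show ?thesis .
    qed
    have "\<forall>p\<in>U. (u (Suc n) has_derivative blinfun_apply (u' (Suc n) p)) (at p)"
      unfolding uS U_def using has_derivative_radial_integral[OF d c] by blast
    moreover have "continuous_on U (u' (Suc n))"
      unfolding uS U_def by (rule continuous_on_radial_integral_deriv[OF d c])
    ultimately show ?case using e1 e2 by blast
  qed
  have sm: "summable (\<lambda>n. norm v0 * (1/2)^n :: real)" "summable (\<lambda>n. 8 * Q * norm v0 * (1/2)^n :: real)"
    by (auto intro!: summable_mult summable_geometric)
  define v' where "v' = (\<lambda>p. \<Sum>n. u' n p)"
  have ul': "uniform_limit U (\<lambda>n p. \<Sum>i<n. u' i p) v' sequentially"
    unfolding v'_def by (rule Weierstrass_m_test[OF _ sm(2)]) (use I in auto)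
  have z: "0 \<in> U" using r by (simp add: U_def)
  have nle: "\<forall>\<^sub>F n in sequentially. \<forall>x\<in>U. \<forall>h. norm (sum (\<lambda>i. u' i x h) {..<n} - v' x h) \<le> e * norm h"
    if "e > 0" for e
  proof -
    have "\<forall>\<^sub>F n in sequentially. \<forall>x\<in>U. norm ((\<Sum>i<n. u' i x) - v' x) < e"
      using uniform_limitD[OF ul' that] by (simp add: dist_norm)
    then show ?thesis
    proof eventually_elim
      case (elim n)
      show ?case
      proof (intro ballI allI)
        fix x h assume x: "x \<in> U"
        have "norm (sum (\<lambda>i. u' i x h) {..<n} - v' x h) = norm (((\<Sum>i<n. u' i x) - v' x) h)"
          by (simp add: blinfun.bilinear_simps blinfun.sum_left)
        also have "\<dots> \<le> norm ((\<Sum>i<n. u' i x) - v' x) * norm h" by (rule norm_blinfun)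
        also have "\<dots> \<le> e * norm h" using elim x by (intro mult_right_mono) (auto intro: less_imp_le)
        finally show "norm (sum (\<lambda>i. u' i x h) {..<n} - v' x h) \<le> e * norm h" .
      qed
    qed
  qed
  have "summable (\<lambda>n. u n 0)"
    by (rule summable_comparison_test'[OF sm(1), of 0]) (use I z in auto)
  then have "\<exists>g. \<forall>x\<in>U. (\<lambda>n. u n x) sums g x \<and> (g has_derivative blinfun_apply (v' x)) (at x within U)"
    by (intro has_derivative_series[OF _ _ nle z])
      (use I in \<open>auto simp: U_def summable_sums intro: has_derivative_at_withinI\<close>)
  then obtain v where v: "\<And>x. x \<in> U \<Longrightarrow> (\<lambda>n. u n x) sums v x"
    and dv0: "\<And>x. x \<in> U \<Longrightarrow> (v has_derivative blinfun_apply (v' x)) (at x within U)" by auto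
  have dv: "(v has_derivative blinfun_apply (v' x)) (at x)" if "x \<in> U" for x
    using dv0[OF that] that by (metis U_def at_within_open open_ball)
  have cv: "continuous_on U v"
    using dv by (meson continuous_at_imp_continuous_on has_derivative_continuous)
  have cv': "continuous_on U v'"
    by (rule uniform_limit_theorem[OF _ ul']) (use I in \<open>auto intro!: always_eventually continuous_on_sum\<close>)
  have veq: "v x = (\<Sum>n. u n x)" if "x \<in> U" for x using v[OF that] by (simp add: sums_iff)
  have ulv: "uniform_limit U (\<lambda>n p. \<Sum>i<n. u i p) (\<lambda>x. \<Sum>n. u n x) sequentially"
    by (rule Weierstrass_m_test[OF _ sm(1)]) (use I in auto)
  have Gd: "\<And>p. p \<in> ball 0 r \<Longrightarrow> (G v has_derivative blinfun_apply (G' v v' p)) (at p)"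
    using G' dv by (auto simp: U_def)
  have Gc: "continuous_on (ball 0 r) (G' v v')"
    using contG' cv cv' by (auto simp: U_def)
  have cu: "continuous_on U (u n)" for n
    using I by (meson continuous_at_imp_continuous_on has_derivative_continuous)
  have fixp: "v p = v0 + radial_integral (G v) p" if p: "p \<in> U" for p
  proof -
    \<comment> \<open>The term \<open>u 0\<close> contributes \<open>v0\<close>, which shifts the
      index: n + 1 terms of the series match n terms under the integral.\<close>
    have Sn: "(\<Sum>i<Suc n. u i p) = v0 + integral {0..1} (\<lambda>t. \<Sum>i<n. G (u i) (t *\<^sub>R p) p)" for n
    proof -
      have "integral {0..1} (\<lambda>t. \<Sum>i<n. G (u i) (t *\<^sub>R p) p) = (\<Sum>i<n. integral {0..1} (\<lambda>t. G (u i) (t *\<^sub>R p) p))"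
      proof (rule integral_sum)
        fix i
        have "continuous_on {0..1} (\<lambda>t. G (u i) (t *\<^sub>R p))"
          by (rule radial_fixed_cont(1)[where g="G (u i)" and g'="G' (u i) (u' i)" and r=r])
            (use p I G' contG' cu in \<open>auto simp: U_def\<close>)
        then show "(\<lambda>t. G (u i) (t *\<^sub>R p) p) integrable_on {0..1}"
          by (intro integrable_continuous_real continuous_intros)
      qed auto
      then show ?thesis
        by (simp add: sum.lessThan_Suc_shift u0 uS radial_integral_def del: sum.lessThan_Suc)
    qed
    have "(\<lambda>n. integral {0..1} (\<lambda>t. \<Sum>i<n. G (u i) (t *\<^sub>R p) p)) \<longlonglongrightarrow> radial_integral (G v) p"
      unfolding radial_integral_def
    proof (rule tendstoI)
      fix e :: real assume e: "e > 0"
      \<comment> \<open>Chosen so that \<open>Q * e1 * norm p\<close> stays below e/2; adding 1 to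
        \<open>norm p\<close> keeps the denominator positive at \<open>p = 0\<close>.\<close>
      define e1 where "e1 = e / (2 * Q * (norm p + 1))"
      have e1: "e1 > 0" using e Q by (auto simp: e1_def intro!: divide_pos_pos mult_pos_pos add_nonneg_pos)
      have "\<forall>\<^sub>F n in sequentially. \<forall>x\<in>U. dist (\<Sum>i<n. u i x) (\<Sum>n. u n x) < e1"
        by (rule uniform_limitD[OF ulv e1])
      then show "\<forall>\<^sub>F n in sequentially. dist (integral {0..1} (\<lambda>t. \<Sum>i<n. G (u i) (t *\<^sub>R p) p))
              (integral {0..1} (\<lambda>t. G v (t *\<^sub>R p) p)) < e"
      proof eventually_elim
        case (elim n)
        have tU: "t *\<^sub>R p \<in> U" if "t \<in> {0..1}" for t
          using scaleR_in_ball_0[OF _ that] p by (auto simp: U_def)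
        have c1: "continuous_on {0..1} (\<lambda>t. G (u i) (t *\<^sub>R p) p)" for i
        proof -
          have "continuous_on {0..1} (\<lambda>t. G (u i) (t *\<^sub>R p))"
            by (rule radial_fixed_cont(1)[where g="G (u i)" and g'="G' (u i) (u' i)" and r=r])
              (use p I G' contG' cu in \<open>auto simp: U_def\<close>)
          then show ?thesis by (intro continuous_intros)
        qed
        have c2: "continuous_on {0..1} (\<lambda>t. G v (t *\<^sub>R p) p)"
        proof -
          have "continuous_on {0..1} (\<lambda>t. G v (t *\<^sub>R p))"
            by (rule radial_fixed_cont(1)[OF Gd Gc]) (use p in \<open>auto simp: U_def\<close>)
          then show ?thesis by (intro continuous_intros)
        qed
        have "integral {0..1} (\<lambda>t. \<Sum>i<n. G (u i) (t *\<^sub>R p) p) - integral {0..1} (\<lambda>t. G v (t *\<^sub>R p) p)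
          = integral {0..1} (\<lambda>t. (\<Sum>i<n. G (u i) (t *\<^sub>R p) p) - G v (t *\<^sub>R p) p)"
          by (rule integral_diff[symmetric]; intro integrable_continuous_real continuous_on_sum c1 c2)
        also have "norm \<dots> \<le> Q * e1 * norm p * (1 - 0)"
        proof (rule integral_bound)
          show "continuous_on {0..1} (\<lambda>t. (\<Sum>i<n. G (u i) (t *\<^sub>R p) p) - G v (t *\<^sub>R p) p)"
            by (intro continuous_on_diff continuous_on_sum c1 c2)
          fix t :: real assume t: "t \<in> {0..1}"
          have "(\<Sum>i<n. G (u i) (t *\<^sub>R p) p) - G v (t *\<^sub>R p) p =
              B ((\<Sum>i<n. u i (t *\<^sub>R p)) - v (t *\<^sub>R p)) (\<omega> (t *\<^sub>R p)) p"
            by (simp add: G_def B.diff_left B.sum_left blinfun.diff_left blinfun.sum_left)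
          also have "norm \<dots> \<le> norm (B ((\<Sum>i<n. u i (t *\<^sub>R p)) - v (t *\<^sub>R p)) (\<omega> (t *\<^sub>R p))) * norm p"
            by (rule norm_blinfun)
          also have "\<dots> \<le> Q * e1 * norm p"
          proof (rule mult_right_mono)
            have "norm ((\<Sum>i<n. u i (t *\<^sub>R p)) - v (t *\<^sub>R p)) \<le> e1"
              using elim tU[OF t] by (auto simp: veq dist_norm intro: less_imp_le)
            then show "norm (B ((\<Sum>i<n. u i (t *\<^sub>R p)) - v (t *\<^sub>R p)) (\<omega> (t *\<^sub>R p))) \<le> Q * e1"
              using Q1[of "t *\<^sub>R p"] tU[OF t] Q unfolding U_def
              by (meson mult_left_mono order_trans zero_le_one)
          qed auto
          finally show "norm ((\<Sum>i<n. G (u i) (t *\<^sub>R p) p) - G v (t *\<^sub>R p) p) \<le> Q * e1 * norm p" .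
        qed auto
        also have "\<dots> < e"
        proof -
          have np: "norm p + 1 > 0" by (simp add: add_nonneg_pos)
          have "Q * e1 * norm p \<le> Q * e1 * (norm p + 1)" using Q e1 by (intro mult_left_mono) auto
          also have "\<dots> = e / 2" using Q np by (simp add: e1_def del: distrib_left_numeral distrib_right_numeral)
          finally show ?thesis using e by simp
        qed
        finally show ?case by (simp add: dist_norm)
      qed
    qed
    then have "(\<lambda>n. \<Sum>i<Suc n. u i p) \<longlonglongrightarrow> v0 + radial_integral (G v) p"
      unfolding Sn by (intro tendsto_intros)
    moreover have "(\<lambda>n. \<Sum>i<Suc n. u i p) \<longlonglongrightarrow> v p"
      using v[OF p] unfolding sums_def by (rule LIMSEQ_Suc)
    ultimately show ?thesis using LIMSEQ_unique by blast
  qed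
  have v'eq: "v' p = radial_integral_deriv (G v) (G' v v') p" if p: "p \<in> U" for p
  proof -
    have "((\<lambda>p. v0 + radial_integral (G v) p) has_derivative
        blinfun_apply (radial_integral_deriv (G v) (G' v v') p)) (at p)"
      using has_derivative_radial_integral[OF Gd Gc, of p] p
      by (auto simp: U_def intro!: derivative_eq_intros)
    then have "(v has_derivative blinfun_apply (radial_integral_deriv (G v) (G' v v') p)) (at p)"
      by (rule has_derivative_transform_within_open[of _ _ _ _ U]) (use p fixp in \<open>auto simp: U_def\<close>)
    with dv[OF p] have "blinfun_apply (v' p) = blinfun_apply (radial_integral_deriv (G v) (G' v v') p)"
      by (rule has_derivative_unique)
    then show ?thesis by (simp add: blinfun_apply_inject)
  qed
  define E where "E = (\<lambda>p. v' p - G v p)"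
  text \<open>By flatness the defect \<open>E\<close> satisfies a homogeneous integral equation, whose kernel is small.\<close>
  have Eint: "((\<lambda>t. t *\<^sub>R (B (E (t *\<^sub>R p) X) (\<omega> (t *\<^sub>R p)) p - B (E (t *\<^sub>R p) p) (\<omega> (t *\<^sub>R p)) X))
      has_integral E p X) {0..1}" if p: "p \<in> U" for p X
  proof -
    have "((\<lambda>t. t *\<^sub>R (G' v v' (t *\<^sub>R p) X p - G' v v' (t *\<^sub>R p) p X)) has_integral
          radial_integral_deriv (G v) (G' v v') p X - G v p X) {0..1}"
      by (rule radial_integral_deriv_apply[OF Gd Gc]) (use p in \<open>auto simp: U_def\<close>)
    \<comment> \<open>By \<open>flat\<close> the antisymmetrised terms with \<open>\<omega>'\<close>
      turn into terms with two factors \<open>\<omega>\<close>. These complete each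
      \<open>v'\<close> to \<open>v' - G v\<close>, which is \<open>E\<close>.\<close>
    moreover have "G' v v' q X p - G' v v' q p X = B (E q X) (\<omega> q) p - B (E q p) (\<omega> q) X"
      if "q \<in> U" for q
      using flat[of q "v q" X p] that
      by (simp add: G'_def E_def G_def U_def blinfun.bilinear_simps B.diff_left algebra_simps)
    moreover have "t *\<^sub>R p \<in> U" if "t \<in> {0..1}" for t
      using scaleR_in_ball_0[OF _ that] p by (auto simp: U_def)
    ultimately show ?thesis
      by (auto simp: E_def v'eq[OF p] blinfun.bilinear_simps elim!: has_integral_eq[rotated])
  qed
  \<comment> \<open>Each of the two terms of the kernel is bounded by Q M times the norms of
    \<open>X\<close> and \<open>p\<close>, so \<open>r * Q \<le> 1/8\<close> leaves at most a
    quarter of M. A bound that improves itself by a factor 1/2 forces \<open>E\<close> to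
    vanish.\<close>
  have Ebd: "norm (E p) \<le> M / 2" if p: "p \<in> U" and M: "\<And>q. q \<in> U \<Longrightarrow> norm (E q) \<le> M" for p M
  proof (rule norm_blinfun_bound)
    have M0: "0 \<le> M" using M[OF p] norm_ge_zero order_trans by blast
    then show "0 \<le> M / 2" by simp
    fix X
    have "norm (E p X) \<le> (M / 2 * norm X) * measure lborel (cbox 0 (1::real))"
    proof (rule has_integral_bound)
      show "((\<lambda>t. t *\<^sub>R (B (E (t *\<^sub>R p) X) (\<omega> (t *\<^sub>R p)) p - B (E (t *\<^sub>R p) p) (\<omega> (t *\<^sub>R p)) X))
         has_integral E p X) (cbox 0 1)" using Eint[OF p] by simp
      show "0 \<le> M / 2 * norm X" using M0 by simp
      fix t :: real assume "t \<in> cbox 0 1"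
      then have t: "t \<in> {0..1}" by simp
      define q where "q = t *\<^sub>R p"
      have q: "q \<in> U" using scaleR_in_ball_0[OF _ t] p by (auto simp: U_def q_def)
      have pr: "norm p \<le> r" using p by (simp add: U_def)
      have a: "norm (B (E q a) (\<omega> q) b) \<le> Q * M * norm a * norm b" for a b
      proof -
        have "norm (B (E q a) (\<omega> q) b) \<le> norm (B (E q a) (\<omega> q)) * norm b" by (rule norm_blinfun)
        also have "\<dots> \<le> (Q * norm (E q a)) * norm b"
          using Q1 q by (intro mult_right_mono) (auto simp: U_def)
        also have "\<dots> \<le> (Q * (M * norm a)) * norm b"
          using Q order_trans[OF norm_blinfun mult_right_mono[OF M[OF q] norm_ge_zero]]
          by (intro mult_right_mono mult_left_mono) auto
        finally show ?thesis by (simp add: mult.assoc)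
      qed
      have "norm (B (E q X) (\<omega> q) p - B (E q p) (\<omega> q) X) \<le> Q * M * norm X * norm p + Q * M * norm p * norm X"
        by (rule norm_triangle_le_diff) (intro add_mono a)
      also have "\<dots> = (2 * M * norm X) * (norm p * Q)" by (simp add: algebra_simps)
      also have "\<dots> \<le> (2 * M * norm X) * (1/8)"
        using M0 Q pr by (intro mult_left_mono order_trans[OF mult_right_mono[OF pr]]) auto
      also have "\<dots> \<le> M / 2 * norm X" using M0 by simp
      finally have 1: "norm (B (E q X) (\<omega> q) p - B (E q p) (\<omega> q) X) \<le> M / 2 * norm X" .
      have "norm (t *\<^sub>R (B (E q X) (\<omega> q) p - B (E q p) (\<omega> q) X)) \<le> 1 * (M / 2 * norm X)"
        unfolding norm_scaleR by (intro mult_mono 1) (use t in auto)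
      then show "norm (t *\<^sub>R (B (E (t *\<^sub>R p) X) (\<omega> (t *\<^sub>R p)) p - B (E (t *\<^sub>R p) p) (\<omega> (t *\<^sub>R p)) X))
         \<le> M / 2 * norm X"
        by (simp add: q_def)
    qed
    then show "norm (E p X) \<le> M / 2 * norm X" by simp
  qed
  obtain M where M: "\<And>q. q \<in> U \<Longrightarrow> norm (E q) \<le> M"
  proof
    fix q assume q: "q \<in> U"
    have "norm (v' q) \<le> (\<Sum>n. 8 * Q * norm v0 * (1/2)^n)"
      unfolding v'_def by (rule norm_suminf_le[OF _ sm(2)]) (use I q in auto)
    moreover have "norm (v q) \<le> (\<Sum>n. norm v0 * (1/2)^n)"
      unfolding veq[OF q] by (rule norm_suminf_le[OF _ sm(1)]) (use I q in auto)
    then have "norm (G v q) \<le> Q * (\<Sum>n. norm v0 * (1/2)^n)"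
      using order_trans[OF nG[OF q] mult_left_mono] Q by auto
    ultimately show "norm (E q) \<le> (\<Sum>n. 8 * Q * norm v0 * (1/2)^n) + Q * (\<Sum>n. norm v0 * (1/2)^n)"
      unfolding E_def by (intro norm_triangle_le_diff add_mono)
  qed
  have Mn: "\<forall>q\<in>U. norm (E q) \<le> M * (1/2)^n" for n
  proof (induction n)
    case (Suc n)
    then show ?case using Ebd[of _ "M * (1/2)^n"] by auto
  qed (use M in auto)
  have E0: "E q = 0" if "q \<in> U" for q
  proof -
    have "(\<lambda>n. M * (1/2)^n) \<longlonglongrightarrow> M * 0"
      by (intro tendsto_intros LIMSEQ_power_zero) auto
    then have "norm (E q) \<le> M * 0"
      by (rule LIMSEQ_le_const) (use Mn that in auto)
    then show ?thesis by simp
  qed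
  have "v 0 = v0" using fixp[OF z] by (simp add: radial_integral_def)
  moreover have "(v has_derivative blinfun_apply (B (v p) (\<omega> p))) (at p)" if "p \<in> ball 0 r" for p
    using dv[of p] E0[of p] that by (simp add: U_def E_def G_def)
  ultimately show ?thesis by blast
qed

text \<open>Continuity bounds \<omega> and its derivative near \<open>c\<close>, and translating
  \<open>c\<close> to 0 gives the case of a small ball. As the equation is linear, the radius
  depends on these bounds only, so one ball serves all initial values \<open>v0\<close>.\<close>

lemma linear_frobenius:
  fixes B :: "'e::banach \<Rightarrow> 'f::real_normed_vector \<Rightarrow> ('a::banach \<Rightarrow>\<^sub>L 'e)"
    and \<omega> :: "'a \<Rightarrow> 'f" and \<omega>' :: "'a \<Rightarrow> 'a \<Rightarrow>\<^sub>L 'f"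
  assumes B: "bounded_bilinear B"
    and V: "open V" "c \<in> V"
    and der: "\<And>p. p \<in> V \<Longrightarrow> (\<omega> has_derivative blinfun_apply (\<omega>' p)) (at p)"
    and cont: "continuous_on V \<omega>'"
    and flat: "\<And>p w X Y. p \<in> V \<Longrightarrow>
      B w (\<omega>' p X) Y + B (B w (\<omega> p) X) (\<omega> p) Y = B w (\<omega>' p Y) X + B (B w (\<omega> p) Y) (\<omega> p) X"
  obtains r where "r > 0" "ball c r \<subseteq> V"
    "\<And>v0. \<exists>v. v c = v0 \<and> (\<forall>p\<in>ball c r. (v has_derivative blinfun_apply (B (v p) (\<omega> p))) (at p))"
proof -
  interpret B: bounded_bilinear B by fact
  obtain K where K: "K > 0" "\<And>a b. norm (B a b) \<le> norm a * norm b * K"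
    using B.pos_bounded by blast
  define M where "M = max (norm (\<omega> c)) (norm (\<omega>' c)) + 1"
  have M: "M > 0" by (simp add: M_def add_nonneg_pos max_def)
  have "isCont \<omega> c" using der V has_derivative_continuous by blast
  then have "\<forall>\<^sub>F p in nhds c. norm (\<omega> p) < M"
    by (intro order_tendstoD(2)[OF tendsto_norm]) (auto simp: M_def isCont_def tendsto_at_iff_tendsto_nhds)
  moreover have "isCont \<omega>' c" using cont V by (simp add: continuous_on_eq_continuous_at)
  then have "\<forall>\<^sub>F p in nhds c. norm (\<omega>' p) < M"
    by (intro order_tendstoD(2)[OF tendsto_norm]) (auto simp: M_def isCont_def tendsto_at_iff_tendsto_nhds)
  moreover have "\<forall>\<^sub>F p in nhds c. p \<in> V" using V by (rule eventually_nhds_in_open)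
  ultimately have "\<forall>\<^sub>F p in nhds c. norm (\<omega> p) < M \<and> norm (\<omega>' p) < M \<and> p \<in> V"
    by eventually_elim auto
  then obtain d where d: "d > 0" "\<And>p. p \<in> ball c d \<Longrightarrow> norm (\<omega> p) < M \<and> norm (\<omega>' p) < M \<and> p \<in> V"
    unfolding eventually_nhds_metric by (auto simp: dist_commute)
  \<comment> \<open>The summand \<open>M * K\<close> bounds the action of \<omega> and of its
    derivative; the summand 1 secures \<open>1 \<le> Q\<close>.\<close>
  define Q where "Q = 1 + M * K"
  have Q: "1 \<le> Q" "M * K \<le> Q" using M K by (auto simp: Q_def)
  define r where "r = min d (1 / (8 * Q))"
  have r: "r > 0" "r \<le> d" using d Q by (auto simp: r_def)
  have "r * Q \<le> 1 / (8 * Q) * Q" using Q by (intro mult_right_mono) (auto simp: r_def)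
  then have rQ: "r * Q \<le> 1/8" using Q by simp
  have inV: "p + c \<in> V" "norm (\<omega> (p + c)) \<le> M" "norm (\<omega>' (p + c)) \<le> M" if "p \<in> ball 0 r" for p :: 'a
    using d(2)[of "p + c"] r that by (auto simp: dist_norm intro: less_imp_le)
  have "\<exists>v. v 0 = v0 \<and> (\<forall>p\<in>ball 0 r. (v has_derivative blinfun_apply (B (v p) (\<omega> (p + c)))) (at p))" for v0
  proof (rule linear_frobenius_small_ball[OF B r(1) Q(1) rQ, where \<omega>'="\<lambda>p. \<omega>' (p + c)"])
    fix p :: 'a assume p: "p \<in> ball 0 r"
    show "((\<lambda>p. \<omega> (p + c)) has_derivative blinfun_apply (\<omega>' (p + c))) (at p)"
      by (rule has_derivative_eq_rhs, rule has_derivative_compose[where f="\<lambda>p. p + c", OF _ der[OF inV(1)[OF p]]])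
        (auto intro!: derivative_eq_intros)
    fix w :: 'e
    have "norm w * norm (\<omega> (p + c)) * K \<le> norm w * M * K"
      using K inV[OF p] by (intro mult_right_mono mult_left_mono) auto
    also have "\<dots> = (M * K) * norm w" by simp
    also have "\<dots> \<le> Q * norm w" using Q by (intro mult_right_mono) auto
    finally show "norm (B w (\<omega> (p + c))) \<le> Q * norm w" using K(2) order_trans by blast
    fix X :: 'a
    have "norm (\<omega>' (p + c) X) \<le> M * norm X"
      using inV(3)[OF p] norm_blinfun order_trans mult_right_mono by (metis norm_ge_zero)
    then have "norm w * norm (\<omega>' (p + c) X) * K \<le> norm w * (M * norm X) * K"
      using K by (intro mult_right_mono mult_left_mono) auto
    also have "\<dots> = (M * K) * (norm w * norm X)" by simp
    also have "\<dots> \<le> Q * (norm w * norm X)" using Q by (intro mult_right_mono) auto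
    finally have "norm w * norm (\<omega>' (p + c) X) * K \<le> Q * norm w * norm X" by (simp add: mult.assoc)
    then show "norm (B w (\<omega>' (p + c) X)) \<le> Q * norm w * norm X" using K(2) order_trans by blast
  next
    show "continuous_on (ball (0::'a) r) (\<lambda>p. \<omega>' (p + c))"
      by (rule continuous_on_compose2[OF cont]) (use inV in \<open>auto intro!: continuous_intros\<close>)
  qed (use flat inV in auto)
  note ex = this
  show thesis
  proof (rule that[OF r(1)])
    show "ball c r \<subseteq> V" using d(2) r by force
    fix v0
    obtain v where v: "v 0 = v0" "\<And>p. p \<in> ball 0 r \<Longrightarrow> (v has_derivative blinfun_apply (B (v p) (\<omega> (p + c)))) (at p)"
      using ex by blast
    have "((\<lambda>p. v (p - c)) has_derivative blinfun_apply (B (v (p - c)) (\<omega> p))) (at p)" if "p \<in> ball c r" for p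
    proof -
      have "p - c \<in> ball 0 r" using that by (simp add: dist_norm norm_minus_commute)
      have "((\<lambda>p. v (p - c)) has_derivative (\<lambda>X. blinfun_apply (B (v (p - c)) (\<omega> (p - c + c))) X)) (at p)"
        by (rule has_derivative_compose[where f="\<lambda>p. p - c", OF _ v(2)[OF \<open>p - c \<in> ball 0 r\<close>]])
          (auto intro!: derivative_eq_intros)
      then show ?thesis by simp
    qed
    then show "\<exists>v. v c = v0 \<and> (\<forall>p\<in>ball c r. (v has_derivative blinfun_apply (B (v p) (\<omega> p))) (at p))"
      using v(1) by (intro exI[of _ "\<lambda>p. v (p - c)"]) auto
  qed
qed

section \<open>Flat sections over a simply connected space\<close>

lemma continuous_on_nhdE:
  assumes "continuous_on K h" "k \<in> K" "open U" "h k \<in> U"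
  obtains A where "open A" "k \<in> A" "\<And>y. y \<in> K \<Longrightarrow> y \<in> A \<Longrightarrow> h y \<in> U"
  using assms unfolding continuous_on_topological by meson

text \<open>An axiomatic form of the parallel sections of a flat connection, that is, of a locally
  constant sheaf with values in \<open>G\<close>. Sections are total functions of which only the
  values on \<open>W\<close> matter, hence the shape of \<open>Par_local\<close>. In
  \<open>flat_nhd\<close> a section over \<open>W\<close> exists with any prescribed value at any
  point of \<open>W\<close> and is determined by that value.\<close>

locale flat_sections =
  fixes Par :: "'m::topological_space set \<Rightarrow> ('m \<Rightarrow> 'e) \<Rightarrow> bool"
    and D :: "'m set" and G :: "'e set"
  assumes open_D: "open D"
    and Par_subset: "\<And>W W' s. Par W s \<Longrightarrow> open W' \<Longrightarrow> W' \<subseteq> W \<Longrightarrow> Par W' s"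
    and Par_in: "\<And>W s q. Par W s \<Longrightarrow> q \<in> W \<Longrightarrow> s q \<in> G"
    and Par_local: "\<And>W s. open W \<Longrightarrow>
      (\<And>p. p \<in> W \<Longrightarrow> \<exists>N t. open N \<and> p \<in> N \<and> Par N t \<and> (\<forall>q\<in>N. t q = s q)) \<Longrightarrow> Par W s"
    and flat_nhd: "\<And>Y p. open Y \<Longrightarrow> p \<in> Y \<Longrightarrow> Y \<subseteq> D \<Longrightarrow>
      \<exists>W. open W \<and> p \<in> W \<and> W \<subseteq> Y \<and> path_connected W \<and>
        (\<forall>q\<in>W. \<forall>v\<in>G. \<exists>s. Par W s \<and> s q = v) \<and>
        (\<forall>s s'. Par W s \<and> Par W s' \<and> (\<exists>q\<in>W. s q = s' q) \<longrightarrow> (\<forall>q\<in>W. s q = s' q))"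
begin

text \<open>A section of the pull-back under \<open>h\<close>. It is a function on the parameter set
  \<open>K\<close>, not on the image, because continuation along a path that returns to a point may
  arrive with another value.\<close>

definition along :: "('k::topological_space \<Rightarrow> 'm) \<Rightarrow> 'k set \<Rightarrow> ('k \<Rightarrow> 'e) \<Rightarrow> bool" where
  "along h K \<sigma> \<longleftrightarrow> (\<forall>k\<in>K. \<exists>N W s. open N \<and> k \<in> N \<and> open W \<and> h ` (N \<inter> K) \<subseteq> W \<and> Par W s \<and>
      (\<forall>x\<in>N \<inter> K. \<sigma> x = s (h x)))"

lemma alongE:
  assumes "along h K \<sigma>" "k \<in> K"
  obtains N W s where "open N" "k \<in> N" "open W" "h ` (N \<inter> K) \<subseteq> W" "Par W s" "\<And>x. x \<in> N \<Longrightarrow> x \<in> K \<Longrightarrow> \<sigma> x = s (h x)"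
  using assms unfolding along_def by (metis IntI)

lemma along_in:
  assumes "along h K \<sigma>" "k \<in> K"
  shows "\<sigma> k \<in> G"
  using assms(1,2)
proof (rule alongE)
  fix N W s assume a: "k \<in> N" "h ` (N \<inter> K) \<subseteq> W" "Par W s" "\<And>x. x \<in> N \<Longrightarrow> x \<in> K \<Longrightarrow> \<sigma> x = s (h x)"
  then have "h k \<in> W" using assms(2) by auto
  then show ?thesis using Par_in[OF a(3)] a(1,4) assms(2) by metis
qed

lemma along_compose:
  assumes \<sigma>: "along h K \<sigma>" and g: "continuous_on K' g" "g ` K' \<subseteq> K"
    and h': "\<And>x. x \<in> K' \<Longrightarrow> h' x = h (g x)" and \<tau>: "\<And>x. x \<in> K' \<Longrightarrow> \<tau> x = \<sigma> (g x)"
  shows "along h' K' \<tau>"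
  unfolding along_def
proof
  fix k assume k: "k \<in> K'"
  have gk: "g k \<in> K" using k g(2) by auto
  obtain N W s where N: "open N" "g k \<in> N" "open W" "h ` (N \<inter> K) \<subseteq> W" "Par W s"
    "\<And>x. x \<in> N \<Longrightarrow> x \<in> K \<Longrightarrow> \<sigma> x = s (h x)"
    using \<sigma> gk by (rule alongE) (rule that; assumption)
  obtain A where A: "open A" "k \<in> A" "\<And>y. y \<in> K' \<Longrightarrow> y \<in> A \<Longrightarrow> g y \<in> N"
    by (rule continuous_on_nhdE[OF g(1) k N(1,2)]) (rule that; assumption)
  have *: "h' x \<in> W \<and> \<tau> x = s (h' x)" if "x \<in> A \<inter> K'" for x
  proof -
    have "g x \<in> N" "g x \<in> K" using A(3) g(2) that by auto
    then show ?thesis using N(4,6) h' \<tau> that by auto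
  qed
  show "\<exists>N W s. open N \<and> k \<in> N \<and> open W \<and> h' ` (N \<inter> K') \<subseteq> W \<and> Par W s \<and> (\<forall>x\<in>N \<inter> K'. \<tau> x = s (h' x))"
    by (intro exI[of _ A] exI[of _ W] exI[of _ s] conjI A N ballI) (use * in blast)+
qed

lemma along_subset: "along h K \<sigma> \<Longrightarrow> K' \<subseteq> K \<Longrightarrow> along h K' \<sigma>"
  by (rule along_compose[where g="\<lambda>x. x" and h=h and K=K]) auto

lemma along_section:
  assumes "Par W s" "open W" "continuous_on K h" "h ` K \<subseteq> W"
  shows "along h K (\<lambda>k. s (h k))"
  unfolding along_def
  by (intro ballI exI[of _ UNIV] exI[of _ W] exI[of _ s]) (use assms in auto)

text \<open>The conclusion is symmetric in \<open>q\<close> and \<open>q'\<close>, so it transports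
  agreement and disagreement alike; both become locally constant.\<close>

lemma flat_nhd_agree:
  assumes "Par W s" "Par W' s'" "open W" "open W'" "p \<in> W" "p \<in> W'" "p \<in> D"
  obtains U where "open U" "p \<in> U" "U \<subseteq> W" "U \<subseteq> W'"
    "\<And>q q'. q \<in> U \<Longrightarrow> q' \<in> U \<Longrightarrow> s q = s' q \<Longrightarrow> s q' = s' q'"
proof -
  have "open (W \<inter> W' \<inter> D)" "p \<in> W \<inter> W' \<inter> D" using assms open_D by auto
  from flat_nhd[OF this] obtain U where U: "open U" "p \<in> U" "U \<subseteq> W \<inter> W' \<inter> D"
    "\<And>s s'. Par U s \<and> Par U s' \<and> (\<exists>q\<in>U. s q = s' q) \<Longrightarrow> (\<forall>q\<in>U. s q = s' q)"
    by auto
  have "Par U s" "Par U s'" using assms(1,2) U(1,3) Par_subset by blast+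
  then show thesis using that[OF U(1,2)] U(3) U(4)[of s s'] by blast
qed

text \<open>Whether \<open>\<sigma>\<close> and \<open>\<tau>\<close> agree is a locally constant
  property on the connected set \<open>K\<close>.\<close>

lemma along_unique:
  assumes K: "connected K" and h: "continuous_on K h" "h ` K \<subseteq> D"
    and s: "along h K \<sigma>" "along h K \<tau>" and eq: "k0 \<in> K" "\<sigma> k0 = \<tau> k0" and k: "k \<in> K"
  shows "\<sigma> k = \<tau> k"
proof -
  have "(\<sigma> k0 = \<tau> k0) = (\<sigma> k = \<tau> k)"
  proof (rule connected_local_const[OF K eq(1) k], intro ballI)
    fix a assume a: "a \<in> K"
    obtain N W s where N: "open N" "a \<in> N" "open W" "h ` (N \<inter> K) \<subseteq> W" "Par W s"
      "\<And>x. x \<in> N \<Longrightarrow> x \<in> K \<Longrightarrow> \<sigma> x = s (h x)" using s(1) a by (rule alongE) (rule that; assumption)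
    obtain N' W' s' where N': "open N'" "a \<in> N'" "open W'" "h ` (N' \<inter> K) \<subseteq> W'" "Par W' s'"
      "\<And>x. x \<in> N' \<Longrightarrow> x \<in> K \<Longrightarrow> \<tau> x = s' (h x)" using s(2) a by (rule alongE) (rule that; assumption)
    have ha: "h a \<in> W" "h a \<in> W'" "h a \<in> D" using a N N' h by auto
    obtain U where U: "open U" "h a \<in> U"
      "\<And>q q'. q \<in> U \<Longrightarrow> q' \<in> U \<Longrightarrow> s q = s' q \<Longrightarrow> s q' = s' q'"
      by (rule flat_nhd_agree[OF N(5) N'(5) N(3) N'(3) ha]) (rule that; assumption)
    obtain A where A: "open A" "a \<in> A" "\<And>y. y \<in> K \<Longrightarrow> y \<in> A \<Longrightarrow> h y \<in> U"
      by (rule continuous_on_nhdE[OF h(1) a U(1,2)]) (rule that; assumption)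
    have "(\<sigma> a = \<tau> a) = (\<sigma> x = \<tau> x)" if x: "x \<in> A \<inter> N \<inter> N'" "x \<in> K" for x
    proof -
      have "h x \<in> U" using A(3) x by blast
      then have "(s (h a) = s' (h a)) = (s (h x) = s' (h x))" using U(2,3) by blast
      then show ?thesis using x a N(2,6) N'(2,6) by auto
    qed
    then show "\<forall>\<^sub>F b in at a within K. (\<sigma> a = \<tau> a) = (\<sigma> b = \<tau> b)"
      unfolding eventually_at_topological
      by (intro exI[of _ "A \<inter> N \<inter> N'"]) (use A N N' in auto)
  qed
  then show ?thesis using eq by simp
qed

text \<open>Near a point of only one of the closed sets the other one can be cut away. At a common
  point the local sections of \<sigma> and \<tau> agree, hence they agree nearby, and the one
  belonging to \<sigma> represents both.\<close>

lemma along_glue: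
  assumes cl: "closed K" "closed L" and h: "continuous_on (K \<union> L) h" "h ` (K \<union> L) \<subseteq> D"
    and s: "along h K \<sigma>" "along h L \<tau>" and eq: "\<And>k. k \<in> K \<Longrightarrow> k \<in> L \<Longrightarrow> \<sigma> k = \<tau> k"
  shows "along h (K \<union> L) (\<lambda>k. if k \<in> K then \<sigma> k else \<tau> k)" (is "along h _ ?\<rho>")
  unfolding along_def
proof
  fix a assume a: "a \<in> K \<union> L"
  consider "a \<in> K" "a \<notin> L" | "a \<in> L" "a \<notin> K" | "a \<in> K" "a \<in> L" using a by blast
  then show "\<exists>N W s. open N \<and> a \<in> N \<and> open W \<and> h ` (N \<inter> (K \<union> L)) \<subseteq> W \<and> Par W s \<and>
    (\<forall>x\<in>N \<inter> (K \<union> L). ?\<rho> x = s (h x))"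
  proof cases
    case 1
    obtain N W s where N: "open N" "a \<in> N" "open W" "h ` (N \<inter> K) \<subseteq> W" "Par W s"
      "\<And>x. x \<in> N \<Longrightarrow> x \<in> K \<Longrightarrow> \<sigma> x = s (h x)" using s(1) 1(1) by (rule alongE) (rule that; assumption)
    show ?thesis
      by (rule exI[of _ "N - L"], rule exI[of _ W], rule exI[of _ s]) (use N 1 cl in auto)
  next
    case 2
    obtain N W s where N: "open N" "a \<in> N" "open W" "h ` (N \<inter> L) \<subseteq> W" "Par W s"
      "\<And>x. x \<in> N \<Longrightarrow> x \<in> L \<Longrightarrow> \<tau> x = s (h x)" using s(2) 2(1) by (rule alongE) (rule that; assumption)
    show ?thesis
      by (rule exI[of _ "N - K"], rule exI[of _ W], rule exI[of _ s]) (use N 2 cl in auto)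
  next
    case 3
    obtain N W s where N: "open N" "a \<in> N" "open W" "h ` (N \<inter> K) \<subseteq> W" "Par W s"
      "\<And>x. x \<in> N \<Longrightarrow> x \<in> K \<Longrightarrow> \<sigma> x = s (h x)" using s(1) 3(1) by (rule alongE) (rule that; assumption)
    obtain N' W' s' where N': "open N'" "a \<in> N'" "open W'" "h ` (N' \<inter> L) \<subseteq> W'" "Par W' s'"
      "\<And>x. x \<in> N' \<Longrightarrow> x \<in> L \<Longrightarrow> \<tau> x = s' (h x)" using s(2) 3(2) by (rule alongE) (rule that; assumption)
    have ha: "h a \<in> W" "h a \<in> W'" "h a \<in> D" using 3 N N' h by auto
    obtain U where U: "open U" "h a \<in> U" "U \<subseteq> W"
      "\<And>q q'. q \<in> U \<Longrightarrow> q' \<in> U \<Longrightarrow> s q = s' q \<Longrightarrow> s q' = s' q'"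
      by (rule flat_nhd_agree[OF N(5) N'(5) N(3) N'(3) ha]) (rule that; assumption)
    have "s (h a) = s' (h a)" using eq 3 N N' by metis
    then have U': "s q = s' q" if "q \<in> U" for q using U that by blast
    obtain A where A: "open A" "a \<in> A" "\<And>y. y \<in> K \<union> L \<Longrightarrow> y \<in> A \<Longrightarrow> h y \<in> U"
      by (rule continuous_on_nhdE[OF h(1) a U(1,2)]) (rule that; assumption)
    have "?\<rho> x = s (h x)" if "x \<in> A \<inter> N \<inter> N'" "x \<in> K \<union> L" for x
      using that A N(6) N'(6) U' by (cases "x \<in> K") auto
    moreover have "h ` (A \<inter> N \<inter> N' \<inter> (K \<union> L)) \<subseteq> W" using A U by blast
    ultimately show ?thesis
      by (intro exI[of _ "A \<inter> N \<inter> N'"] exI[of _ W] exI[of _ s]) (use A N N' in auto)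
  qed
qed

section \<open>Continuation over a square by bisection\<close>

definition solvable :: "('k::topological_space \<Rightarrow> 'm) \<Rightarrow> 'k set \<Rightarrow> bool" where
  "solvable h K \<longleftrightarrow> (\<forall>k\<in>K. \<forall>v\<in>G. \<exists>\<sigma>. along h K \<sigma> \<and> \<sigma> k = v)"

context
  fixes h :: "real \<times> real \<Rightarrow> 'm"
  assumes h: "continuous_on UNIV h" "range h \<subseteq> D"
begin

lemma solvable_subset: "solvable h K \<Longrightarrow> K' \<subseteq> K \<Longrightarrow> solvable h K'"
  unfolding solvable_def using along_subset by (meson subsetD)

text \<open>Matching the two solutions at a single common point \<open>e\<close> makes them equal on
  the whole intersection, because it is connected. Since \<open>solvable\<close> allows the initial
  point anywhere, the solution can start in either piece and be continued into the other from
  \<open>e\<close>.\<close>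

lemma solvable_union:
  assumes cl: "closed K" "closed L" and c: "connected (K \<inter> L)" "K \<inter> L \<noteq> {}"
    and s: "solvable h K" "solvable h L"
  shows "solvable h (K \<union> L)"
  unfolding solvable_def
proof (intro ballI)
  fix k v assume k: "k \<in> K \<union> L" and v: "v \<in> G"
  obtain e where e: "e \<in> K" "e \<in> L" using c by auto
  have hc: "continuous_on A h" "h ` A \<subseteq> D" for A using h continuous_on_subset by blast+
  have glue: "along h (K \<union> L) (\<lambda>k. if k \<in> K then \<sigma> k else \<tau> k)" "\<And>k. k \<in> K \<inter> L \<Longrightarrow> \<sigma> k = \<tau> k"
    if "along h K \<sigma>" "along h L \<tau>" "\<sigma> e = \<tau> e" for \<sigma> \<tau>
  proof -
    have *: "\<sigma> k = \<tau> k" if "k \<in> K \<inter> L" for k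
      by (rule along_unique[OF c(1) hc, of \<sigma> \<tau> e])
        (use e that \<open>\<sigma> e = \<tau> e\<close> along_subset[OF \<open>along h K \<sigma>\<close>] along_subset[OF \<open>along h L \<tau>\<close>] in auto)
    then show "along h (K \<union> L) (\<lambda>k. if k \<in> K then \<sigma> k else \<tau> k)" "\<And>k. k \<in> K \<inter> L \<Longrightarrow> \<sigma> k = \<tau> k"
      using along_glue[OF cl hc that(1,2)] by blast+
  qed
  show "\<exists>\<sigma>. along h (K \<union> L) \<sigma> \<and> \<sigma> k = v"
  proof (cases "k \<in> K")
    case True
    then obtain \<sigma> where \<sigma>: "along h K \<sigma>" "\<sigma> k = v" using s(1) v unfolding solvable_def by blast
    then have "\<sigma> e \<in> G" using along_in e by blast
    then obtain \<tau> where \<tau>: "along h L \<tau>" "\<tau> e = \<sigma> e" using s(2) e unfolding solvable_def by blast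
    show ?thesis using glue(1)[OF \<sigma>(1) \<tau>(1) \<tau>(2)[symmetric]] \<sigma>(2) True
      by (intro exI[of _ "\<lambda>k. if k \<in> K then \<sigma> k else \<tau> k"]) auto
  next
    case False
    then have kL: "k \<in> L" using k by blast
    then obtain \<tau> where \<tau>: "along h L \<tau>" "\<tau> k = v" using s(2) v unfolding solvable_def by blast
    then have "\<tau> e \<in> G" using along_in e by blast
    then obtain \<sigma> where \<sigma>: "along h K \<sigma>" "\<sigma> e = \<tau> e" using s(1) e unfolding solvable_def by blast
    show ?thesis using glue(1)[OF \<sigma>(1) \<tau>(1) \<sigma>(2)] \<tau>(2) False
      by (intro exI[of _ "\<lambda>k. if k \<in> K then \<sigma> k else \<tau> k"]) auto
  qed
qed

text \<open>Bisection is used twice. In the second coordinate it glues small rectangles inside flat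
  neighbourhoods to a full strip of some positive width; the width shrinks at each union, which is
  why it is only asserted to exist. In the first coordinate it glues such strips. As
  \<open>h\<close> is defined on the whole plane, strips may stick out of the square.\<close>

lemma solvable_square: "solvable h ({0..1} \<times> {0..1})"
proof -
  have strip: "\<exists>d>0. solvable h ({s - d..s + d} \<times> {0..1})" for s
  proof -
    have "(0::real) \<le> 1 \<longrightarrow> (\<exists>d>0. solvable h ({s - d..s + d} \<times> {0..1}))"
    proof (rule Bolzano[where P="\<lambda>a b. a \<le> b \<longrightarrow> (\<exists>d>0. solvable h ({s - d..s + d} \<times> {a..b}))"])
      fix a b c :: real
      assume "a \<le> b \<longrightarrow> (\<exists>d>0. solvable h ({s - d..s + d} \<times> {a..b}))"
        "b \<le> c \<longrightarrow> (\<exists>d>0. solvable h ({s - d..s + d} \<times> {b..c}))" and abc: "a \<le> b" "b \<le> c"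
      then obtain d d' where d: "d > 0" "d' > 0"
        and s: "solvable h ({s - d..s + d} \<times> {a..b})" "solvable h ({s - d'..s + d'} \<times> {b..c})" by auto
      define e where "e = min d d'"
      have e: "e > 0" "e \<le> d" "e \<le> d'" using d by (auto simp: e_def)
      have i: "({s - e..s + e} \<times> {a..b}) \<inter> ({s - e..s + e} \<times> {b..c}) = {s - e..s + e} \<times> {b}"
        using abc by auto
      have "solvable h (({s - e..s + e} \<times> {a..b}) \<union> ({s - e..s + e} \<times> {b..c}))"
      proof (rule solvable_union)
        show "connected (({s - e..s + e} \<times> {a..b}) \<inter> ({s - e..s + e} \<times> {b..c}))"
          unfolding i by (intro connected_Times) auto
        show "solvable h ({s - e..s + e} \<times> {a..b})" "solvable h ({s - e..s + e} \<times> {b..c})"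
          using e by (intro solvable_subset[OF s(1)] solvable_subset[OF s(2)]; auto)+
      qed (use e i in \<open>auto intro!: closed_Times\<close>)
      moreover have "({s - e..s + e} \<times> {a..b}) \<union> ({s - e..s + e} \<times> {b..c}) = {s - e..s + e} \<times> {a..c}"
        using abc by auto
      ultimately show "a \<le> c \<longrightarrow> (\<exists>d>0. solvable h ({s - d..s + d} \<times> {a..c}))"
        using e by auto
    next
      fix x :: real
      have "h (s, x) \<in> D" using h by auto
      from flat_nhd[OF open_D this] obtain W where W: "open W" "h (s, x) \<in> W"
        "\<And>q v. q \<in> W \<Longrightarrow> v \<in> G \<Longrightarrow> \<exists>s. Par W s \<and> s q = v" by auto
      have "open (h -` W)" using h(1) W(1) open_vimage by blast
      then obtain A B where AB: "open A" "open B" "s \<in> A" "x \<in> B" "A \<times> B \<subseteq> h -` W"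
        using W(2) by (metis open_prod_elim mem_Sigma_iff vimageI)
      obtain d where d: "d > 0" "cball s d \<subseteq> A" using AB open_contains_cball by blast
      obtain d' where d': "d' > 0" "cball x d' \<subseteq> B" using AB open_contains_cball by blast
      have "solvable h ({s - d..s + d} \<times> {a..b})" if "a \<le> x" "x \<le> b" "b - a < d'" for a b
        unfolding solvable_def
      proof (intro ballI)
        fix k v assume k: "k \<in> {s - d..s + d} \<times> {a..b}" and v: "v \<in> G"
        have "{s - d..s + d} \<subseteq> A" using d by (auto simp: cball_eq_atLeastAtMost)
        moreover have "{a..b} \<subseteq> B" using d' that by (auto simp: cball_eq_atLeastAtMost)
        ultimately have im: "h ` ({s - d..s + d} \<times> {a..b}) \<subseteq> W" using AB by blast
        then obtain t where "Par W t" "t (h k) = v" using W(3) k v by blast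
        then show "\<exists>\<sigma>. along h ({s - d..s + d} \<times> {a..b}) \<sigma> \<and> \<sigma> k = v"
          using along_section[OF _ W(1) continuous_on_subset[OF h(1)] im] by auto
      qed
      then show "\<exists>da>0. \<forall>a b. a \<le> x \<and> x \<le> b \<and> b - a < da \<longrightarrow> a \<le> b \<longrightarrow>
          (\<exists>d>0. solvable h ({s - d..s + d} \<times> {a..b}))" using d d' by blast
    qed auto
    then show ?thesis by simp
  qed
  have "(0::real) \<le> 1 \<longrightarrow> solvable h ({0..1} \<times> {0..1})"
  proof (rule Bolzano[where P="\<lambda>a b. a \<le> b \<longrightarrow> solvable h ({a..b} \<times> {0..1})"])
    fix a b c :: real
    assume s: "a \<le> b \<longrightarrow> solvable h ({a..b} \<times> {0..1})" "b \<le> c \<longrightarrow> solvable h ({b..c} \<times> {0..1})"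
      and abc: "a \<le> b" "b \<le> c"
    have i: "({a..b} \<times> {0..1::real}) \<inter> ({b..c} \<times> {0..1}) = {b} \<times> {0..1}" using abc by auto
    have "solvable h (({a..b} \<times> {0..1}) \<union> ({b..c} \<times> {0..1}))"
    proof (rule solvable_union)
      show "connected (({a..b} \<times> {0..1::real}) \<inter> ({b..c} \<times> {0..1}))"
        unfolding i by (intro connected_Times) auto
    qed (use s abc i in \<open>auto intro!: closed_Times\<close>)
    moreover have "({a..b} \<times> {0..1}) \<union> ({b..c} \<times> {0..1::real}) = {a..c} \<times> {0..1}"
      using abc by auto
    ultimately show "a \<le> c \<longrightarrow> solvable h ({a..c} \<times> {0..1})" by simp
  next
    fix x :: real
    obtain d where d: "d > 0" "solvable h ({x - d..x + d} \<times> {0..1})" using strip by blast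
    have "solvable h ({a..b} \<times> {0..1})" if "a \<le> x" "x \<le> b" "b - a < d" for a b
      using that by (intro solvable_subset[OF d(2)]) auto
    then show "\<exists>d>0. \<forall>a b. a \<le> x \<and> x \<le> b \<and> b - a < d \<longrightarrow> a \<le> b \<longrightarrow> solvable h ({a..b} \<times> {0..1})"
      using d by blast
  qed auto
  then show ?thesis by simp
qed

end

lemma along_square:
  fixes h :: "real \<times> real \<Rightarrow> 'm"
  assumes h: "continuous_on ({0..1} \<times> {0..1}) h" "h ` ({0..1} \<times> {0..1}) \<subseteq> D"
    and k: "k \<in> {0..1} \<times> {0..1}" and v: "v \<in> G"
  obtains \<sigma> where "along h ({0..1} \<times> {0..1}) \<sigma>" "\<sigma> k = v"
proof -
  \<comment> \<open>Clamping both coordinates to the unit interval extends \<open>h\<close>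
    continuously from the square to the plane, with values still in \<open>D\<close>.\<close>
  define c where "c = (\<lambda>x::real. max 0 (min 1 x))"
  define h' where "h' = (\<lambda>x. h (c (fst x), c (snd x)))"
  have c: "c x \<in> {0..1}" for x by (auto simp: c_def)
  have ci: "c x = x" if "x \<in> {0..1}" for x using that by (auto simp: c_def)
  have "continuous_on UNIV h'" unfolding h'_def
  proof (rule continuous_on_compose2[OF h(1)])
    show "continuous_on UNIV (\<lambda>x. (c (fst x), c (snd x)))"
      unfolding c_def by (intro continuous_intros)
  qed (use c in auto)
  moreover have "range h' \<subseteq> D" unfolding h'_def using c h(2) by blast
  ultimately have "solvable h' ({0..1} \<times> {0..1})" by (rule solvable_square)
  then obtain \<sigma> where \<sigma>: "along h' ({0..1} \<times> {0..1}) \<sigma>" "\<sigma> k = v"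
    using k v unfolding solvable_def by blast
  have "along h ({0..1} \<times> {0..1}) \<sigma>"
    by (rule along_compose[OF \<sigma>(1), where g="\<lambda>x. x"]) (auto simp: h'_def ci)
  then show thesis using \<sigma>(2) that by blast
qed

section \<open>Continuation along paths and trivial monodromy\<close>

lemma along_path:
  fixes \<gamma> :: "real \<Rightarrow> 'm"
  assumes g: "path \<gamma>" "path_image \<gamma> \<subseteq> D" and v: "v \<in> G"
  obtains \<sigma> where "along \<gamma> {0..1} \<sigma>" "\<sigma> 0 = v"
proof -
  \<comment> \<open>A path is treated as a map of the square that ignores the first coordinate, so
    no separate one-dimensional argument is required.\<close>
  have "continuous_on ({0..1} \<times> {0..1}) (\<lambda>x::real\<times>real. \<gamma> (snd x))"
    by (rule continuous_on_compose2[OF g(1)[unfolded path_def]]) (auto intro!: continuous_intros)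
  moreover have "(\<lambda>x::real\<times>real. \<gamma> (snd x)) ` ({0..1} \<times> {0..1}) \<subseteq> D"
    using g(2) unfolding path_image_def by auto
  ultimately obtain \<sigma> where \<sigma>: "along (\<lambda>x::real\<times>real. \<gamma> (snd x)) ({0..1} \<times> {0..1}) \<sigma>" "\<sigma> (0, 0) = v"
    by (rule along_square[of _ "(0, 0)" v]) (use v in \<open>auto intro: that\<close>)
  have "along \<gamma> {0..1} (\<lambda>t. \<sigma> (0, t))"
    by (rule along_compose[OF \<sigma>(1), where g="\<lambda>t. (0, t)"]) (auto intro!: continuous_intros)
  then show thesis using \<sigma>(2) that by blast
qed

text \<open>A free homotopy of the loop \<open>\<gamma>\<close> to a constant loop is a map of the square. A section along it
  takes the same values on the sides \<open>{0..1} \<times> {0}\<close> and \<open>{0..1} \<times> {1}\<close>, because it does so at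
  their end points on the constant side.\<close>

lemma along_loop:
  assumes D: "simply_connected D"
    and g: "path \<gamma>" "path_image \<gamma> \<subseteq> D" "\<gamma> 0 = \<gamma> 1" and s: "along \<gamma> {0..1} \<sigma>"
  shows "\<sigma> 0 = \<sigma> 1"
proof -
  have g0: "\<gamma> 0 \<in> D" using g(2) by (auto simp: path_image_def)
  have "homotopic_loops D \<gamma> (\<lambda>_. \<gamma> 0)"
  proof (rule D[unfolded simply_connected_def, rule_format], intro conjI)
    show "path (\<lambda>_::real. \<gamma> 0)" unfolding path_def by (rule continuous_on_const)
  qed (use g g0 in \<open>auto simp: pathfinish_def pathstart_def path_image_def\<close>)
  then obtain h where h: "continuous_on ({0..1::real} \<times> {0..1::real}) h" "h \<in> ({0..1} \<times> {0..1}) \<rightarrow> D"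
    "\<And>x. x \<in> {0..1} \<Longrightarrow> h (0, x) = \<gamma> x" "\<And>x. x \<in> {0..1} \<Longrightarrow> h (1, x) = \<gamma> 0"
    "\<And>t. t \<in> {0..1} \<Longrightarrow> h (t, 1) = h (t, 0)"
    unfolding homotopic_loops by (auto simp: pathfinish_def pathstart_def)
  have hD: "h ` ({0..1} \<times> {0..1}) \<subseteq> D" using h(2) by auto
  obtain \<rho> where \<rho>: "along h ({0..1} \<times> {0..1}) \<rho>" "\<rho> (0, 0) = \<sigma> 0"
    using along_square[OF h(1) hD, of "(0, 0)" "\<sigma> 0"] along_in[OF s, of 0] by auto
  have sub: "continuous_on {0..1} \<eta>" "\<eta> ` {0..1} \<subseteq> D"
    if "continuous_on {0..1} g" "g ` {0..1} \<subseteq> {0..1} \<times> {0..1}" "\<And>x. x \<in> {0..1} \<Longrightarrow> \<eta> x = h (g x)"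
    for g :: "real \<Rightarrow> real \<times> real" and \<eta>
  proof -
    show "continuous_on {0..1} \<eta>"
      by (rule continuous_on_eq[OF continuous_on_compose2[OF h(1) that(1,2)]]) (simp add: that(3))
    show "\<eta> ` {0..1} \<subseteq> D"
      using hD that(2,3) by (auto simp: image_subset_iff)
  qed
  have gc: "continuous_on {0..1} \<gamma>" "\<gamma> ` {0..1} \<subseteq> D"
    using g unfolding path_def path_image_def by auto
  have c1: "continuous_on {0..1} (\<lambda>t::real. (a, t))" "continuous_on {0..1} (\<lambda>t::real. (t, a))" for a :: real
    by (auto intro!: continuous_intros)
  have left: "\<rho> (0, t) = \<sigma> t" if "t \<in> {0..1}" for t
    by (rule along_unique[OF connected_Icc gc _ s, of "\<lambda>t. \<rho> (0, t)" 0 t])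
      (use that \<rho>(2) h(3) in \<open>auto intro!: along_compose[OF \<rho>(1) c1(1)[of 0]]\<close>)
  have const: "along (\<lambda>_. \<gamma> 0) {0..1::real} (\<lambda>_. v)" if v: "v \<in> G" for v
  proof -
    obtain W t where W: "open W" "\<gamma> 0 \<in> W" "Par W t" "t (\<gamma> 0) = v"
      using flat_nhd[OF open_D g0] v by blast
    then show ?thesis using along_section[OF W(3,1), of "{0..1}" "\<lambda>_. \<gamma> 0"] by auto
  qed
  have "\<rho> (1, 0) \<in> G" using along_in[OF \<rho>(1)] by simp
  have right: "\<rho> (1, 1) = \<rho> (1, 0)"
    by (rule along_unique[OF connected_Icc _ _ _ const[OF \<open>\<rho> (1, 0) \<in> G\<close>], of "\<lambda>t. \<rho> (1, t)" 0 1])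
      (use g0 h(4) in \<open>auto intro!: along_compose[OF \<rho>(1) c1(1)[of 1]]\<close>)
  have a0: "along (\<lambda>t. h (t, 0)) {0..1} (\<lambda>t. \<rho> (t, 0))"
    by (rule along_compose[OF \<rho>(1) c1(2)[of 0]]) auto
  have a1: "along (\<lambda>t. h (t, 0)) {0..1} (\<lambda>t. \<rho> (t, 1))"
    by (rule along_compose[OF \<rho>(1) c1(2)[of 1]]) (auto simp: h(5))
  have "\<rho> (0, 1) = \<rho> (0, 0)"
    by (rule along_unique[OF connected_Icc sub[OF c1(2)[of 0]] a1 a0, of 1]) (use right in auto)
  then show ?thesis using left[of 0] left[of 1] by simp
qed

text \<open>The value at \<open>p\<close> is the end value of the continuation of \<open>v0\<close>
  along any path from \<open>p0\<close> to \<open>p\<close>. Independence of the path follows from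
  \<open>along_loop\<close>.\<close>

theorem flat_section_exists:
  assumes D: "simply_connected D" and p0: "p0 \<in> D" and v0: "v0 \<in> G"
  obtains T where "Par D T" "T p0 = v0"
proof -
  define R where "R p e \<longleftrightarrow> (\<exists>\<gamma> \<sigma>. path \<gamma> \<and> path_image \<gamma> \<subseteq> D \<and> \<gamma> 0 = p0 \<and> \<gamma> 1 = p \<and>
     along \<gamma> {0..1} \<sigma> \<and> \<sigma> 0 = v0 \<and> \<sigma> 1 = e)" for p e
  have pc: "continuous_on {0..1} \<gamma>" "\<gamma> ` {0..1} \<subseteq> D" if "path \<gamma>" "path_image \<gamma> \<subseteq> D" for \<gamma>
    using that by (auto simp: path_def path_image_def)
  \<comment> \<open>A joined path runs through its first constituent on the first half of the
    interval, so at 1/2 the continuation has the end value belonging to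
    \<open>\<gamma>\<close>.\<close>
  have first: "\<tau> (1/2) = \<sigma> 1"
    if "path \<gamma>" "path_image \<gamma> \<subseteq> D" "along \<gamma> {0..1} \<sigma>" "\<sigma> 0 = v0" "along (\<gamma> +++ \<eta>) {0..1} \<tau>" "\<tau> 0 = v0"
    for \<gamma> \<eta> \<sigma> \<tau>
  proof -
    have "along \<gamma> {0..1} (\<lambda>t. \<tau> (t/2))"
      by (rule along_compose[OF that(5), where g="\<lambda>t. t/2"]) (auto simp: joinpaths_def intro!: continuous_intros)
    then have "(\<lambda>t. \<tau> (t/2)) 1 = \<sigma> 1"
      by (rule along_unique[OF connected_Icc pc[OF that(1,2)] _ that(3), of _ 0]) (use that in auto)
    then show ?thesis by simp
  qed
  have uniq: "e = e'" if R: "R p e" "R p e'" for p e e'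
  proof -
    obtain \<gamma> \<sigma> where 1: "path \<gamma>" "path_image \<gamma> \<subseteq> D" "\<gamma> 0 = p0" "\<gamma> 1 = p" "along \<gamma> {0..1} \<sigma>" "\<sigma> 0 = v0" "\<sigma> 1 = e"
      using R(1) unfolding R_def by blast
    obtain \<eta> \<tau> where 2: "path \<eta>" "path_image \<eta> \<subseteq> D" "\<eta> 0 = p0" "\<eta> 1 = p" "along \<eta> {0..1} \<tau>" "\<tau> 0 = v0" "\<tau> 1 = e'"
      using R(2) unfolding R_def by blast
    \<comment> \<open>Continuation around this loop returns to \<open>v0\<close>. Its second half,
      read backwards by \<open>1 - t/2\<close>, is then a continuation of \<open>v0\<close> along
      \<open>\<eta>\<close>, so the value at 1/2 is the end value for both paths.\<close>
    define \<zeta> where "\<zeta> = \<gamma> +++ reversepath \<eta>"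
    have z1: "path \<zeta>"
      using 1 2 unfolding \<zeta>_def by (intro path_join_imp) (auto, simp add: pathfinish_def)
    have z2: "path_image \<zeta> \<subseteq> D"
      using 1 2 unfolding \<zeta>_def by (intro subset_path_image_join) auto
    have z3: "\<zeta> 0 = \<zeta> 1"
      using 1 2 by (simp add: \<zeta>_def joinpaths_def reversepath_def)
    note z = z1 z2 z3
    obtain \<rho> where \<rho>: "along \<zeta> {0..1} \<rho>" "\<rho> 0 = v0" using along_path[OF z(1,2) v0] by metis
    have e: "\<rho> (1/2) = e" using first[OF 1(1,2,5,6) \<rho>(1)[unfolded \<zeta>_def] \<rho>(2)] 1(7) by simp
    have "\<rho> 1 = v0" using along_loop[OF D z \<rho>(1)] \<rho>(2) by simp
    have "along \<eta> {0..1} (\<lambda>t. \<rho> (1 - t/2))"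
    proof (rule along_compose[OF \<rho>(1), where g="\<lambda>t. 1 - t/2"])
      fix t :: real assume "t \<in> {0..1}"
      then show "\<eta> t = \<zeta> (1 - t/2)"
        using 1(4) 2(4) by (cases "t = 1") (auto simp: \<zeta>_def joinpaths_def reversepath_def)
    qed (auto intro!: continuous_intros)
    then have "(\<lambda>t. \<rho> (1 - t/2)) 1 = \<tau> 1"
      by (rule along_unique[OF connected_Icc pc[OF 2(1,2)] _ 2(5), of _ 0]) (use 2 \<open>\<rho> 1 = v0\<close> in auto)
    then show ?thesis using e 2(7) by simp
  qed
  have ex: "\<exists>e. R p e" if p: "p \<in> D" for p
  proof -
    \<comment> \<open>Simple connectedness makes the constant loops at \<open>p0\<close> and
      \<open>p\<close> freely homotopic, and the track of their base point is a path in
      \<open>D\<close> from \<open>p0\<close> to \<open>p\<close>.\<close>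
    have "homotopic_loops D (\<lambda>_. p0) (\<lambda>_. p)"
      by (rule D[unfolded simply_connected_def, rule_format])
        (use p p0 in \<open>auto simp: path_def pathfinish_def pathstart_def path_image_def\<close>)
    then obtain h where h: "continuous_on ({0..1::real} \<times> {0..1::real}) h" "h \<in> ({0..1} \<times> {0..1}) \<rightarrow> D"
      "\<And>x. x \<in> {0..1} \<Longrightarrow> h (0, x) = p0" "\<And>x. x \<in> {0..1} \<Longrightarrow> h (1, x) = p"
      unfolding homotopic_loops by auto
    have \<gamma>: "path (\<lambda>t. h (t, 0))"
      unfolding path_def by (rule continuous_on_compose2[OF h(1)]) (auto intro!: continuous_intros)
    have \<gamma>': "path_image (\<lambda>t. h (t, 0)) \<subseteq> D" unfolding path_image_def using h(2) by auto
    obtain \<sigma> where "along (\<lambda>t. h (t, 0)) {0..1} \<sigma>" "\<sigma> 0 = v0" using along_path[OF \<gamma> \<gamma>' v0] by metis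
    then show ?thesis unfolding R_def using \<gamma> \<gamma>' h(3,4)
      by (intro exI[of _ "\<sigma> 1"] exI[of _ "\<lambda>t. h (t, 0)"] exI[of _ \<sigma>]) auto
  qed
  define T where "T p = (THE e. R p e)" for p
  have TR: "R p (T p)" if "p \<in> D" for p
    unfolding T_def using ex[OF that] uniq by (metis theI)
  have Teq: "T p = e" if "R p e" "p \<in> D" for p e using uniq TR that by blast
  have "Par D T"
  proof (rule Par_local[OF open_D])
    fix p assume p: "p \<in> D"
    obtain \<gamma> \<sigma> where 1: "path \<gamma>" "path_image \<gamma> \<subseteq> D" "\<gamma> 0 = p0" "\<gamma> 1 = p" "along \<gamma> {0..1} \<sigma>" "\<sigma> 0 = v0" "\<sigma> 1 = T p"
      using TR[OF p] unfolding R_def by blast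
    have TG: "T p \<in> G" using along_in[OF 1(5), of 1] 1(7) by simp
    obtain W where W: "open W" "p \<in> W" "W \<subseteq> D" "path_connected W" "\<exists>s. Par W s \<and> s p = T p"
      using flat_nhd[OF open_D p] TG by auto
    then obtain s where s: "Par W s" "s p = T p" by blast
    \<comment> \<open>The path \<open>\<gamma>\<close> to \<open>p\<close> is prolonged inside
      \<open>W\<close>, where continuation is given by the local section \<open>s\<close>.\<close>
    have "s q = T q" if q: "q \<in> W" for q
    proof -
      obtain \<eta> where \<eta>: "path \<eta>" "path_image \<eta> \<subseteq> W" "\<eta> 0 = p" "\<eta> 1 = q"
        using W(2,4) q unfolding path_connected_def pathstart_def pathfinish_def by blast
      define \<zeta> where "\<zeta> = \<gamma> +++ \<eta>"
      have z: "path \<zeta>"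
        using 1 \<eta> unfolding \<zeta>_def by (intro path_join_imp) (auto simp: pathfinish_def pathstart_def)
      have z': "path_image \<zeta> \<subseteq> D"
        using 1 \<eta> W(3) unfolding \<zeta>_def by (intro subset_path_image_join) auto
      obtain \<rho> where \<rho>: "along \<zeta> {0..1} \<rho>" "\<rho> 0 = v0" using along_path[OF z z' v0] by metis
      have e: "\<rho> (1/2) = T p" using first[OF 1(1,2,5,6) \<rho>(1)[unfolded \<zeta>_def] \<rho>(2)] 1(7) by simp
      have a1: "along \<eta> {0..1} (\<lambda>t. \<rho> (1/2 + t/2))"
      proof (rule along_compose[OF \<rho>(1), where g="\<lambda>t. 1/2 + t/2"])
        fix t :: real assume "t \<in> {0..1}"
        then show "\<eta> t = \<zeta> (1/2 + t/2)"
          using 1(4) \<eta>(3) by (cases "t = 0") (auto simp: \<zeta>_def joinpaths_def)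
      qed (auto intro!: continuous_intros)
      have \<eta>c: "continuous_on {0..1} \<eta>" "\<eta> ` {0..1} \<subseteq> W" "\<eta> ` {0..1} \<subseteq> D"
        using \<eta> W(3) by (auto simp: path_def path_image_def)
      have "(\<lambda>t. \<rho> (1/2 + t/2)) 1 = (\<lambda>t. s (\<eta> t)) 1"
        by (rule along_unique[OF connected_Icc \<eta>c(1,3) a1 along_section[OF s(1) W(1) \<eta>c(1,2)], of 0])
          (use e s \<eta> in auto)
      then have "\<rho> 1 = s q" using \<eta>(4) by simp
      then have "R q (s q)" unfolding R_def
        by (intro exI[of _ \<zeta>] exI[of _ \<rho>]) (use z z' \<rho> 1(3) \<eta>(4) in \<open>auto simp: \<zeta>_def joinpaths_def\<close>)
      then show ?thesis using Teq W(3) q by force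
    qed
    then show "\<exists>N t. open N \<and> p \<in> N \<and> Par N t \<and> (\<forall>q\<in>N. t q = T q)"
      using W s(1) by blast
  qed
  moreover have "T p0 = v0"
  proof (rule Teq[OF _ p0])
    obtain \<sigma> where "along (\<lambda>_::real. p0) {0..1} \<sigma>" "\<sigma> 0 = v0"
      using along_path[of "\<lambda>_. p0" v0] p0 v0 by (auto simp: path_def path_image_def)
    moreover obtain W t where "open W" "p0 \<in> W" "Par W t" "t p0 = v0"
      using flat_nhd[OF open_D p0] v0 by blast
    then have "along (\<lambda>_::real. p0) {0..1} (\<lambda>_. v0)"
      using along_section[of W t "{0..1}" "\<lambda>_. p0"] by auto
    ultimately show "R p0 v0" unfolding R_def using p0
      by (intro exI[of _ "\<lambda>_. p0"] exI[of _ "\<lambda>_. v0"]) (auto simp: path_def path_image_def)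
  qed
  ultimately show thesis using that by blast
qed

end

section \<open>Smooth maps of a plane domain\<close>

lemma ddir_eq: "(F has_derivative F') (at p) \<Longrightarrow> ddir X F p = F' X"
  unfolding ddir_def by (simp add: frechet_derivative_at[symmetric])

lemma has_derivative_ddir:
  "F differentiable at p \<Longrightarrow> (F has_derivative (\<lambda>X. ddir X F p)) (at p)"
  unfolding ddir_def by (simp only: frechet_derivative_works)

lemma ddir_linear: "F differentiable at p \<Longrightarrow> linear (\<lambda>X. ddir X F p)"
  by (rule has_derivative_linear[OF has_derivative_ddir])

lemma complex_eq_scaleR: "X = Re X *\<^sub>R 1 + Im X *\<^sub>R \<i>"
  by (simp add: complex_eq_iff)

lemma ddir_expand:
  assumes "F differentiable at p"
  shows "ddir X F p = Re X *\<^sub>R ddir 1 F p + Im X *\<^sub>R ddir \<i> F p"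
proof -
  have "ddir (Re X *\<^sub>R 1 + Im X *\<^sub>R \<i>) F p = Re X *\<^sub>R ddir 1 F p + Im X *\<^sub>R ddir \<i> F p"
    by (simp only: linear_add[OF ddir_linear[OF assms]] linear_scale[OF ddir_linear[OF assms]])
  then show ?thesis using complex_eq_scaleR[of X] by simp
qed

lemma ddir_cong_open:
  assumes "open V" "p \<in> V" "\<And>q. q \<in> V \<Longrightarrow> F q = G q"
  shows "ddir X F p = ddir X G p"
proof -
  have "(F has_derivative f) (at p) \<longleftrightarrow> (G has_derivative f) (at p)" for f
    using has_derivative_transform_within_open[OF _ assms(1,2), of F f UNIV G]
      has_derivative_transform_within_open[OF _ assms(1,2), of G f UNIV F] assms(3) by auto
  then show ?thesis unfolding ddir_def frechet_derivative_def by simp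
qed

lemma ddir_differentiable_cong_open:
  assumes "open V" "p \<in> V" "\<And>q. q \<in> V \<Longrightarrow> F q = G q" "F differentiable at p"
  shows "G differentiable at p"
  using has_derivative_transform_within_open[OF _ assms(1,2), of F _ UNIV G] assms(3,4)
  unfolding differentiable_def by auto

section \<open>Closure properties of maps of class C^k and smooth maps\<close>

lemma Ck_on_cong:
  assumes "open V" "\<And>q. q \<in> V \<Longrightarrow> F q = G q" "Ck_on k F V"
  shows "Ck_on k G V"
  using assms(2,3)
proof (induction k arbitrary: F G)
  case 0
  then show ?case using continuous_on_eq by (metis Ck_on.simps(1))
next
  case (Suc k)
  have "G differentiable_on V"
    using Suc.prems ddir_differentiable_cong_open[OF assms(1), of _ F G] assms(1)
    by (auto simp: differentiable_on_eq_differentiable_at)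
  moreover have "Ck_on k (ddir X G) V" if "Ck_on k (ddir X F) V" for X
    using Suc.IH[of "ddir X F" "ddir X G"] that ddir_cong_open[OF assms(1)] Suc.prems(1) by blast
  ultimately show ?case using Suc.prems by simp
qed

lemma Ck_on_subset:
  assumes "V' \<subseteq> V" "Ck_on k F V"
  shows "Ck_on k F V'"
  using assms(2)
proof (induction k arbitrary: F)
  case 0
  then show ?case using assms(1) continuous_on_subset by auto
next
  case (Suc k)
  then show ?case using assms(1) differentiable_on_subset by auto
qed

lemma Ck_on_local:
  assumes "open V" "\<And>p. p \<in> V \<Longrightarrow> \<exists>W. open W \<and> p \<in> W \<and> Ck_on k F W"
  shows "Ck_on k F V"
  using assms(2)
proof (induction k arbitrary: F)
  case 0
  have "isCont F p" if "p \<in> V" for p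
    using 0[OF that] continuous_on_eq_continuous_at by auto
  then show ?case by (simp add: continuous_at_imp_continuous_on)
next
  case (Suc k)
  have "F differentiable at p" if "p \<in> V" for p
    using Suc.prems[OF that] by (auto simp: differentiable_on_eq_differentiable_at)
  then have "F differentiable_on V"
    using assms(1) by (simp add: differentiable_on_eq_differentiable_at)
  moreover have "\<exists>W. open W \<and> p \<in> W \<and> Ck_on k (ddir X F) W" if "p \<in> V" "X = 1 \<or> X = \<i>" for p X
    using Suc.prems[OF that(1)] that(2) by auto
  then have "Ck_on k (ddir X F) V" if "X = 1 \<or> X = \<i>" for X
    using that by (intro Suc.IH) blast
  ultimately show ?case by simp
qed

lemma Ck_on_SucD:
  assumes "open V" "Ck_on (Suc k) F V"
  shows "Ck_on k F V"
  using assms(2)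
proof (induction k arbitrary: F)
  case 0
  then show ?case using differentiable_imp_continuous_on by auto
next
  case (Suc k)
  have *: "F differentiable_on V" "Ck_on (Suc k) (ddir 1 F) V" "Ck_on (Suc k) (ddir \<i> F) V"
    using Suc.prems unfolding Ck_on.simps(2)[of "Suc k"] by blast+
  show ?case unfolding Ck_on.simps(2)[of k F] using *(1) Suc.IH[OF *(2)] Suc.IH[OF *(3)] by blast
qed

lemma Ck_on_SucI:
  assumes "open V" "\<And>p. p \<in> V \<Longrightarrow> (F has_derivative (\<lambda>X. F' X p)) (at p)"
    "Ck_on k (F' 1) V" "Ck_on k (F' \<i>) V"
  shows "Ck_on (Suc k) F V"
proof -
  have "F differentiable_on V"
    using assms(1,2) by (auto simp: differentiable_on_eq_differentiable_at differentiable_def)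
  moreover have "ddir X F p = F' X p" if "p \<in> V" for X p
    using ddir_eq[OF assms(2)[OF that]] .
  ultimately show ?thesis
    using Ck_on_cong[OF assms(1) _ assms(3), of "ddir 1 F"] Ck_on_cong[OF assms(1) _ assms(4), of "ddir \<i> F"]
    by simp
qed

lemma Ck_on_Suc_has_derivative:
  assumes "open V" "Ck_on (Suc k) F V" "p \<in> V"
  shows "(F has_derivative (\<lambda>X. ddir X F p)) (at p)"
  using assms by (auto intro!: has_derivative_ddir simp: differentiable_on_eq_differentiable_at)

lemma Ck_on_add:
  assumes "open V" "Ck_on k F V" "Ck_on k G V"
  shows "Ck_on k (\<lambda>p. F p + G p) V"
  using assms(2,3)
proof (induction k arbitrary: F G)
  case (Suc k)
  show ?case
    by (rule Ck_on_SucI[OF assms(1), where F'="\<lambda>X p. ddir X F p + ddir X G p"];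
        (intro has_derivative_add Ck_on_Suc_has_derivative[OF assms(1)] Suc.IH)?)
      (use Suc.prems in auto)
qed (auto intro!: continuous_intros)

lemma Ck_on_bilinear:
  assumes "bounded_bilinear B" "open V" "Ck_on k F V" "Ck_on k G V"
  shows "Ck_on k (\<lambda>p. B (F p) (G p)) V"
  using assms(3,4)
proof (induction k arbitrary: F G)
  case 0
  then show ?case using bounded_bilinear.continuous_on[OF assms(1)] by auto
next
  case (Suc k)
  have FG: "Ck_on k F V" "Ck_on k G V" using Suc.prems Ck_on_SucD[OF assms(2)] by blast+
  have "Ck_on k (\<lambda>p. B (F p) (ddir X G p) + B (ddir X F p) (G p)) V"
    if "Ck_on k (ddir X F) V" "Ck_on k (ddir X G) V" for X
    using that FG by (intro Ck_on_add[OF assms(2)] Suc.IH)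
  then show ?case
    by (intro Ck_on_SucI[OF assms(2), where F'="\<lambda>X p. B (F p) (ddir X G p) + B (ddir X F p) (G p)"]
        bounded_bilinear.FDERIV[OF assms(1)] Ck_on_Suc_has_derivative[OF assms(2)])
      (use Suc.prems in auto)
qed

lemma Ck_on_linear:
  assumes L: "bounded_linear L" and "open V" "Ck_on k F V"
  shows "Ck_on k (\<lambda>p. L (F p)) V"
  using assms(3)
proof (induction k arbitrary: F)
  case 0
  then show ?case using bounded_linear.continuous_on[OF L] by auto
next
  case (Suc k)
  then show ?case
    by (intro Ck_on_SucI[OF assms(2), where F'="\<lambda>X p. L (ddir X F p)"]
        bounded_linear.has_derivative[OF L] Ck_on_Suc_has_derivative[OF assms(2)]) auto
qed

lemma smooth_on_differentiable: "smooth_on F V \<Longrightarrow> open V \<Longrightarrow> p \<in> V \<Longrightarrow> F differentiable at p"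
  unfolding smooth_on_def using differentiable_on_eq_differentiable_at[of V F] Ck_on.simps(2)[of 0 F V] by blast

lemma smooth_on_has_derivative:
  "smooth_on F V \<Longrightarrow> open V \<Longrightarrow> p \<in> V \<Longrightarrow> (F has_derivative (\<lambda>X. ddir X F p)) (at p)"
  by (intro has_derivative_ddir smooth_on_differentiable)

lemma smooth_on_cong:
  "smooth_on F V \<Longrightarrow> open V \<Longrightarrow> (\<And>q. q \<in> V \<Longrightarrow> F q = G q) \<Longrightarrow> smooth_on G V"
  unfolding smooth_on_def using Ck_on_cong[of V F G] by blast

lemma smooth_on_subset: "smooth_on F V \<Longrightarrow> V' \<subseteq> V \<Longrightarrow> smooth_on F V'"
  unfolding smooth_on_def using Ck_on_subset[of V' V] by blast

lemma smooth_on_local: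
  "open V \<Longrightarrow> (\<And>p. p \<in> V \<Longrightarrow> \<exists>W. open W \<and> p \<in> W \<and> smooth_on F W) \<Longrightarrow> smooth_on F V"
  unfolding smooth_on_def by (intro allI Ck_on_local) blast+

lemma smooth_on_add:
  "open V \<Longrightarrow> smooth_on F V \<Longrightarrow> smooth_on G V \<Longrightarrow> smooth_on (\<lambda>p. F p + G p) V"
  by (simp add: smooth_on_def Ck_on_add)

lemma smooth_on_bilinear:
  "bounded_bilinear B \<Longrightarrow> open V \<Longrightarrow> smooth_on F V \<Longrightarrow> smooth_on G V \<Longrightarrow> smooth_on (\<lambda>p. B (F p) (G p)) V"
  by (simp add: smooth_on_def Ck_on_bilinear)

lemma smooth_on_linear:
  "bounded_linear L \<Longrightarrow> open V \<Longrightarrow> smooth_on F V \<Longrightarrow> smooth_on (\<lambda>p. L (F p)) V"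
  by (simp add: smooth_on_def Ck_on_linear)

lemma smooth_on_diff:
  "open V \<Longrightarrow> smooth_on F V \<Longrightarrow> smooth_on G V \<Longrightarrow> smooth_on (\<lambda>p. F p - G p) V"
  using smooth_on_add[of V F "\<lambda>p. - G p"] smooth_on_linear[OF bounded_linear_minus[OF bounded_linear_ident], of V G]
  by simp

lemma smooth_on_ddir:
  assumes "open V" "smooth_on F V"
  shows "smooth_on (ddir X F) V"
proof -
  have *: "smooth_on (ddir 1 F) V" "smooth_on (ddir \<i> F) V"
    using assms(2) unfolding smooth_on_def by (metis Ck_on.simps(2))+
  have "smooth_on (\<lambda>p. Re X *\<^sub>R ddir 1 F p + Im X *\<^sub>R ddir \<i> F p) V"
    by (intro smooth_on_add[OF assms(1)] smooth_on_linear[OF bounded_linear_scaleR_right assms(1)] *)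
  then show ?thesis
    by (rule smooth_on_cong[OF _ assms(1)]) (metis ddir_expand smooth_on_differentiable assms)
qed

text \<open>Bootstrapping: the derivative of \<open>T\<close> is bilinear in \<open>T\<close> and
  the smooth coefficients, so each order of regularity of \<open>T\<close> yields the next.\<close>

lemma smooth_on_linear_ode:
  assumes B: "bounded_bilinear B" and V: "open V"
    and ode: "\<And>p. p \<in> V \<Longrightarrow> (T has_derivative (\<lambda>X. B (T p) (\<omega> X p))) (at p)"
    and \<omega>: "\<And>X. smooth_on (\<omega> X) V"
  shows "smooth_on T V"
  unfolding smooth_on_def
proof
  fix k show "Ck_on k T V"
  proof (induction k)
    case 0
    then show ?case using has_derivative_continuous[OF ode] by (auto intro!: continuous_at_imp_continuous_on)
  next
    case (Suc k)
    then show ?case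
      by (intro Ck_on_SucI[OF V, where F'="\<lambda>X p. B (T p) (\<omega> X p)"] ode Ck_on_bilinear[OF B V])
        (use \<omega> in \<open>auto simp: smooth_on_def\<close>)
  qed
qed

text \<open>Smoothness is stated through partial derivatives, whereas the Frobenius theorem takes a
  continuous derivative with values in bounded linear maps; the partials in the directions 1 and
  \<i> assemble to one.\<close>

lemma smooth_on_C1_blinfun:
  fixes F :: "complex \<Rightarrow> 'b::real_normed_vector"
  assumes V: "open V" and F: "smooth_on F V"
  obtains F' where "continuous_on V F'" "\<And>p X. p \<in> V \<Longrightarrow> blinfun_apply (F' p) X = ddir X F p"
    "\<And>p. p \<in> V \<Longrightarrow> (F has_derivative blinfun_apply (F' p)) (at p)"
proof
  let ?F' = "\<lambda>p. (blinfun_scaleR_left (ddir 1 F p) o\<^sub>L Blinfun Re) + (blinfun_scaleR_left (ddir \<i> F p) o\<^sub>L Blinfun Im)"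
  have c: "continuous_on V (ddir X F)" for X
    using smooth_on_ddir[OF V F, of X] unfolding smooth_on_def by (metis Ck_on.simps(1))
  show "continuous_on V ?F'" by (intro continuous_intros c)
  show *: "blinfun_apply (?F' p) X = ddir X F p" if "p \<in> V" for p X
    using ddir_expand[OF smooth_on_differentiable[OF F V that], of X]
    by (simp add: blinfun.bilinear_simps bounded_linear_Blinfun_apply bounded_linear_Re bounded_linear_Im)
  show "(F has_derivative blinfun_apply (?F' p)) (at p)" if "p \<in> V" for p
    by (rule has_derivative_eq_rhs[OF smooth_on_has_derivative[OF F V that]]) (rule ext, simp only: *[OF that])
qed

section \<open>Symmetry of second derivatives\<close>

lemma has_vector_derivative_ddir_line:
  assumes "F differentiable at (p + of_real t * X)"
  shows "((\<lambda>s. F (p + of_real s * X)) has_vector_derivative ddir X F (p + of_real t * X)) (at t)"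
proof -
  have "((\<lambda>s. F (p + of_real s * X)) has_derivative (\<lambda>s. ddir (of_real s * X) F (p + of_real t * X))) (at t)"
    by (rule has_derivative_compose[where f="\<lambda>s. p + of_real s * X", OF _ has_derivative_ddir[OF assms]])
      (auto intro!: derivative_eq_intros)
  then show ?thesis unfolding has_vector_derivative_def
    using linear_scale[OF ddir_linear[OF assms], of _ X] by (simp add: scaleR_conv_of_real)
qed

text \<open>The increment of \<open>F\<close> in the direction \<open>Y\<close> is an integral of
  \<open>ddir Y F\<close>. Differentiating in the direction \<open>X\<close> under the integral
  sign, and then in the upper limit, brings out the two mixed derivatives.\<close>

lemma ddir_commute:
  fixes F :: "complex \<Rightarrow> 'b::banach"
  assumes V: "open V" and F: "smooth_on F V" and p: "p \<in> V"
  shows "ddir X (ddir Y F) p = ddir Y (ddir X F) p"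
proof -
  define \<phi> where "\<phi> = (\<lambda>z::real\<times>real. p + of_real (fst z) * X + of_real (snd z) * Y)"
  have "continuous_on UNIV \<phi>" unfolding \<phi>_def by (intro continuous_intros)
  then have "open (\<phi> -` V)" using V open_vimage by blast
  moreover have "(0, 0) \<in> \<phi> -` V" using p by (simp add: \<phi>_def)
  ultimately obtain A B where AB: "open A" "open B" "0 \<in> A" "0 \<in> B" "A \<times> B \<subseteq> \<phi> -` V"
    by (metis open_prod_elim mem_Sigma_iff)
  obtain d where d: "d > 0" "cball 0 d \<subseteq> A" using AB open_contains_cball by blast
  obtain d' where d': "d' > 0" "cball 0 d' \<subseteq> B" using AB open_contains_cball by blast
  define r where "r = min d d'"
  have r: "r > 0" using d d' by (auto simp: r_def)
  have inV: "p + of_real s * X + of_real t * Y \<in> V" if "\<bar>s\<bar> \<le> r" "\<bar>t\<bar> \<le> r" for s t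
  proof -
    have "(s, t) \<in> A \<times> B" using d(2) d'(2) that by (auto simp: r_def)
    then show ?thesis using AB(5) unfolding \<phi>_def by auto
  qed
  have c: "continuous_on V (ddir Y F)" "continuous_on V (ddir X (ddir Y F))"
    using smooth_on_ddir[OF V] F unfolding smooth_on_def by (metis Ck_on.simps(1) smooth_on_def)+
  have df: "F differentiable at q" "ddir Y F differentiable at q" "ddir X F differentiable at q" if "q \<in> V" for q
    using smooth_on_differentiable[OF _ V that] smooth_on_ddir[OF V F] F by blast+
  have line: "p + of_real s * X + of_real t * Y = (p + of_real t * Y) + of_real s * X" for s t
    by (simp add: algebra_simps)
  \<comment> \<open>The lower limit is -r and not 0, so that the upper limit 0 is interior and a
    two-sided derivative in t can be taken there.\<close>
  have ftc: "integral (cbox (-r) t) (\<lambda>\<eta>. ddir Y F (p + of_real s * X + of_real \<eta> * Y)) =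
      F (p + of_real s * X + of_real t * Y) - F (p + of_real s * X + of_real (-r) * Y)"
    if st: "\<bar>s\<bar> \<le> r" "\<bar>t\<bar> \<le> r" for s t
  proof -
    have "((\<lambda>\<eta>. ddir Y F (p + of_real s * X + of_real \<eta> * Y)) has_integral
      F (p + of_real s * X + of_real t * Y) - F (p + of_real s * X + of_real (-r) * Y)) {-r..t}"
      by (rule fundamental_theorem_of_calculus)
        (use st r inV df in \<open>auto intro!: has_vector_derivative_at_within has_vector_derivative_ddir_line\<close>)
    then show ?thesis by (simp add: integral_unique)
  qed
  \<comment> \<open>Both sides of \<open>ftc\<close> are differentiated in s at 0: the integral by
    the Leibniz rule, the boundary values directly.\<close>
  have dx: "ddir X F (p + of_real t * Y) - ddir X F (p + of_real (-r) * Y) =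
      integral {-r..t} (\<lambda>\<eta>. ddir X (ddir Y F) (p + of_real \<eta> * Y))" if t: "\<bar>t\<bar> \<le> r" for t
  proof -
    let ?U = "{-r<..<r}"
    have in1: "p + of_real s * X + of_real \<eta> * Y \<in> V" if "s \<in> ?U" "\<eta> \<in> cbox (-r) t" for s \<eta>
      using inV[of s \<eta>] that t by auto
    have "((\<lambda>s. integral (cbox (-r) t) (\<lambda>\<eta>. ddir Y F (p + of_real s * X + of_real \<eta> * Y)))
        has_vector_derivative integral (cbox (-r) t) (\<lambda>\<eta>. ddir X (ddir Y F) (p + of_real 0 * X + of_real \<eta> * Y)))
        (at 0 within ?U)"
    proof (rule leibniz_rule_vector_derivative[where fx="\<lambda>s \<eta>. ddir X (ddir Y F) (p + of_real s * X + of_real \<eta> * Y)"])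
      fix s \<eta> assume s: "s \<in> ?U" and e: "\<eta> \<in> cbox (-r) t"
      show "((\<lambda>s. ddir Y F (p + of_real s * X + of_real \<eta> * Y)) has_vector_derivative
          ddir X (ddir Y F) (p + of_real s * X + of_real \<eta> * Y)) (at s within ?U)"
        unfolding line
        by (rule has_vector_derivative_at_within, rule has_vector_derivative_ddir_line)
          (use df(2)[OF in1[OF s e]] in \<open>simp add: line\<close>)
    next
      fix s assume s: "s \<in> ?U"
      show "(\<lambda>\<eta>. ddir Y F (p + of_real s * X + of_real \<eta> * Y)) integrable_on cbox (-r) t"
        by (rule integrable_continuous, rule continuous_on_compose2[OF c(1)])
          (use in1[OF s] in \<open>auto intro!: continuous_intros\<close>)
    next
      show "continuous_on (?U \<times> cbox (-r) t) (\<lambda>(s, \<eta>). ddir X (ddir Y F) (p + of_real s * X + of_real \<eta> * Y))"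
        unfolding split_beta
        by (rule continuous_on_compose2[OF c(2)]) (use in1 in \<open>auto intro!: continuous_intros\<close>)
    qed (use r in auto)
    moreover have at0: "at 0 within ?U = at (0::real)" using r by (intro at_within_open) auto
    moreover have "((\<lambda>s. F ((p + of_real t * Y) + of_real s * X) - F ((p + of_real (-r) * Y) + of_real s * X))
      has_vector_derivative ddir X F ((p + of_real t * Y) + of_real 0 * X) - ddir X F ((p + of_real (-r) * Y) + of_real 0 * X)) (at 0)"
      using inV[of 0 t] inV[of 0 "-r"] t r
      by (intro has_vector_derivative_diff has_vector_derivative_ddir_line df) auto
    then have "((\<lambda>s. integral (cbox (-r) t) (\<lambda>\<eta>. ddir Y F (p + of_real s * X + of_real \<eta> * Y)))
      has_vector_derivative ddir X F ((p + of_real t * Y) + of_real 0 * X) - ddir X F ((p + of_real (-r) * Y) + of_real 0 * X)) (at 0)"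
      by (rule has_vector_derivative_transform_within_open[of _ _ _ ?U])
        (use r t in \<open>auto simp: ftc[unfolded cbox_interval] line[symmetric] simp del: of_real_minus\<close>)
    ultimately have "ddir X F ((p + of_real t * Y) + of_real 0 * X) - ddir X F ((p + of_real (-r) * Y) + of_real 0 * X)
       = integral (cbox (-r) t) (\<lambda>\<eta>. ddir X (ddir Y F) (p + of_real 0 * X + of_real \<eta> * Y))"
      using vector_derivative_unique_at by metis
    then show ?thesis by simp
  qed
  have 1: "((\<lambda>t. integral {-r..t} (\<lambda>\<eta>. ddir X (ddir Y F) (p + of_real \<eta> * Y))) has_vector_derivative
      ddir X (ddir Y F) (p + of_real 0 * Y)) (at 0 within {-r..r})"
    by (rule integral_has_vector_derivative, rule continuous_on_compose2[OF c(2)])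
      (use inV[of 0] r in \<open>auto intro!: continuous_intros\<close>)
  have "at 0 within {-r..r} = at (0::real)" using r by (intro at_within_interior) auto
  with 1 have 1: "((\<lambda>t. integral {-r..t} (\<lambda>\<eta>. ddir X (ddir Y F) (p + of_real \<eta> * Y))) has_vector_derivative
      ddir X (ddir Y F) (p + of_real 0 * Y)) (at 0)" by simp
  have "((\<lambda>t. ddir X F (p + of_real t * Y) - ddir X F (p + of_real (-r) * Y)) has_vector_derivative
      ddir Y (ddir X F) (p + of_real 0 * Y) - 0) (at 0)"
    by (intro has_vector_derivative_diff has_vector_derivative_ddir_line has_vector_derivative_const df)
      (use p in simp)
  then have "((\<lambda>t. integral {-r..t} (\<lambda>\<eta>. ddir X (ddir Y F) (p + of_real \<eta> * Y))) has_vector_derivative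
      ddir Y (ddir X F) (p + of_real 0 * Y) - 0) (at 0)"
    by (rule has_vector_derivative_transform_within_open[of _ _ _ "{-r<..<r}"])
      (use r in \<open>auto simp: dx simp del: of_real_minus\<close>)
  with 1 show ?thesis using vector_derivative_unique_at by fastforce
qed

section \<open>Real matrices acting on \<open>\<complex>\<^sup>4\<close>\<close>

definition real_act :: "real ^ 4 ^ 4 \<Rightarrow> complex ^ 4 \<Rightarrow> complex ^ 4" where
  "real_act M v = (\<chi> i. \<Sum>j\<in>UNIV. of_real (M $ i $ j) * v $ j)"

text \<open>The rank-one matrix a b^* plus its complex conjugate. For an isotropic unit vector
  \<open>F\<close> the matrix \<open>real_outer F F\<close> is the orthogonal projection onto the
  real span of Re F and Im F.\<close>

definition real_outer :: "complex ^ 4 \<Rightarrow> complex ^ 4 \<Rightarrow> real ^ 4 ^ 4" where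
  "real_outer a b = (\<chi> i j. 2 * Re (a $ i * cnj (b $ j)))"

definition real_wedge :: "complex ^ 4 \<Rightarrow> complex ^ 4 \<Rightarrow> real ^ 4 ^ 4" where
  "real_wedge a b = real_outer a b - real_outer b a"

section \<open>Algebra of the bilinear and Hermitian products\<close>

lemma bil_commute: "bil v w = bil w v"
  by (simp add: bil_def mult.commute)

lemma bil_add: "bil (u + v) w = bil u w + bil v w" "bil w (u + v) = bil w u + bil w v"
  by (simp_all add: bil_def algebra_simps sum.distrib)

lemma bil_diff: "bil (u - v) w = bil u w - bil v w" "bil w (u - v) = bil w u - bil w v"
  by (simp_all add: bil_def algebra_simps sum_subtractf)

lemma bil_scale: "bil (c *s v) w = c * bil v w" "bil v (c *s w) = c * bil v w"
  by (simp_all add: bil_def algebra_simps sum_distrib_left)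

lemma cnjv_cnjv [simp]: "cnjv (cnjv v) = v"
  by (simp add: cnjv_def vec_eq_iff)

lemma cnjv_linear: "cnjv (u + v) = cnjv u + cnjv v" "cnjv (u - v) = cnjv u - cnjv v" "cnjv (c *s v) = cnj c *s cnjv v"
  by (simp_all add: cnjv_def vec_eq_iff)

lemma bil_cnjv: "bil (cnjv v) (cnjv w) = cnj (bil v w)"
  by (simp add: bil_def cnjv_def)

lemma herm_cnjv: "herm v (cnjv w) = bil v w" "herm (cnjv v) w = cnj (bil v w)"
  by (simp_all add: herm_def bil_cnjv)

lemma herm_sym: "herm w v = cnj (herm v w)"
  unfolding herm_def by (metis bil_cnjv bil_commute cnjv_cnjv)

lemma herm_add: "herm (u + v) w = herm u w + herm v w" "herm w (u + v) = herm w u + herm w v"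
  by (simp_all add: herm_def bil_add cnjv_linear)

lemma herm_diff: "herm (u - v) w = herm u w - herm v w" "herm w (u - v) = herm w u - herm w v"
  by (simp_all add: herm_def bil_diff cnjv_linear)

lemma herm_scale: "herm (c *s v) w = c * herm v w" "herm v (c *s w) = cnj c * herm v w"
  by (simp_all add: herm_def bil_scale cnjv_linear)

lemma scaleR_eq_scale: "r *\<^sub>R v = of_real r *s (v :: complex ^ 4)"
  by (simp add: vec_eq_iff scaleR_conv_of_real[where 'a=complex])

lemma inner_eq_Re_herm: "inner v w = Re (herm v w)"
  by (simp add: herm_def bil_def cnjv_def inner_vec_def inner_complex_def)

lemma norm_eq_1_iff_herm: "norm v = 1 \<longleftrightarrow> herm v v = 1"
proof -
  have "Im (herm v v) = 0" using arg_cong[OF herm_sym[of v v], of Im] by simp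
  then show ?thesis
    by (simp add: norm_eq_1 inner_eq_Re_herm complex_eq_iff)
qed

lemma bounded_bilinear_herm: "bounded_bilinear herm"
proof (rule bilinear_conv_bounded_bilinear[THEN iffD1])
  show "bilinear herm"
    unfolding bilinear_def
    by (auto intro!: linearI simp: herm_add herm_scale scaleR_eq_scale scaleR_conv_of_real[where 'a=complex])
qed

lemma bounded_bilinear_bil: "bounded_bilinear bil"
proof (rule bilinear_conv_bounded_bilinear[THEN iffD1])
  show "bilinear bil"
    unfolding bilinear_def
    by (auto intro!: linearI simp: bil_add bil_scale scaleR_eq_scale scaleR_conv_of_real[where 'a=complex])
qed

lemma bounded_bilinear_vscale: "bounded_bilinear ((*s) :: complex \<Rightarrow> complex ^ 4 \<Rightarrow> complex ^ 4)"
proof (rule bilinear_conv_bounded_bilinear[THEN iffD1])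
  show "bilinear ((*s) :: complex \<Rightarrow> complex ^ 4 \<Rightarrow> complex ^ 4)"
    unfolding bilinear_def
    by (auto intro!: linearI simp: vec_eq_iff algebra_simps scaleR_conv_of_real[where 'a=complex])
qed

lemma bounded_bilinear_real_outer: "bounded_bilinear real_outer"
proof (rule bilinear_conv_bounded_bilinear[THEN iffD1])
  show "bilinear real_outer"
    unfolding bilinear_def
    by (auto intro!: linearI simp: real_outer_def vec_eq_iff algebra_simps scaleR_conv_of_real[where 'a=complex])
qed

lemma bounded_bilinear_real_wedge: "bounded_bilinear real_wedge"
proof (rule bilinear_conv_bounded_bilinear[THEN iffD1])
  show "bilinear real_wedge"
    unfolding bilinear_def
    by (auto intro!: linearI simp: real_wedge_def real_outer_def vec_eq_iff algebra_simps scaleR_conv_of_real[where 'a=complex])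
qed

lemma bounded_bilinear_real_act: "bounded_bilinear real_act"
proof (rule bilinear_conv_bounded_bilinear[THEN iffD1])
  show "bilinear real_act"
    unfolding bilinear_def
    by (auto intro!: linearI simp: real_act_def vec_eq_iff algebra_simps sum.distrib sum_distrib_left scaleR_conv_of_real[where 'a=complex])
qed

lemma bounded_bilinear_matrix_mult:
  "bounded_bilinear ((**) :: real ^ 4 ^ 4 \<Rightarrow> real ^ 4 ^ 4 \<Rightarrow> real ^ 4 ^ 4)"
proof (rule bilinear_conv_bounded_bilinear[THEN iffD1])
  show "bilinear ((**) :: real ^ 4 ^ 4 \<Rightarrow> real ^ 4 ^ 4 \<Rightarrow> real ^ 4 ^ 4)"
    unfolding bilinear_def
    by (auto intro!: linearI simp: matrix_matrix_mult_def vec_eq_iff algebra_simps sum.distrib sum_distrib_left)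
qed

lemma bounded_linear_transpose: "bounded_linear (transpose :: real ^ 4 ^ 4 \<Rightarrow> real ^ 4 ^ 4)"
  by (rule linear_conv_bounded_linear[THEN iffD1]) (auto intro!: linearI simp: transpose_def vec_eq_iff)

interpretation vscale: bounded_bilinear "(*s) :: complex \<Rightarrow> complex ^ 4 \<Rightarrow> complex ^ 4"
  by (rule bounded_bilinear_vscale)
interpretation real_outer: bounded_bilinear real_outer by (rule bounded_bilinear_real_outer)
interpretation real_wedge: bounded_bilinear real_wedge by (rule bounded_bilinear_real_wedge)
interpretation real_act: bounded_bilinear real_act by (rule bounded_bilinear_real_act)
interpretation mat4: bounded_bilinear "(**) :: real ^ 4 ^ 4 \<Rightarrow> real ^ 4 ^ 4 \<Rightarrow> real ^ 4 ^ 4"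
  by (rule bounded_bilinear_matrix_mult)

text \<open>A product of two real parts splits into a term with \<open>y\<close> and a term with
  \<open>cnj y\<close>; contraction of the inner index turns these into the Hermitian and the
  bilinear product of \<open>c\<close> and \<open>b\<close>.\<close>

lemma real_outer_mult:
  "real_outer a b ** real_outer c d = real_outer (herm c b *s a) d + real_outer (cnj (bil c b) *s a) (cnjv d)"
proof -
  have "(\<Sum>k\<in>UNIV. 2 * Re (a $ i * cnj (b $ k)) * (2 * Re (c $ k * cnj (d $ j)))) =
      2 * Re (herm c b * a $ i * cnj (d $ j)) + 2 * Re (cnj (bil c b) * a $ i * d $ j)" for i j
  proof -
    have "2 * Re x * (2 * Re y) = 2 * Re (x * y) + 2 * Re (x * cnj y)" for x y :: complex
      by (simp add: algebra_simps)
    then have "(\<Sum>k\<in>UNIV. 2 * Re (a $ i * cnj (b $ k)) * (2 * Re (c $ k * cnj (d $ j)))) =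
      2 * Re (\<Sum>k\<in>UNIV. a $ i * cnj (b $ k) * (c $ k * cnj (d $ j))) +
      2 * Re (\<Sum>k\<in>UNIV. a $ i * cnj (b $ k) * cnj (c $ k * cnj (d $ j)))"
      by (simp only: Re_sum sum.distrib sum_distrib_left)
    also have "(\<Sum>k\<in>UNIV. a $ i * cnj (b $ k) * (c $ k * cnj (d $ j))) = herm c b * a $ i * cnj (d $ j)"
      by (simp add: herm_def bil_def cnjv_def sum_distrib_left sum_distrib_right mult_ac)
    also have "(\<Sum>k\<in>UNIV. a $ i * cnj (b $ k) * cnj (c $ k * cnj (d $ j))) = cnj (bil c b) * a $ i * d $ j"
      by (simp add: bil_def sum_distrib_left sum_distrib_right mult_ac)
    finally show ?thesis .
  qed
  then show ?thesis
    by (simp add: matrix_matrix_mult_def vec_eq_iff real_outer_def cnjv_def)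
qed

lemma real_act_real_outer: "real_act (real_outer a b) v = herm v b *s a + bil v b *s cnjv a"
proof -
  have "complex_of_real (2 * Re (a $ i * cnj (b $ j))) = a $ i * cnj (b $ j) + cnj (a $ i) * b $ j" for i j
    by (simp add: complex_eq_iff)
  then show ?thesis
    by (simp add: real_act_def real_outer_def vec_eq_iff herm_def bil_def cnjv_def sum.distrib
        sum_distrib_left sum_distrib_right mult_ac distrib_left)
qed

lemma transpose_real_wedge: "transpose (real_wedge a b) = - real_wedge a b"
  by (simp add: real_wedge_def transpose_def real_outer_def vec_eq_iff algebra_simps)

lemma real_outer_scale: "real_outer a (c *s b) = real_outer (cnj c *s a) b"
  by (simp add: real_outer_def vec_eq_iff mult_ac)

lemma real_outer_cnjv: "real_outer (cnjv a) (cnjv b) = real_outer a b"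
  by (simp add: real_outer_def cnjv_def vec_eq_iff)

lemma real_outer_cnjv_commute: "real_outer (cnjv a) b = real_outer a (cnjv b)"
  by (metis cnjv_cnjv real_outer_cnjv)

lemma real_act_mult: "real_act (M ** N) v = real_act M (real_act N v)"
proof -
  have "(\<Sum>j\<in>UNIV. \<Sum>k\<in>UNIV. of_real (M $ i $ k) * of_real (N $ k $ j) * v $ j) =
     (\<Sum>k\<in>UNIV. \<Sum>j\<in>UNIV. of_real (M $ i $ k) * of_real (N $ k $ j) * v $ j)" for i
    by (rule sum.swap)
  then show ?thesis
    by (simp add: real_act_def matrix_matrix_mult_def vec_eq_iff sum_distrib_left sum_distrib_right mult.assoc)
qed

lemma real_act_1 [simp]: "real_act (mat 1) v = v"
proof -
  have "complex_of_real (if i = j then 1 else 0) * v $ j = (if j = i then v $ j else 0)" for i j :: 4 by simp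
  then show ?thesis by (simp add: real_act_def mat_def vec_eq_iff)
qed

lemma real_act_cscale: "real_act M (c *s v) = c *s real_act M v"
  by (simp add: real_act_def vec_eq_iff sum_distrib_left mult_ac)

lemma cnjv_real_act: "cnjv (real_act M v) = real_act M (cnjv v)"
  by (simp add: cnjv_def real_act_def vec_eq_iff)

lemma bil_real_act_left: "bil (real_act M v) w = bil v (real_act (transpose M) w)"
proof -
  have "(\<Sum>i\<in>UNIV. \<Sum>j\<in>UNIV. of_real (M $ i $ j) * v $ j * w $ i) =
     (\<Sum>j\<in>UNIV. \<Sum>i\<in>UNIV. of_real (M $ i $ j) * v $ j * w $ i)"
    by (rule sum.swap)
  then show ?thesis
    by (simp add: bil_def real_act_def transpose_def sum_distrib_left sum_distrib_right mult_ac)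
qed

context
  fixes M :: "real ^ 4 ^ 4"
  assumes orth: "orthogonal_matrix M"
begin

lemma bil_real_act: "bil (real_act M v) (real_act M w) = bil v w"
  using orth by (simp add: bil_real_act_left orthogonal_matrix_def real_act_mult[symmetric])

lemma herm_real_act: "herm (real_act M v) (real_act M w) = herm v w"
  by (simp add: herm_def cnjv_real_act bil_real_act)

lemma inner_real_act: "inner (real_act M v) (real_act M w) = inner v w"
  by (simp add: inner_eq_Re_herm herm_real_act)

lemma norm_real_act: "norm (real_act M v) = norm v"
  by (simp add: norm_eq_sqrt_inner inner_real_act)

lemma real_act_transpose_cancel:
  "real_act (transpose M) (real_act M v) = v" "real_act M (real_act (transpose M) v) = v"
  using orth by (simp_all add: orthogonal_matrix_def real_act_mult[symmetric])

end

text \<open>The bracket of two tangent directions of the symmetric space lies in the isotropy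
  algebra. The contributions built from \<open>F\<close> alone cancel because \<open>bil\<close> is
  symmetric and because of \<open>ab\<close>, which is the form taken by the Lagrangian
  condition.\<close>

lemma real_wedge_commutator:
  assumes F: "herm F F = 1" "bil F F = 0"
    and a: "herm a F = 0" "bil a F = 0" and b: "herm b F = 0" "bil b F = 0"
    and ab: "herm a b = herm b a"
  shows "real_wedge a F ** real_wedge b F - real_wedge b F ** real_wedge a F = - real_wedge a b"
proof -
  have z: "herm F a = 0" "bil F a = 0" "herm F b = 0" "bil F b = 0"
    using a b herm_sym[of F a] herm_sym[of F b] bil_commute by auto
  have "real_wedge a F ** real_wedge b F = - real_outer a b - real_outer (herm b a *s F) F - real_outer (cnj (bil b a) *s F) (cnjv F)"
    by (simp add: real_wedge_def mat4.diff_left mat4.diff_right real_outer_mult z F a b real_outer.zero_left)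
  moreover have "real_wedge b F ** real_wedge a F = - real_outer b a - real_outer (herm a b *s F) F - real_outer (cnj (bil a b) *s F) (cnjv F)"
    by (simp add: real_wedge_def mat4.diff_left mat4.diff_right real_outer_mult z F a b real_outer.zero_left)
  ultimately show ?thesis
    using ab bil_commute[of a b] by (simp add: real_wedge_def)
qed

text \<open>With P = \<open>real_outer F F\<close> and \<open>D\<close> a derivative of
  \<open>F\<close>, the left side is the commutator of dP with P. The vertical part
  \<open>h *s F\<close> drops out of dP because \<open>h\<close> is imaginary.\<close>

lemma projection_commutator:
  assumes F: "herm F F = 1" "bil F F = 0"
    and D: "D = t + h *s F" "Re h = 0" and t: "herm t F = 0" "bil t F = 0"
  shows "(real_outer D F + real_outer F D) ** real_outer F F - real_outer F F ** (real_outer D F + real_outer F D)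
    = real_wedge t F"
proof -
  have z: "herm F t = 0" "bil F t = 0"
    using t herm_sym[of F t] bil_commute by auto
  have "cnj h = - h" using D(2) by (simp add: complex_eq_iff)
  then have "real_outer D F + real_outer F D = real_outer t F + real_outer F t + (real_outer (h *s F) F + real_outer ((-h) *s F) F)"
    by (simp add: D real_outer.add_left real_outer.add_right real_outer_scale)
  also have "\<dots> = real_outer t F + real_outer F t"
    by (simp add: real_outer.add_left[symmetric] vec.scale_left_distrib[symmetric] real_outer.zero_left)
  finally show ?thesis
    by (simp add: mat4.add_left mat4.add_right real_outer_mult z t F real_outer.zero_left real_wedge_def)
qed

section \<open>The moving frame of a minimal Lagrangian lift\<close>

lemma ddir_bilinear:
  assumes "bounded_bilinear B" "F differentiable at p" "G differentiable at p"
  shows "ddir X (\<lambda>q. B (F q) (G q)) p = B (F p) (ddir X G p) + B (ddir X F p) (G p)"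
  by (rule ddir_eq[OF bounded_bilinear.FDERIV[OF assms(1) has_derivative_ddir[OF assms(2)] has_derivative_ddir[OF assms(3)]]])

lemma ddir_add:
  "F differentiable at p \<Longrightarrow> G differentiable at p \<Longrightarrow> ddir X (\<lambda>q. F q + G q) p = ddir X F p + ddir X G p"
  by (rule ddir_eq[OF has_derivative_add[OF has_derivative_ddir has_derivative_ddir]])

lemma ddir_diff:
  "F differentiable at p \<Longrightarrow> G differentiable at p \<Longrightarrow> ddir X (\<lambda>q. F q - G q) p = ddir X F p - ddir X G p"
  by (rule ddir_eq[OF has_derivative_diff[OF has_derivative_ddir has_derivative_ddir]])

lemma ddir_scaleR:
  "F differentiable at p \<Longrightarrow> ddir X (\<lambda>q. r *\<^sub>R F q) p = r *\<^sub>R ddir X F p"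
  by (rule ddir_eq[OF has_derivative_scaleR_right[OF has_derivative_ddir]])

lemma ddir_const_open:
  assumes "open W" "p \<in> W" "\<And>q. q \<in> W \<Longrightarrow> F q = c"
  shows "ddir X F p = 0"
proof -
  have "ddir X F p = ddir X (\<lambda>_. c) p" by (rule ddir_cong_open[OF assms])
  also have "\<dots> = 0" by (rule ddir_eq[where F'="\<lambda>_. 0"]) simp
  finally show ?thesis .
qed

text \<open>For an isotropic unit vector \<open>f\<close> this is the orthogonal projection onto the
  horizontal copy of the tangent space of \<open>Q2\<close>, the last step in
  \<open>cov_Q2\<close>.\<close>

definition Q2_tangent :: "complex ^ 4 \<Rightarrow> complex ^ 4 \<Rightarrow> complex ^ 4" where
  "Q2_tangent f v = v - herm v f *s f - herm v (cnjv f) *s cnjv f"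

lemma Q2_tangent_linear:
  "Q2_tangent f (u + v) = Q2_tangent f u + Q2_tangent f v"
  "Q2_tangent f (u - v) = Q2_tangent f u - Q2_tangent f v"
  "Q2_tangent f (r *\<^sub>R v) = r *\<^sub>R Q2_tangent f v"
  by (simp_all add: Q2_tangent_def herm_add herm_diff herm_scale scaleR_eq_scale vec_eq_iff algebra_simps)

lemma Q2_tangent_scale_self:
  "herm f f = 1 \<Longrightarrow> bil f f = 0 \<Longrightarrow> Q2_tangent f (c *s f) = 0"
  by (simp add: Q2_tangent_def herm_scale herm_cnjv bil_scale)

lemma Q2_tangent_scale_cnjv:
  "herm f f = 1 \<Longrightarrow> bil f f = 0 \<Longrightarrow> Q2_tangent f (c *s cnjv f) = 0"
  using herm_sym[of "cnjv f" "cnjv f"]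
  by (simp add: Q2_tangent_def herm_scale herm_cnjv bil_scale herm_def[symmetric] bil_commute[of "cnjv f"])

lemma cov_Q2_alt:
  "cov_Q2 X Y F p = Q2_tangent (F p) (ddir X (tang Y F) p - herm (ddir X F p) (F p) *s tang Y F p)"
  by (simp add: cov_Q2_def Q2_tangent_def Let_def)

locale isotropic_lift =
  fixes F :: "complex \<Rightarrow> complex ^ 4" and W :: "complex set"
  assumes open_W: "open W" and smooth_F: "smooth_on F W"
    and norm_F: "\<And>p. p \<in> W \<Longrightarrow> norm (F p) = 1"
    and bil_F: "\<And>p. p \<in> W \<Longrightarrow> bil (F p) (F p) = 0"
begin

lemma herm_F: "p \<in> W \<Longrightarrow> herm (F p) (F p) = 1"
  using norm_F norm_eq_1_iff_herm by blast

lemma diff_F: "p \<in> W \<Longrightarrow> F differentiable at p"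
  using smooth_on_differentiable[OF smooth_F open_W] .

lemma smooth_ddir: "smooth_on (ddir X F) W"
  by (rule smooth_on_ddir[OF open_W smooth_F])

lemma diff_ddir: "p \<in> W \<Longrightarrow> ddir X F differentiable at p"
  using smooth_on_differentiable[OF smooth_ddir open_W] .

lemma smooth_vert: "smooth_on (\<lambda>p. herm (ddir X F p) (F p)) W"
  by (rule smooth_on_bilinear[OF bounded_bilinear_herm open_W smooth_ddir smooth_F])

lemma smooth_tang: "smooth_on (tang X F) W"
  unfolding tang_def[abs_def]
  by (intro smooth_on_diff[OF open_W] smooth_ddir smooth_on_bilinear[OF bounded_bilinear_vscale open_W]
      smooth_vert smooth_F)

lemma diff_tang: "p \<in> W \<Longrightarrow> tang X F differentiable at p"
  using smooth_on_differentiable[OF smooth_tang open_W] .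

lemma diff_vert: "p \<in> W \<Longrightarrow> (\<lambda>q. herm (ddir X F q) (F q)) differentiable at p"
  using smooth_on_differentiable[OF smooth_vert open_W] .

lemma Re_vert: "p \<in> W \<Longrightarrow> Re (herm (ddir X F p) (F p)) = 0"
proof -
  assume p: "p \<in> W"
  have "herm (F p) (ddir X F p) + herm (ddir X F p) (F p) = 0"
    using ddir_bilinear[OF bounded_bilinear_herm diff_F[OF p] diff_F[OF p], of X]
      ddir_const_open[OF open_W p, of "\<lambda>q. herm (F q) (F q)" 1 X] herm_F by simp
  then show ?thesis
    using herm_sym[of "F p" "ddir X F p"] by (simp add: complex_eq_iff)
qed

lemma cnj_vert: "p \<in> W \<Longrightarrow> cnj (herm (ddir X F p) (F p)) = - herm (ddir X F p) (F p)"
  using Re_vert by (simp add: complex_eq_iff)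

lemma bil_ddir: "p \<in> W \<Longrightarrow> bil (ddir X F p) (F p) = 0"
proof -
  assume p: "p \<in> W"
  have "bil (F p) (ddir X F p) + bil (ddir X F p) (F p) = 0"
    using ddir_bilinear[OF bounded_bilinear_bil diff_F[OF p] diff_F[OF p], of X]
      ddir_const_open[OF open_W p, of "\<lambda>q. bil (F q) (F q)" 0 X] bil_F by simp
  then show ?thesis by (simp add: bil_commute)
qed

lemma ddir_eq_tang: "ddir X F p = tang X F p + herm (ddir X F p) (F p) *s F p"
  by (simp add: tang_def)

lemma tang_perp:
  assumes "p \<in> W"
  shows "herm (tang X F p) (F p) = 0" "bil (tang X F p) (F p) = 0"
    "herm (F p) (tang X F p) = 0" "bil (F p) (tang X F p) = 0"
proof -
  show 1: "herm (tang X F p) (F p) = 0" "bil (tang X F p) (F p) = 0"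
    using assms by (simp_all add: tang_def herm_diff herm_scale bil_diff bil_scale herm_F bil_F bil_ddir)
  then show "herm (F p) (tang X F p) = 0" "bil (F p) (tang X F p) = 0"
    using herm_sym[of "F p" "tang X F p"] bil_commute by auto
qed

lemma tang_expand: "p \<in> W \<Longrightarrow> tang X F p = Re X *\<^sub>R tang 1 F p + Im X *\<^sub>R tang \<i> F p"
  unfolding tang_def[of X] ddir_expand[OF diff_F, of p X]
  by (simp add: tang_def herm_add herm_scale scaleR_eq_scale vec_eq_iff algebra_simps)

lemma tang_add: "p \<in> W \<Longrightarrow> tang (X + Y) F p = tang X F p + tang Y F p"
  using tang_expand[of p X] tang_expand[of p Y] tang_expand[of p "X + Y"] by (simp add: algebra_simps)

lemma tang_scaleR: "p \<in> W \<Longrightarrow> tang (r *\<^sub>R X) F p = r *\<^sub>R tang X F p"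
  using tang_expand[of p X] tang_expand[of p "r *\<^sub>R X"] by (simp add: algebra_simps)

lemma projection_commutator_F:
  assumes "p \<in> W"
  shows "(real_outer (ddir X F p) (F p) + real_outer (F p) (ddir X F p)) ** real_outer (F p) (F p) -
    real_outer (F p) (F p) ** (real_outer (ddir X F p) (F p) + real_outer (F p) (ddir X F p)) =
    real_wedge (tang X F p) (F p)"
  by (rule projection_commutator[OF herm_F bil_F ddir_eq_tang Re_vert tang_perp(1,2)]) (use assms in auto)

text \<open>The Levi-Civita connection is torsion-free and constant coordinate fields commute. In
  terms of the lift, the two unprojected expressions differ by a multiple of \<open>F p\<close>,
  which the projection removes.\<close>

lemma cov_Q2_commute:
  assumes p: "p \<in> W"
  shows "cov_Q2 X Y F p = cov_Q2 Y X F p"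
proof -
  define h where "h X q = herm (ddir X F q) (F q)" for X q
  have dt: "ddir X (tang Y F) p = ddir X (ddir Y F) p - (h Y p *s ddir X F p + ddir X (h Y) p *s F p)" for X Y
  proof -
    have dh: "h Y differentiable at p" using diff_vert[OF p] unfolding h_def .
    have dhF: "(\<lambda>q. h Y q *s F q) differentiable at p"
      using vscale.FDERIV[OF has_derivative_ddir[OF dh] has_derivative_ddir[OF diff_F[OF p]]]
      unfolding differentiable_def by blast
    show ?thesis
      using ddir_diff[OF diff_ddir[OF p] dhF, of X] ddir_bilinear[OF bounded_bilinear_vscale dh diff_F[OF p], of X]
      by (simp add: tang_def[abs_def] h_def)
  qed
  have "(ddir X (tang Y F) p - h X p *s tang Y F p) =
      (ddir Y (tang X F) p - h Y p *s tang X F p) + (ddir Y (h X) p - ddir X (h Y) p) *s F p"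
    unfolding dt using ddir_commute[OF open_W smooth_F p, of X Y]
    by (simp add: tang_def h_def vec_eq_iff algebra_simps)
  then show ?thesis
    unfolding cov_Q2_alt h_def[symmetric]
    using Q2_tangent_scale_self[OF herm_F[OF p] bil_F[OF p]] by (simp add: Q2_tangent_linear)
qed

lemma cov_Q2_expand_right:
  assumes p: "p \<in> W"
  shows "cov_Q2 X Y F p = Re Y *\<^sub>R cov_Q2 X 1 F p + Im Y *\<^sub>R cov_Q2 X \<i> F p"
proof -
  have "ddir X (tang Y F) p = ddir X (\<lambda>q. Re Y *\<^sub>R tang 1 F q + Im Y *\<^sub>R tang \<i> F q) p"
    by (rule ddir_cong_open[OF open_W p tang_expand])
  also have "\<dots> = Re Y *\<^sub>R ddir X (tang 1 F) p + Im Y *\<^sub>R ddir X (tang \<i> F) p"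
    using diff_tang[OF p]
    by (subst ddir_add) (auto simp: ddir_scaleR intro!: differentiable_scaleR)
  finally have "ddir X (tang Y F) p - herm (ddir X F p) (F p) *s tang Y F p =
      Re Y *\<^sub>R (ddir X (tang 1 F) p - herm (ddir X F p) (F p) *s tang 1 F p) +
      Im Y *\<^sub>R (ddir X (tang \<i> F) p - herm (ddir X F p) (F p) *s tang \<i> F p)"
    using tang_expand[OF p, of Y] by (simp add: scaleR_eq_scale vec_eq_iff algebra_simps)
  then show ?thesis unfolding cov_Q2_alt by (simp add: Q2_tangent_linear)
qed

lemma cov_Q2_expand:
  assumes p: "p \<in> W"
  shows "cov_Q2 X Y F p = (Re X * Re Y) *\<^sub>R cov_Q2 1 1 F p + (Re X * Im Y + Im X * Re Y) *\<^sub>R cov_Q2 1 \<i> F p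
     + (Im X * Im Y) *\<^sub>R cov_Q2 \<i> \<i> F p"
  using cov_Q2_expand_right[OF p, of X Y] cov_Q2_expand_right[OF p, of 1 X] cov_Q2_expand_right[OF p, of \<i> X]
    cov_Q2_commute[OF p]
  by (simp add: algebra_simps)

end

text \<open>Multiplying both vectors by a common phase leaves \<open>real_wedge\<close> unchanged;
  this is the infinitesimal version. It removes the phase of the lift from the derivative of the
  connection.\<close>

lemma real_wedge_gauge:
  assumes "cnj h = - h"
  shows "real_wedge (h *s a) b + real_wedge a (h *s b) = 0"
proof -
  have "real_wedge (h *s a) b + real_wedge a (h *s b) =
    real_outer (h *s a) b + real_outer ((-h) *s a) b - (real_outer (h *s b) a + real_outer ((-h) *s b) a)"
    using assms by (simp add: real_wedge_def real_outer_scale)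
  also have "\<dots> = 0"
    by (simp add: real_outer.add_left[symmetric] vec.scale_left_distrib[symmetric] real_outer.zero_left)
  finally show ?thesis .
qed

lemma real_wedge_scale_self: "Im c = 0 \<Longrightarrow> real_wedge (c *s a) a = 0"
  using complex_eq_iff[of "cnj c" c] by (simp add: real_wedge_def real_outer_scale)

text \<open>Hence the component of a derivative along \<open>cnjv F\<close>, which is normal to
  \<open>Q2\<close>, is invisible to the wedge with \<open>F\<close>.\<close>

lemma real_wedge_scale_cnjv: "real_wedge (c *s cnjv a) a = 0"
proof -
  have "real_outer a (c *s cnjv a) = real_outer (cnjv (cnj c *s a)) a"
    by (simp add: real_outer_scale real_outer_cnjv_commute)
  then show ?thesis by (simp add: real_wedge_def cnjv_linear)
qed

section \<open>Consequences of conformality, the Lagrangian condition and minimality\<close>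

locale minimal_lagrangian_lift = isotropic_lift +
  fixes u :: "complex \<Rightarrow> real"
  assumes metric: "\<And>p X Y. p \<in> W \<Longrightarrow> fs_metric F p X Y = 2 * exp (u p) * Re (X * cnj Y)"
    and kahler: "\<And>p X Y. p \<in> W \<Longrightarrow> fs_kahler F p X Y = 0"
    and mean: "\<And>p. p \<in> W \<Longrightarrow> mean_curv F p = 0"
begin

lemma Im_herm_tang: "p \<in> W \<Longrightarrow> Im (herm (tang X F p) (tang Y F p)) = 0"
  using kahler[of p X Y] by (simp add: fs_kahler_def inner_eq_Re_herm herm_scale)

lemma herm_tang_commute: "p \<in> W \<Longrightarrow> herm (tang X F p) (tang Y F p) = herm (tang Y F p) (tang X F p)"
  using herm_sym[of "tang X F p" "tang Y F p"] Im_herm_tang[of p Y X] by (simp add: complex_eq_iff)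

text \<open>The projection only removes vectors orthogonal to \<open>tang Z F p\<close>. The phase
  correction is an imaginary multiple of \<open>tang Y F p\<close>, and its real inner product with
  \<open>tang Z F p\<close> vanishes because their Hermitian product is real.\<close>

lemma inner_cov_Q2_tang:
  assumes p: "p \<in> W"
  shows "inner (cov_Q2 X Y F p) (tang Z F p) = inner (ddir X (tang Y F) p) (tang Z F p)"
proof -
  have "herm (cnjv (F p)) (tang Z F p) = 0"
    using tang_perp[OF p] by (simp add: herm_cnjv)
  then show ?thesis
    using tang_perp[OF p, of Z] Re_vert[OF p, of X] Im_herm_tang[OF p, of Y Z]
    by (simp add: inner_eq_Re_herm cov_Q2_alt Q2_tangent_def herm_diff herm_scale)
qed

lemma ddir_inner_tang:
  assumes p: "p \<in> W"
  shows "ddir X (\<lambda>q. inner (tang Y F q) (tang Z F q)) p =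
    inner (cov_Q2 X Y F p) (tang Z F p) + inner (cov_Q2 X Z F p) (tang Y F p)"
  unfolding inner_cov_Q2_tang[OF p]
  using ddir_bilinear[OF bounded_bilinear_inner diff_tang[OF p] diff_tang[OF p], of X Y Z]
  by (simp add: inner_commute)

text \<open>This is the harmonic map equation. Differentiating the conformality relations and using
  symmetry of the Hessian shows that the trace has no tangential component; its normal component is
  a multiple of the mean curvature vector.\<close>

lemma laplacian_eq_0:
  assumes p: "p \<in> W"
  shows "cov_Q2 1 1 F p + cov_Q2 \<i> \<i> F p = 0"
proof -
  define H where "H = cov_Q2 1 1 F p + cov_Q2 \<i> \<i> F p"
  let ?c = "\<lambda>X Y Z. inner (cov_Q2 X Y F p) (tang Z F p)"
  have z: "?c X 1 \<i> + ?c X \<i> 1 = 0" for X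
    unfolding ddir_inner_tang[OF p, symmetric]
    by (rule ddir_const_open[OF open_W p]) (use metric[unfolded fs_metric_def] in auto)
  have e: "?c X 1 1 = ?c X \<i> \<i>" for X
  proof -
    have "ddir X (\<lambda>q. inner (tang 1 F q) (tang 1 F q)) p = ddir X (\<lambda>q. inner (tang \<i> F q) (tang \<i> F q)) p"
      by (rule ddir_cong_open[OF open_W p]) (use metric[unfolded fs_metric_def] in auto)
    then show ?thesis unfolding ddir_inner_tang[OF p] by simp
  qed
  have s: "?c 1 \<i> Z = ?c \<i> 1 Z" for Z using cov_Q2_commute[OF p] by simp
  have H1: "inner H (tang 1 F p) = 0"
    using z[of \<i>] e[of 1] s[of \<i>] by (simp add: H_def inner_add_left)
  have Hi: "inner H (tang \<i> F p) = 0"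
    using z[of 1] e[of \<i>] s[of 1] by (simp add: H_def inner_add_left)
  define \<rho> where "\<rho> = 2 * exp (u p)"
  have \<rho>: "\<rho> \<noteq> 0" "fs_metric F p 1 1 = \<rho>" "fs_metric F p \<i> \<i> = \<rho>" using metric[OF p] by (auto simp: \<rho>_def)
  have "normal_part F p (cov_Q2 1 1 F p) + normal_part F p (cov_Q2 \<i> \<i> F p) = H"
  proof -
    have "normal_part F p a + normal_part F p b = normal_part F p (a + b)" for a b
      by (simp add: normal_part_def inner_add_left add_divide_distrib scaleR_left_distrib algebra_simps)
    then show ?thesis by (simp add: H_def[symmetric]) (simp add: normal_part_def H1 Hi)
  qed
  moreover have "mean_curv F p = (1 / (2 * \<rho>)) *\<^sub>R (normal_part F p (cov_Q2 1 1 F p) + normal_part F p (cov_Q2 \<i> \<i> F p))"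
    unfolding mean_curv_def \<rho> by (simp add: scaleR_add_right inverse_eq_divide)
  ultimately show ?thesis using mean[OF p] \<rho> H_def by simp
qed

text \<open>The derivative of \<open>tang Y F\<close> differs from the covariant derivative by three
  terms. The multiple of \<open>F\<close> is real by the Lagrangian condition and the multiple of
  \<open>cnjv F\<close> is arbitrary; both have zero wedge with \<open>F\<close>. The phase term
  cancels against the one from the derivative of \<open>F\<close>.\<close>

lemma ddir_real_wedge_tang:
  assumes p: "p \<in> W"
  shows "ddir X (\<lambda>q. real_wedge (tang Y F q) (F q)) p =
    real_wedge (cov_Q2 X Y F p) (F p) + real_wedge (tang Y F p) (tang X F p)"
proof -
  define h where "h = herm (ddir X F p) (F p)"
  define v where "v = ddir X (tang Y F) p - h *s tang Y F p"
  have c: "cov_Q2 X Y F p = v - herm v (F p) *s F p - herm v (cnjv (F p)) *s cnjv (F p)"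
    unfolding cov_Q2_alt Q2_tangent_def v_def h_def by simp
  have ch: "cnj h = - h" using cnj_vert[OF p] h_def by simp
  have "herm (tang Y F p) (ddir X F p) + herm (ddir X (tang Y F) p) (F p) = 0"
    using ddir_bilinear[OF bounded_bilinear_herm diff_tang[OF p] diff_F[OF p], of X Y]
      ddir_const_open[OF open_W p, of "\<lambda>q. herm (tang Y F q) (F q)" 0 X] tang_perp by simp
  then have "herm v (F p) = - herm (tang Y F p) (tang X F p)"
    using tang_perp[OF p] ddir_eq_tang[of X p]
    by (simp add: v_def herm_diff herm_scale herm_add eq_neg_iff_add_eq_0 add.commute) (metis add.right_neutral herm_add(2) herm_scale(2) mult_zero_right)
  then have "Im (herm v (F p)) = 0" using Im_herm_tang[OF p] by simp
  have "ddir X (\<lambda>q. real_wedge (tang Y F q) (F q)) p =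
      real_wedge (tang Y F p) (ddir X F p) + real_wedge (ddir X (tang Y F) p) (F p)"
    by (rule ddir_bilinear[OF bounded_bilinear_real_wedge diff_tang[OF p] diff_F[OF p]])
  also have "ddir X (tang Y F) p = cov_Q2 X Y F p + herm v (F p) *s F p + herm v (cnjv (F p)) *s cnjv (F p) + h *s tang Y F p"
    by (simp add: c v_def)
  also have "ddir X F p = tang X F p + h *s F p" unfolding h_def by (rule ddir_eq_tang)
  also have "real_wedge (tang Y F p) (tang X F p + h *s F p) +
      real_wedge (cov_Q2 X Y F p + herm v (F p) *s F p + herm v (cnjv (F p)) *s cnjv (F p) + h *s tang Y F p) (F p) =
      real_wedge (cov_Q2 X Y F p) (F p) + real_wedge (tang Y F p) (tang X F p) +
      real_wedge (herm v (F p) *s F p) (F p) + real_wedge (herm v (cnjv (F p)) *s cnjv (F p)) (F p) +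
      (real_wedge (h *s tang Y F p) (F p) + real_wedge (tang Y F p) (h *s F p))"
    by (simp add: real_wedge.add_left real_wedge.add_right)
  also have "\<dots> = real_wedge (cov_Q2 X Y F p) (F p) + real_wedge (tang Y F p) (tang X F p)"
    using real_wedge_scale_self[OF \<open>Im (herm v (F p)) = 0\<close>] real_wedge_scale_cnjv real_wedge_gauge[OF ch] by simp
  finally show ?thesis .
qed

text \<open>The left side is alternating and real bilinear in \<open>X\<close> and \<open>Y\<close>,
  and such a form on a real plane is a multiple of the area form.\<close>

lemma real_wedge_tang_tang:
  assumes p: "p \<in> W"
  shows "real_wedge (tang X F p) (tang Y F p) = Im (cnj X * Y) *\<^sub>R real_wedge (tang 1 F p) (tang \<i> F p)"
proof -
  have "real_wedge a a = 0" for a by (simp add: real_wedge_def)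
  moreover have "real_wedge (tang \<i> F p) (tang 1 F p) = - real_wedge (tang 1 F p) (tang \<i> F p)"
    by (simp add: real_wedge_def)
  ultimately show ?thesis
    unfolding tang_expand[OF p, of X] tang_expand[OF p, of Y]
    by (simp add: real_wedge.add_left real_wedge.add_right real_wedge.scaleR_left real_wedge.scaleR_right algebra_simps)
qed

text \<open>With \<open>\<mu> = cnj l - 1\<close> the hypothesis says \<open>cmod l = 1\<close>.\<close>

lemma connection_flat:
  assumes p: "p \<in> W" and \<mu>: "(cmod \<mu>)\<^sup>2 + 2 * Re \<mu> = 0"
  defines "\<eta> X q \<equiv> real_wedge (tang (\<mu> * X) F q) (F q)"
  shows "ddir X (\<eta> Y) p + \<eta> X p ** \<eta> Y p = ddir Y (\<eta> X) p + \<eta> Y p ** \<eta> X p"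
proof -
  define k where "k = Im (cnj X * Y)"
  define \<Omega> where "\<Omega> = real_wedge (tang 1 F p) (tang \<i> F p)"
  \<comment> \<open>A symmetric real bilinear form with zero trace depends only on the complex
    product of its arguments, so the factor \<mu> may be moved from one argument to the
    other.\<close>
  have cov: "cov_Q2 X (\<mu> * Y) F p = cov_Q2 Y (\<mu> * X) F p"
  proof -
    have "cov_Q2 \<i> \<i> F p = - cov_Q2 1 1 F p" using laplacian_eq_0[OF p] by (simp add: add_eq_0_iff)
    then show ?thesis
      unfolding cov_Q2_expand[OF p, of X] cov_Q2_expand[OF p, of Y] by (simp add: algebra_simps)
  qed
  have comm: "\<eta> X p ** \<eta> Y p - \<eta> Y p ** \<eta> X p = - real_wedge (tang (\<mu> * X) F p) (tang (\<mu> * Y) F p)"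
    unfolding \<eta>_def
    by (rule real_wedge_commutator[OF herm_F bil_F tang_perp(1,2) tang_perp(1,2) herm_tang_commute]) (use p in auto)
  have "ddir X (\<eta> Y) p - ddir Y (\<eta> X) p + (\<eta> X p ** \<eta> Y p - \<eta> Y p ** \<eta> X p) =
     real_wedge (tang (\<mu> * Y) F p) (tang X F p) - real_wedge (tang (\<mu> * X) F p) (tang Y F p)
     - real_wedge (tang (\<mu> * X) F p) (tang (\<mu> * Y) F p)"
    unfolding comm unfolding \<eta>_def ddir_real_wedge_tang[OF p] cov by simp
  also have "\<dots> = (Im (cnj (\<mu> * Y) * X) - Im (cnj (\<mu> * X) * Y) - Im (cnj (\<mu> * X) * (\<mu> * Y))) *\<^sub>R \<Omega>"
    unfolding \<Omega>_def real_wedge_tang_tang[OF p, of "\<mu> * Y" X] real_wedge_tang_tang[OF p, of "\<mu> * X" Y]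
      real_wedge_tang_tang[OF p, of "\<mu> * X" "\<mu> * Y"]
    by (simp only: scaleR_left_diff_distrib)
  \<comment> \<open>Up to the factor -k this is |1 + \<mu>|^2 - 1: the linear part in \<mu> comes
    from differentiating the wedge, the quadratic part from the commutator.\<close>
  also have "Im (cnj (\<mu> * Y) * X) - Im (cnj (\<mu> * X) * Y) - Im (cnj (\<mu> * X) * (\<mu> * Y)) = - k * ((cmod \<mu>)\<^sup>2 + 2 * Re \<mu>)"
    unfolding k_def cmod_power2 by (simp add: algebra_simps power2_eq_square)
  also note \<mu>
  finally show ?thesis by (simp add: algebra_simps)
qed

end

section \<open>Rotating a lift\<close>

lemma real_act_real_wedge:
  "real_act (real_wedge a f) v = herm v f *s a + bil v f *s cnjv a - herm v a *s f - bil v a *s cnjv f"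
  by (simp add: real_wedge_def real_act.diff_left real_act_real_outer algebra_simps)

lemma Q2_tangent_real_act:
  assumes "orthogonal_matrix M"
  shows "Q2_tangent (real_act M f) (real_act M v) = real_act M (Q2_tangent f v)"
  using assms
  by (simp add: Q2_tangent_def cnjv_real_act herm_real_act real_act.diff_right real_act_cscale)

locale rotated_lift = isotropic_lift +
  fixes T :: "complex \<Rightarrow> real ^ 4 ^ 4" and l :: complex
  assumes l: "cmod l = 1"
    and orth: "\<And>p. p \<in> W \<Longrightarrow> orthogonal_matrix (T p)"
    and ode: "\<And>p. p \<in> W \<Longrightarrow>
      (T has_derivative (\<lambda>X. T p ** real_wedge (tang ((cnj l - 1) * X) F p) (F p))) (at p)"
begin

abbreviation "TF \<equiv> \<lambda>p. real_act (T p) (F p)"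

lemma smooth_T: "smooth_on T W"
proof (rule smooth_on_linear_ode[OF bounded_bilinear_matrix_mult open_W ode])
  show "smooth_on (\<lambda>p. real_wedge (tang ((cnj l - 1) * X) F p) (F p)) W" for X
    by (intro smooth_on_bilinear[OF bounded_bilinear_real_wedge open_W] smooth_tang smooth_F)
qed

lemma isotropic_TF: "isotropic_lift TF W"
proof
  show "smooth_on TF W"
    by (rule smooth_on_bilinear[OF bounded_bilinear_real_act open_W smooth_T smooth_F])
qed (use open_W orth norm_F bil_F in \<open>auto simp: norm_real_act bil_real_act\<close>)

lemma ddir_real_act_T:
  assumes p: "p \<in> W" and G: "G differentiable at p"
  shows "ddir X (\<lambda>q. real_act (T q) (G q)) p = real_act (T p)
    (ddir X G p + real_act (real_wedge (tang ((cnj l - 1) * X) F p) (F p)) (G p))"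
proof -
  have "ddir X T p = T p ** real_wedge (tang ((cnj l - 1) * X) F p) (F p)"
    by (rule ddir_eq[OF ode[OF p]])
  then show ?thesis
    using ddir_bilinear[OF bounded_bilinear_real_act _ G, of T X] smooth_on_differentiable[OF smooth_T open_W p]
    by (simp add: real_act.add_right real_act_mult)
qed

text \<open>For a tangent vector w the matrix \<open>real_wedge w (F p)\<close> sends
  \<open>F p\<close> to w, since every other product involved vanishes.\<close>

lemma ddir_TF:
  assumes p: "p \<in> W"
  shows "ddir X TF p = real_act (T p) (ddir X F p + tang ((cnj l - 1) * X) F p)"
  using ddir_real_act_T[OF p diff_F[OF p]] tang_perp[OF p]
  by (simp add: real_act_real_wedge herm_F[OF p] bil_F[OF p])

lemma vert_TF: "p \<in> W \<Longrightarrow> herm (ddir X TF p) (TF p) = herm (ddir X F p) (F p)"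
  using tang_perp[of p] by (simp add: ddir_TF herm_real_act orth herm_add)

text \<open>The rotation contributes the tangent vector of \<open>(cnj l - 1) * X\<close>, and
  adding that of \<open>X\<close> leaves \<open>cnj l * X\<close>. This is the reason for the -1 in
  the connection.\<close>

lemma tang_TF:
  assumes p: "p \<in> W"
  shows "tang X TF p = real_act (T p) (tang (cnj l * X) F p)"
proof -
  have "tang X TF p = real_act (T p) (tang X F p + tang ((cnj l - 1) * X) F p)"
    unfolding tang_def[of X TF] vert_TF[OF p] unfolding ddir_TF[OF p] tang_def[of X F]
    by (simp add: real_act.add_right real_act.diff_right real_act_cscale)
  then show ?thesis by (simp add: tang_add[OF p, symmetric] algebra_simps)
qed

lemma fs_metric_TF: "p \<in> W \<Longrightarrow> fs_metric TF p X Y = fs_metric F p (cnj l * X) (cnj l * Y)"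
  by (simp add: fs_metric_def tang_TF inner_real_act orth)

lemma fs_kahler_TF: "p \<in> W \<Longrightarrow> fs_kahler TF p X Y = fs_kahler F p (cnj l * X) (cnj l * Y)"
  by (simp add: fs_kahler_def tang_TF inner_real_act orth real_act_cscale[symmetric])

text \<open>The derivative of \<open>T\<close> sends a tangent vector into the span of
  \<open>F\<close> and \<open>cnjv F\<close>, which the final projection discards. Therefore the
  direction of differentiation \<open>X\<close> is not rotated; only the field \<open>Y\<close>
  is.\<close>

lemma cov_Q2_TF:
  assumes p: "p \<in> W"
  shows "cov_Q2 X Y TF p = real_act (T p) (cov_Q2 X (cnj l * Y) F p)"
proof -
  let ?t = "tang (cnj l * Y) F" and ?w = "tang ((cnj l - 1) * X) F p"
  have "ddir X (tang Y TF) p = ddir X (\<lambda>q. real_act (T q) (?t q)) p"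
    by (rule ddir_cong_open[OF open_W p tang_TF])
  also have "\<dots> = real_act (T p) (ddir X ?t p + real_act (real_wedge ?w (F p)) (?t p))"
    by (rule ddir_real_act_T[OF p diff_tang[OF p]])
  also have "real_act (real_wedge ?w (F p)) (?t p) = - ((herm (?t p) ?w) *s F p) - bil (?t p) ?w *s cnjv (F p)"
    using tang_perp[OF p] by (simp add: real_act_real_wedge)
  finally have "ddir X (tang Y TF) p - herm (ddir X TF p) (TF p) *s tang Y TF p = real_act (T p)
      ((ddir X ?t p - herm (ddir X F p) (F p) *s ?t p) - (herm (?t p) ?w) *s F p - bil (?t p) ?w *s cnjv (F p))"
    unfolding vert_TF[OF p] tang_TF[OF p]
    by (simp add: real_act.add_right real_act.diff_right real_act_cscale real_act.minus_right)
  then show ?thesis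
    unfolding cov_Q2_alt Q2_tangent_real_act[OF orth[OF p]]
    using Q2_tangent_scale_self[OF herm_F[OF p] bil_F[OF p]] Q2_tangent_scale_cnjv[OF herm_F[OF p] bil_F[OF p]]
    by (simp add: Q2_tangent_real_act[OF orth[OF p]] Q2_tangent_linear)
qed

text \<open>For a horizontal lift the differential is its own tangential part, so rotation
  precomposes it with multiplication by \<open>cnj l\<close>. Such a precomposition multiplies the
  part of type (1,0) by that scalar and the part of type (0,1) by its conjugate.\<close>

lemma dz_TF:
  assumes p: "p \<in> W" and hor: "\<And>X. herm (ddir X F p) (F p) = 0"
  shows "dz TF p = cnj l *s real_act (T p) (dz F p)" "dzbar TF p = l *s real_act (T p) (dzbar F p)"
proof -
  have "ddir X TF p = real_act (T p) (tang (cnj l * X) F p)" for X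
    using tang_TF[OF p, of X] vert_TF[OF p, of X] hor[of X] by (simp add: tang_def[of X TF])
  moreover have "tang X F p = Re X *\<^sub>R ddir 1 F p + Im X *\<^sub>R ddir \<i> F p" for X
  proof -
    have "tang X F p = ddir X F p" using hor[of X] by (simp add: tang_def)
    then show ?thesis using ddir_expand[OF diff_F[OF p], of X] by simp
  qed
  ultimately have e: "ddir 1 TF p = of_real (Re l) *s real_act (T p) (ddir 1 F p) - of_real (Im l) *s real_act (T p) (ddir \<i> F p)"
      "ddir \<i> TF p = of_real (Im l) *s real_act (T p) (ddir 1 F p) + of_real (Re l) *s real_act (T p) (ddir \<i> F p)"
    by (simp_all add: real_act.add_right real_act.diff_right scaleR_eq_scale real_act_cscale)
  have "cnj l = of_real (Re l) - \<i> * of_real (Im l)" "l = of_real (Re l) + \<i> * of_real (Im l)"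
    by (simp_all add: complex_eq_iff)
  then show "dz TF p = cnj l *s real_act (T p) (dz F p)" "dzbar TF p = l *s real_act (T p) (dzbar F p)"
    unfolding dz_def dzbar_def e
    by (simp_all add: vec_eq_iff real_act.add_right real_act.diff_right real_act_cscale)
      (auto simp: field_simps complex_eq_iff)
qed

end

text \<open>Expanding \<open>cnj l\<close> in the rotated trace leaves \<open>Re l\<close> times the
  old trace plus \<open>Im l\<close> times an antisymmetrised Hessian; the first vanishes by
  harmonicity, the second by symmetry.\<close>

lemma (in minimal_lagrangian_lift) mean_curv_TF:
  assumes "rotated_lift F W T l" and p: "p \<in> W"
  shows "mean_curv (\<lambda>p. real_act (T p) (F p)) p = 0"
proof -
  interpret rotated_lift F W T l by fact
  have "cov_Q2 1 1 TF p + cov_Q2 \<i> \<i> TF p =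
     real_act (T p) (Re l *\<^sub>R (cov_Q2 1 1 F p + cov_Q2 \<i> \<i> F p) + Im l *\<^sub>R (cov_Q2 \<i> 1 F p - cov_Q2 1 \<i> F p))"
    unfolding cov_Q2_TF[OF p]
    unfolding cov_Q2_expand_right[OF p, of 1 "cnj l * 1"] cov_Q2_expand_right[OF p, of \<i> "cnj l * \<i>"] real_act.add_right[symmetric]
    by (simp add: algebra_simps)
  then have H: "cov_Q2 1 1 TF p + cov_Q2 \<i> \<i> TF p = 0"
    using laplacian_eq_0[OF p] cov_Q2_commute[OF p, of 1 \<i>] by (simp add: real_act.zero_right)
  have n: "normal_part TF p a + normal_part TF p b = normal_part TF p (a + b)" for a b
    by (simp add: normal_part_def inner_add_left add_divide_distrib scaleR_left_distrib algebra_simps)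
  have "fs_metric TF p \<i> \<i> = fs_metric TF p 1 1"
    by (simp add: fs_metric_TF[OF p] metric[OF p])
  then have "mean_curv TF p = (1/2) *\<^sub>R (normal_part TF p (cov_Q2 1 1 TF p) + normal_part TF p (cov_Q2 \<i> \<i> TF p)) /\<^sub>R fs_metric TF p 1 1"
    by (simp add: mean_curv_def scaleR_add_right)
  then show ?thesis unfolding n H by (simp add: normal_part_def)
qed

section \<open>The connection as a function of the line\<close>

definition line_proj :: "(complex ^ 4) set \<Rightarrow> real ^ 4 ^ 4" where
  "line_proj L = (SOME M. \<exists>v\<in>L. norm v = 1 \<and> M = real_outer v v)"

lemma norm_cscale: "norm (c *s (v :: complex ^ 4)) = cmod c * norm v"
  by (simp add: norm_vec_def L2_set_def norm_mult power_mult_distrib sum_distrib_left[symmetric] real_sqrt_mult)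

text \<open>Two unit vectors of one line differ by a phase, which cancels in
  \<open>real_outer v v\<close>; so the choice in \<open>line_proj\<close> has only one possible
  outcome.\<close>

lemma line_proj_cline:
  assumes "norm v = 1"
  shows "line_proj (cline v) = real_outer v v"
proof -
  have "M = real_outer v v" if M: "w \<in> cline v" "norm w = 1" "M = real_outer w w" for w M
  proof -
    obtain c where w: "w = c *s v" using M(1) by (auto simp: cline_def)
    then have "cmod c = 1" using M assms by (simp add: norm_cscale)
    then have "cnj c * c = 1" by (simp add: complex_norm_square[symmetric] mult.commute)
    then show ?thesis using M w by (simp add: real_outer_scale)
  qed
  moreover have "v \<in> cline v" unfolding cline_def by (rule range_eqI[of _ _ 1]) simp
  ultimately show ?thesis unfolding line_proj_def using assms
    by (intro some_equality) blast+
qed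

text \<open>The commutator of dP with P for P = \<open>line_proj (g q)\<close>. No lift occurs in
  it, so expressions from different lifts and different charts can be compared directly.\<close>

definition connection :: "(complex \<Rightarrow> (complex ^ 4) set) \<Rightarrow> complex \<Rightarrow> complex \<Rightarrow> real ^ 4 ^ 4" where
  "connection g X p =
     ddir X (\<lambda>q. line_proj (g q)) p ** line_proj (g p) - line_proj (g p) ** ddir X (\<lambda>q. line_proj (g q)) p"

lemma unit_lift_isotropic:
  assumes "open W" "unit_lift g W F" "\<And>p. p \<in> W \<Longrightarrow> g p \<in> Q2"
  shows "isotropic_lift F W"
proof
  fix p assume p: "p \<in> W"
  then obtain v where v: "g p = cline v" "bil v v = 0" using assms(3) by (auto simp: Q2_def)
  have "F p \<in> cline (F p)" unfolding cline_def by (rule range_eqI[of _ _ 1]) simp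
  then have "F p \<in> cline v" using v p assms(2) by (simp add: unit_lift_def)
  then show "bil (F p) (F p) = 0" using v(2) by (auto simp: cline_def bil_scale)
qed (use assms in \<open>auto simp: unit_lift_def\<close>)

lemma connection_lift:
  assumes "isotropic_lift F W" and g: "\<And>q. q \<in> W \<Longrightarrow> g q = cline (F q)" and p: "p \<in> W"
  shows "connection g X p = real_wedge (tang X F p) (F p)"
    and "(\<lambda>q. line_proj (g q)) differentiable at p"
proof -
  interpret isotropic_lift F W by fact
  have e: "line_proj (g q) = real_outer (F q) (F q)" if "q \<in> W" for q
    using that g norm_F by (simp add: line_proj_cline)
  have "ddir X (\<lambda>q. line_proj (g q)) p = ddir X (\<lambda>q. real_outer (F q) (F q)) p"
    by (rule ddir_cong_open[OF open_W p e])
  also have "\<dots> = real_outer (F p) (ddir X F p) + real_outer (ddir X F p) (F p)"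
    by (rule ddir_bilinear[OF bounded_bilinear_real_outer diff_F[OF p] diff_F[OF p]])
  finally show "connection g X p = real_wedge (tang X F p) (F p)"
    using projection_commutator_F[OF p, of X] by (simp add: connection_def e[OF p] add.commute)
  have "(\<lambda>q. real_outer (F q) (F q)) differentiable at p"
    using real_outer.FDERIV[OF has_derivative_ddir[OF diff_F[OF p]] has_derivative_ddir[OF diff_F[OF p]]]
    unfolding differentiable_def by blast
  then show "(\<lambda>q. line_proj (g q)) differentiable at p"
    by (rule ddir_differentiable_cong_open[OF open_W p, rotated]) (simp add: e)
qed

lemma connection_compose:
  assumes "(\<lambda>q. line_proj (g q)) differentiable at (\<phi> p)"
    and \<phi>: "(\<phi> has_field_derivative d) (at p)"
    and g': "open W" "p \<in> W" "\<And>q. q \<in> W \<Longrightarrow> g' q = g (\<phi> q)"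
  shows "connection g' X p = connection g (d * X) (\<phi> p)"
proof -
  have "ddir X (\<lambda>q. line_proj (g' q)) p = ddir X (\<lambda>q. line_proj (g (\<phi> q))) p"
    by (rule ddir_cong_open[OF g'(1,2)]) (simp add: g'(3))
  also have "\<dots> = ddir (d * X) (\<lambda>q. line_proj (g q)) (\<phi> p)"
    by (rule ddir_eq, rule has_derivative_compose[OF \<phi>[unfolded has_field_derivative_def] has_derivative_ddir[OF assms(1)]])
  finally show ?thesis by (simp add: connection_def g'(2,3))
qed

section \<open>Local solutions of the rotation equation\<close>

definition rotation :: "(complex \<Rightarrow> (complex ^ 4) set) \<Rightarrow> complex \<Rightarrow> complex set \<Rightarrow> (complex \<Rightarrow> real ^ 4 ^ 4) \<Rightarrow> bool" where
  "rotation g l V T \<longleftrightarrow> (\<forall>p\<in>V. orthogonal_matrix (T p) \<and>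
     (T has_derivative (\<lambda>X. T p ** connection g ((cnj l - 1) * X) p)) (at p))"

lemma rotation_rotated_lift:
  assumes "isotropic_lift F W" "\<And>q. q \<in> W \<Longrightarrow> g q = cline (F q)" "cmod l = 1" "rotation g l W T"
  shows "rotated_lift F W T l"
proof -
  interpret isotropic_lift F W by fact
  show ?thesis
    using assms(3,4) connection_lift(1)[OF assms(1,2)]
    by unfold_locales (auto simp: rotation_def)
qed

lemma rotation_mult_left:
  assumes "orthogonal_matrix C" "rotation g l V T"
  shows "rotation g l V (\<lambda>p. C ** T p)"
  unfolding rotation_def
proof
  fix p assume p: "p \<in> V"
  have "orthogonal_matrix (C ** T p)" using assms p by (auto simp: rotation_def orthogonal_matrix_mul)
  moreover have "((\<lambda>p. C ** T p) has_derivative (\<lambda>X. C ** (T p ** connection g ((cnj l - 1) * X) p))) (at p)"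
    using assms(2) p by (intro bounded_linear.has_derivative[OF mat4.bounded_linear_right]) (auto simp: rotation_def)
  ultimately show "orthogonal_matrix (C ** T p) \<and>
      ((\<lambda>p. C ** T p) has_derivative (\<lambda>X. C ** T p ** connection g ((cnj l - 1) * X) p)) (at p)"
    by (simp add: matrix_mul_assoc)
qed

text \<open>Skewness of the connection makes the derivative of S T^t vanish, so this product keeps
  its value at \<open>q\<close>, which is the identity.\<close>

lemma rotation_unique:
  assumes "convex V" "open V" and S: "rotation g l V S" and T: "rotation g l V T"
    and skew: "\<And>p X. p \<in> V \<Longrightarrow> transpose (connection g X p) = - connection g X p"
    and q: "q \<in> V" "S q = T q" and p: "p \<in> V"
  shows "S p = T p"
proof -
  have d: "((\<lambda>p. S p ** transpose (T p)) has_derivative (\<lambda>X. 0)) (at p within V)" if "p \<in> V" for p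
  proof -
    have "((\<lambda>p. S p ** transpose (T p)) has_derivative (\<lambda>X. S p ** transpose (T p ** connection g ((cnj l - 1) * X) p)
        + S p ** connection g ((cnj l - 1) * X) p ** transpose (T p))) (at p)"
      using S T that
      by (intro mat4.FDERIV bounded_linear.has_derivative[OF bounded_linear_transpose]) (auto simp: rotation_def)
    moreover have "S p ** transpose (T p ** connection g Y p) + S p ** connection g Y p ** transpose (T p) = 0" for Y
      by (simp add: matrix_transpose_mul skew[OF that] mat4.minus_left mat4.minus_right matrix_mul_assoc)
    ultimately show ?thesis by (simp add: has_derivative_at_withinI)
  qed
  have "S p ** transpose (T p) = S q ** transpose (T q)"
    by (rule has_derivative_zero_unique[OF assms(1) d]) (use p q in auto)
  also have "\<dots> = mat 1" using S q by (auto simp: rotation_def orthogonal_matrix_def)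
  finally have "S p ** transpose (T p) ** T p = T p" by simp
  then show ?thesis using T p by (auto simp: rotation_def orthogonal_matrix_def matrix_mul_assoc[symmetric])
qed

lemma rotation_exists_local:
  assumes "minimal_lagrangian_lift F W u" and g: "\<And>q. q \<in> W \<Longrightarrow> g q = cline (F q)"
    and l: "cmod l = 1" and c: "c \<in> W"
  obtains r T where "r > 0" "ball c r \<subseteq> W" "rotation g l (ball c r) T"
proof -
  interpret minimal_lagrangian_lift F W u by fact
  define \<mu> where "\<mu> = cnj l - 1"
  have \<mu>: "(cmod \<mu>)\<^sup>2 + 2 * Re \<mu> = 0"
    using arg_cong[OF l, of "\<lambda>x. x\<^sup>2"] unfolding \<mu>_def cmod_power2 by (simp add: power2_eq_square algebra_simps)
  define \<eta> where "\<eta> X q = real_wedge (tang (\<mu> * X) F q) (F q)" for X q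
  \<comment> \<open>A real linear matrix-valued form on the plane is encoded by its values at 1 and
    \<i>; then \<open>B w ab\<close> is the form multiplied by \<open>w\<close> on the left.\<close>
  define B :: "(real^4^4) \<Rightarrow> (real^4^4) \<times> (real^4^4) \<Rightarrow> complex \<Rightarrow>\<^sub>L (real^4^4)" where
    "B w ab = (blinfun_scaleR_left (w ** fst ab) o\<^sub>L Blinfun Re) + (blinfun_scaleR_left (w ** snd ab) o\<^sub>L Blinfun Im)" for w ab
  have B_apply: "B w ab X = Re X *\<^sub>R (w ** fst ab) + Im X *\<^sub>R (w ** snd ab)" for w ab X
    by (simp add: B_def blinfun.bilinear_simps bounded_linear_Blinfun_apply bounded_linear_Re bounded_linear_Im)
  have B: "bounded_bilinear B"
    by (rule bilinear_conv_bounded_bilinear[THEN iffD1])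
      (auto simp: bilinear_def B_apply blinfun.bilinear_simps mat4.add_left mat4.add_right mat4.scaleR_left mat4.scaleR_right algebra_simps
        intro!: linearI blinfun_eqI)
  have sm\<eta>: "smooth_on (\<eta> X) W" for X
    unfolding \<eta>_def by (intro smooth_on_bilinear[OF bounded_bilinear_real_wedge open_W] smooth_tang smooth_F)
  have \<eta>_expand: "\<eta> X q = Re X *\<^sub>R \<eta> 1 q + Im X *\<^sub>R \<eta> \<i> q" if "q \<in> W" for X q
  proof -
    have "\<mu> * X = Re X *\<^sub>R (\<mu> * 1) + Im X *\<^sub>R (\<mu> * \<i>)" by (simp add: complex_eq_iff)
    then show ?thesis unfolding \<eta>_def
      by (simp only: tang_add[OF that] tang_scaleR[OF that] real_wedge.add_left real_wedge.scaleR_left)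
  qed
  define \<omega> where "\<omega> q = (\<eta> 1 q, \<eta> \<i> q)" for q
  obtain a where a: "continuous_on W a" "\<And>p X. p \<in> W \<Longrightarrow> blinfun_apply (a p) X = ddir X (\<eta> 1) p"
    "\<And>p. p \<in> W \<Longrightarrow> (\<eta> 1 has_derivative blinfun_apply (a p)) (at p)"
    using smooth_on_C1_blinfun[OF open_W sm\<eta>[of 1]] by metis
  obtain b where b: "continuous_on W b" "\<And>p X. p \<in> W \<Longrightarrow> blinfun_apply (b p) X = ddir X (\<eta> \<i>) p"
    "\<And>p. p \<in> W \<Longrightarrow> (\<eta> \<i> has_derivative blinfun_apply (b p)) (at p)"
    using smooth_on_C1_blinfun[OF open_W sm\<eta>[of \<i>]] by metis
  define inl :: "(real^4^4) \<Rightarrow>\<^sub>L ((real^4^4) \<times> (real^4^4))" where "inl = Blinfun (\<lambda>x. (x, 0))"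
  define inr :: "(real^4^4) \<Rightarrow>\<^sub>L ((real^4^4) \<times> (real^4^4))" where "inr = Blinfun (\<lambda>x. (0, x))"
  have ins: "blinfun_apply inl = (\<lambda>x. (x, 0))" "blinfun_apply inr = (\<lambda>x. (0, x))"
    unfolding inl_def inr_def
    by (auto intro!: bounded_linear_Blinfun_apply bounded_linear_Pair bounded_linear_ident bounded_linear_zero)
  define \<omega>' where "\<omega>' p = (inl o\<^sub>L a p) + (inr o\<^sub>L b p)" for p
  have \<omega>'_apply: "\<omega>' p X = (ddir X (\<eta> 1) p, ddir X (\<eta> \<i>) p)" if "p \<in> W" for p X
    using a(2)[OF that] b(2)[OF that] by (simp add: \<omega>'_def ins blinfun.bilinear_simps)
  have ddir_\<eta>: "ddir Y (\<eta> X) p = Re X *\<^sub>R ddir Y (\<eta> 1) p + Im X *\<^sub>R ddir Y (\<eta> \<i>) p" if "p \<in> W" for X Y p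
  proof -
    have "\<eta> X differentiable at p" for X using smooth_on_differentiable[OF sm\<eta> open_W that] .
    then have "ddir Y (\<lambda>q. Re X *\<^sub>R \<eta> 1 q + Im X *\<^sub>R \<eta> \<i> q) p = Re X *\<^sub>R ddir Y (\<eta> 1) p + Im X *\<^sub>R ddir Y (\<eta> \<i>) p"
      by (subst ddir_add) (auto simp: ddir_scaleR intro!: differentiable_scaleR)
    moreover have "ddir Y (\<eta> X) p = ddir Y (\<lambda>q. Re X *\<^sub>R \<eta> 1 q + Im X *\<^sub>R \<eta> \<i> q) p"
      by (rule ddir_cong_open[OF open_W that \<eta>_expand])
    ultimately show ?thesis by simp
  qed
  have B\<omega>: "B w (\<omega> p) X = w ** \<eta> X p" if "p \<in> W" for w p X
    by (simp add: B_apply \<omega>_def \<eta>_expand[OF that, of X] mat4.add_right mat4.scaleR_right)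
  have B\<omega>': "B w (\<omega>' p X) Y = w ** ddir X (\<eta> Y) p" if "p \<in> W" for w p X Y
    by (simp add: B_apply \<omega>'_apply[OF that] ddir_\<eta>[OF that, of _ Y] mat4.add_right mat4.scaleR_right)
  have flat: "ddir X (\<eta> Y) p + \<eta> X p ** \<eta> Y p = ddir Y (\<eta> X) p + \<eta> Y p ** \<eta> X p" if "p \<in> W" for p X Y
    using connection_flat[OF that \<mu>, of X Y] unfolding \<eta>_def[abs_def] .
  obtain r where r: "r > 0" "ball c r \<subseteq> W"
    "\<And>v0. \<exists>v. v c = v0 \<and> (\<forall>p\<in>ball c r. (v has_derivative blinfun_apply (B (v p) (\<omega> p))) (at p))"
  proof (rule linear_frobenius[OF B open_W c, where \<omega>=\<omega> and \<omega>'=\<omega>'])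
    show "(\<omega> has_derivative blinfun_apply (\<omega>' p)) (at p)" if "p \<in> W" for p
      using has_derivative_Pair[OF a(3)[OF that] b(3)[OF that]]
      unfolding \<omega>_def[abs_def] by (rule has_derivative_eq_rhs) (simp add: fun_eq_iff a b \<omega>'_apply that)
    show "continuous_on W \<omega>'" unfolding \<omega>'_def by (intro continuous_intros a b)
    show "B w (\<omega>' p X) Y + B (B w (\<omega> p) X) (\<omega> p) Y = B w (\<omega>' p Y) X + B (B w (\<omega> p) Y) (\<omega> p) X"
      if "p \<in> W" for p w X Y
      using arg_cong[OF flat[OF that, of X Y], of "\<lambda>M. w ** M"]
      by (simp add: B\<omega>[OF that] B\<omega>'[OF that] mat4.add_right matrix_mul_assoc)
  qed (rule that; assumption)
  obtain T where T: "T c = mat 1" "\<And>p. p \<in> ball c r \<Longrightarrow> (T has_derivative blinfun_apply (B (T p) (\<omega> p))) (at p)"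
    using r(3)[of "mat 1"] by blast
  have T': "(T has_derivative (\<lambda>X. T p ** \<eta> X p)) (at p)" if "p \<in> ball c r" for p
    by (rule has_derivative_eq_rhs[OF T(2)[OF that]]) (use B\<omega> r(2) that in \<open>auto simp: fun_eq_iff subset_iff\<close>)
  have skew: "transpose (\<eta> X p) = - \<eta> X p" for X p by (simp add: \<eta>_def transpose_real_wedge)
  \<comment> \<open>The derivative of T T^t is T (\<eta> + \<eta>^t) T^t, which is zero as \<eta> is
    skew, and the initial value \<open>mat 1\<close> is orthogonal.\<close>
  have orth: "orthogonal_matrix (T p)" if p: "p \<in> ball c r" for p
  proof -
    have d: "((\<lambda>p. T p ** transpose (T p)) has_derivative (\<lambda>X. 0)) (at p within ball c r)" if "p \<in> ball c r" for p
    proof -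
      have "((\<lambda>p. T p ** transpose (T p)) has_derivative (\<lambda>X. T p ** transpose (T p ** \<eta> X p) + T p ** \<eta> X p ** transpose (T p))) (at p)"
        by (intro mat4.FDERIV bounded_linear.has_derivative[OF bounded_linear_transpose] T' that)
      moreover have "T p ** transpose (T p ** \<eta> X p) + T p ** \<eta> X p ** transpose (T p) = 0" for X
        by (simp add: matrix_transpose_mul skew mat4.minus_left mat4.minus_right matrix_mul_assoc)
      ultimately show ?thesis by (simp add: has_derivative_at_withinI)
    qed
    have "T p ** transpose (T p) = T c ** transpose (T c)"
      by (rule has_derivative_zero_unique[OF convex_ball d]) (use p r in auto)
    then have "T p ** transpose (T p) = mat 1" by (simp add: T(1) transpose_mat)
    then show ?thesis by (simp add: orthogonal_matrix_def matrix_left_right_inverse)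
  qed
  have "rotation g l (ball c r) T"
    unfolding rotation_def
  proof (intro ballI conjI orth)
    fix p assume p: "p \<in> ball c r"
    then show "(T has_derivative (\<lambda>X. T p ** connection g ((cnj l - 1) * X) p)) (at p)"
      using T'[OF p] r(2) connection_lift(1)[OF isotropic_lift_axioms g, of p] by (auto simp: \<eta>_def \<mu>_def)
  qed
  then show thesis using that r by blast
qed

section \<open>Charts and the associated family\<close>

definition minimal_lagrangian_map :: "(complex \<Rightarrow> (complex ^ 4) set) \<Rightarrow> complex set \<Rightarrow> bool" where
  "minimal_lagrangian_map g V \<longleftrightarrow> conformal_immersion g V \<and> lagrangian g V \<and> minimal g V"

lemma unit_lift_subset: "unit_lift g W F \<Longrightarrow> W' \<subseteq> W \<Longrightarrow> unit_lift g W' F"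
  using smooth_on_subset by (auto simp: unit_lift_def)

lemma unit_lift_minimal_lagrangian_lift:
  assumes "minimal_lagrangian_map g V" "open W" "W \<subseteq> V" "unit_lift g W F"
  obtains u where "minimal_lagrangian_lift F W u"
proof -
  have "\<And>p. p \<in> W \<Longrightarrow> g p \<in> Q2"
    using assms by (auto simp: minimal_lagrangian_map_def conformal_immersion_def smooth_into_Q2_def)
  then interpret isotropic_lift F W using unit_lift_isotropic assms by blast
  obtain u where "induced_metric g V u"
    using assms by (auto simp: minimal_lagrangian_map_def conformal_immersion_def)
  then have "minimal_lagrangian_lift F W u"
    using assms by unfold_locales (auto simp: minimal_lagrangian_map_def induced_metric_def lagrangian_def minimal_def)
  then show thesis using that by blast
qed

lemma minimal_lagrangian_map_lift:
  assumes "minimal_lagrangian_map g V" "open V" "p \<in> V"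
  obtains W F u where "open W" "p \<in> W" "W \<subseteq> V" "unit_lift g W F" "minimal_lagrangian_lift F W u"
    "\<And>q. q \<in> W \<Longrightarrow> g q = cline (F q)"
proof -
  obtain W F where W: "open W" "p \<in> W" "W \<subseteq> V" "unit_lift g W F"
    using assms unfolding minimal_lagrangian_map_def conformal_immersion_def smooth_into_Q2_def by blast
  obtain u where u: "minimal_lagrangian_lift F W u"
    by (rule unit_lift_minimal_lagrangian_lift[OF assms(1) W(1,3,4)])
  show thesis by (rule that[OF W u]) (use W(4) in \<open>simp add: unit_lift_def\<close>)
qed

lemma minimal_lagrangian_map_connection:
  assumes "minimal_lagrangian_map g V" "open V" "p \<in> V"
  shows "transpose (connection g X p) = - connection g X p"
    and "(\<lambda>q. line_proj (g q)) differentiable at p"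
proof -
  obtain W F u where W: "p \<in> W" "minimal_lagrangian_lift F W u" "\<And>q. q \<in> W \<Longrightarrow> g q = cline (F q)"
    by (rule minimal_lagrangian_map_lift[OF assms]) (rule that; assumption)
  then interpret minimal_lagrangian_lift F W u by blast
  note c = connection_lift[OF isotropic_lift_axioms W(3,1)]
  show "transpose (connection g X p) = - connection g X p"
    by (simp add: c(1) transpose_real_wedge)
  show "(\<lambda>q. line_proj (g q)) differentiable at p" by (rule c(2))
qed

lemma minimal_lagrangian_map_subset:
  assumes "minimal_lagrangian_map g V" "open V'" "V' \<subseteq> V"
  shows "minimal_lagrangian_map g V'"
  unfolding minimal_lagrangian_map_def conformal_immersion_def
proof (intro conjI)
  show "\<exists>u. induced_metric g V' u" "lagrangian g V'" "minimal g V'"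
    using assms unfolding minimal_lagrangian_map_def conformal_immersion_def induced_metric_def
      lagrangian_def minimal_def by (meson subset_trans)+
  show "smooth_into_Q2 g V'"
    unfolding smooth_into_Q2_def
  proof (intro conjI ballI)
    fix p assume p: "p \<in> V'"
    show "g p \<in> Q2"
      using assms p by (auto simp: minimal_lagrangian_map_def conformal_immersion_def smooth_into_Q2_def)
    obtain W F where W: "open W" "p \<in> W" "unit_lift g W F"
      using assms p unfolding minimal_lagrangian_map_def conformal_immersion_def smooth_into_Q2_def by blast
    have "unit_lift g (W \<inter> V') F" using unit_lift_subset[OF W(3)] by blast
    then show "\<exists>W F. open W \<and> p \<in> W \<and> W \<subseteq> V' \<and> unit_lift g W F"
      using W p assms(2) by (intro exI[of _ "W \<inter> V'"] exI[of _ F]) auto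
  qed
qed

lemma rotation_subset: "rotation g l V T \<Longrightarrow> V' \<subseteq> V \<Longrightarrow> rotation g l V' T"
  by (auto simp: rotation_def)

text \<open>Orthogonality of \<open>T\<close> is asked for at every point, not only on
  \<open>V\<close>, so that a lift of the rotated map can be turned back into a lift of
  \<open>g\<close> by an equality of total functions.\<close>

locale rotated_map =
  fixes g :: "complex \<Rightarrow> (complex ^ 4) set" and V :: "complex set"
    and T :: "complex \<Rightarrow> real ^ 4 ^ 4" and l :: complex
  assumes open_V: "open V" and map: "minimal_lagrangian_map g V"
    and l: "cmod l = 1" and T_orth: "\<And>p. orthogonal_matrix (T p)" and rot: "rotation g l V T"
begin

abbreviation "Tg \<equiv> \<lambda>p. real_act (T p) ` g p"

lemma g_Q2: "p \<in> V \<Longrightarrow> g p \<in> Q2"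
  using map by (auto simp: minimal_lagrangian_map_def conformal_immersion_def smooth_into_Q2_def)

lemma rotated_liftI:
  assumes "open W" "W \<subseteq> V" "unit_lift g W F"
  shows "rotated_lift F W T l"
proof (rule rotation_rotated_lift[OF _ _ l rotation_subset[OF rot assms(2)]])
  show "isotropic_lift F W" using unit_lift_isotropic[OF assms(1,3)] g_Q2 assms(2) by blast
qed (use assms in \<open>auto simp: unit_lift_def\<close>)

lemma smooth_T: "smooth_on T V"
proof (rule smooth_on_local[OF open_V])
  fix p assume p: "p \<in> V"
  obtain W F u where W: "open W" "p \<in> W" "W \<subseteq> V" "unit_lift g W F"
    by (rule minimal_lagrangian_map_lift[OF map open_V p]) (rule that; assumption)
  then interpret rotated_lift F W T l by (intro rotated_liftI)
  show "\<exists>W. open W \<and> p \<in> W \<and> smooth_on T W" using W smooth_T by blast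
qed

lemma real_act_cline: "real_act M ` cline v = cline (real_act M v)"
  by (auto simp: cline_def real_act_cscale image_image)

lemma unit_lift_Tg:
  assumes "open W" "W \<subseteq> V" "unit_lift g W F"
  shows "unit_lift Tg W (\<lambda>p. real_act (T p) (F p))"
proof -
  interpret rotated_lift F W T l using assms by (rule rotated_liftI)
  interpret TF: isotropic_lift TF W by (rule isotropic_TF)
  show ?thesis
    using TF.smooth_F TF.norm_F assms(3) by (auto simp: unit_lift_def real_act_cline)
qed

text \<open>The metric, Lagrangian and minimality predicates quantify over all lifts of the rotated
  map. Applying the transpose of \<open>T\<close> shows that each of them is the rotation of a lift
  of \<open>g\<close>, so the computations for rotated lifts cover them all.\<close>

lemma unit_lift_Tg_inverse:
  assumes "open W" "W \<subseteq> V" "unit_lift Tg W F'"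
  shows "\<exists>F. unit_lift g W F \<and> rotated_lift F W T l \<and> F' = (\<lambda>p. real_act (T p) (F p))"
proof -
  define F where "F = (\<lambda>p. real_act (transpose (T p)) (F' p))"
  have "unit_lift g W F"
    unfolding unit_lift_def
  proof (intro conjI ballI)
    show "smooth_on F W" unfolding F_def
      using assms smooth_on_subset[OF smooth_T assms(2)]
      by (intro smooth_on_bilinear[OF bounded_bilinear_real_act] smooth_on_linear[OF bounded_linear_transpose])
        (auto simp: unit_lift_def)
    fix p assume p: "p \<in> W"
    have Tt: "orthogonal_matrix (transpose (T p))" using T_orth by (simp add: orthogonal_matrix_transpose)
    show "norm (F p) = 1"
      using assms(3) p by (simp add: F_def norm_real_act[OF Tt] unit_lift_def)
    have "g p = real_act (transpose (T p)) ` real_act (T p) ` g p"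
      by (simp add: image_image real_act_transpose_cancel T_orth)
    also have "real_act (T p) ` g p = cline (F' p)" using assms(3) p by (simp add: unit_lift_def)
    finally show "g p = cline (F p)" by (simp add: real_act_cline F_def)
  qed
  moreover have "F' = (\<lambda>p. real_act (T p) (F p))"
    by (simp add: F_def real_act_transpose_cancel T_orth)
  ultimately show ?thesis using rotated_liftI[OF assms(1,2)] by blast
qed

lemma induced_metric_Tg:
  assumes V': "V' \<subseteq> V" and u: "induced_metric g V' u"
  shows "induced_metric Tg V' u"
  unfolding induced_metric_def
proof (intro allI impI ballI)
  fix W F' p X Y assume W: "open W \<and> W \<subseteq> V' \<and> unit_lift Tg W F'" and p: "p \<in> W"
  obtain F where F: "unit_lift g W F" "rotated_lift F W T l" "F' = (\<lambda>p. real_act (T p) (F p))"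
    using unit_lift_Tg_inverse[of W F'] W V' by blast
  interpret rotated_lift F W T l by (rule F(2))
  have "fs_metric F' p X Y = 2 * exp (u p) * Re (cnj l * X * cnj (cnj l * Y))"
    using u W F(1) p unfolding F(3) fs_metric_TF[OF p] induced_metric_def by blast
  also have "cnj l * X * cnj (cnj l * Y) = (cnj l * l) * (X * cnj Y)" by simp
  also have "cnj l * l = 1" using l by (simp add: complex_norm_square[symmetric] mult.commute)
  finally show "fs_metric F' p X Y = 2 * exp (u p) * Re (X * cnj Y)" by simp
qed

lemma minimal_lagrangian_map_Tg: "minimal_lagrangian_map Tg V"
  unfolding minimal_lagrangian_map_def conformal_immersion_def
proof (intro conjI)
  obtain u where "induced_metric g V u"
    using map by (auto simp: minimal_lagrangian_map_def conformal_immersion_def)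
  then show "\<exists>u. induced_metric Tg V u" using induced_metric_Tg by blast
  show "smooth_into_Q2 Tg V"
    unfolding smooth_into_Q2_def
  proof (intro conjI ballI)
    fix p assume p: "p \<in> V"
    then obtain v where v: "g p = cline v" "v \<noteq> 0" "bil v v = 0" using g_Q2 by (auto simp: Q2_def)
    have "real_act (T p) v \<noteq> 0" using v(2) norm_real_act[OF T_orth, of p v] by auto
    moreover have "bil (real_act (T p) v) (real_act (T p) v) = 0" using v(3) bil_real_act[OF T_orth] by simp
    ultimately show "Tg p \<in> Q2" unfolding Q2_def v(1) real_act_cline by blast
    obtain W F u where W: "open W" "p \<in> W" "W \<subseteq> V" "unit_lift g W F"
      by (rule minimal_lagrangian_map_lift[OF map open_V p]) (rule that; assumption)
    then show "\<exists>W F. open W \<and> p \<in> W \<and> W \<subseteq> V \<and> unit_lift Tg W F" using unit_lift_Tg by blast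
  qed
  show "lagrangian Tg V"
    unfolding lagrangian_def
  proof (intro allI impI ballI)
    fix W F' p X Y assume W: "open W \<and> W \<subseteq> V \<and> unit_lift Tg W F'" and p: "p \<in> W"
    obtain F where F: "unit_lift g W F" "rotated_lift F W T l" "F' = (\<lambda>p. real_act (T p) (F p))"
      using unit_lift_Tg_inverse[of W F'] W by blast
    interpret rotated_lift F W T l by (rule F(2))
    show "fs_kahler F' p X Y = 0"
      using map W F(1) p unfolding F(3) fs_kahler_TF[OF p] minimal_lagrangian_map_def lagrangian_def by blast
  qed
  show "minimal Tg V"
    unfolding minimal_def
  proof (intro allI impI ballI)
    fix W F' p assume W: "open W \<and> W \<subseteq> V \<and> unit_lift Tg W F'" and p: "p \<in> W"
    obtain F where F: "unit_lift g W F" "rotated_lift F W T l" "F' = (\<lambda>p. real_act (T p) (F p))"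
      using unit_lift_Tg_inverse[of W F'] W by blast
    obtain u where "minimal_lagrangian_lift F W u"
      using unit_lift_minimal_lagrangian_lift[OF map _ _ F(1)] W by blast
    then show "mean_curv F' p = 0"
      unfolding F(3) by (rule minimal_lagrangian_lift.mean_curv_TF[OF _ F(2) p])
  qed
qed

lemma dz_cscale:
  assumes "F differentiable at p"
  shows "dz (\<lambda>p. c *s F p) p = c *s dz F p"
proof -
  have "ddir X (\<lambda>p. c *s F p) p = c *s ddir X F p" for X
    by (rule ddir_eq[OF bounded_linear.has_derivative[OF vscale.bounded_linear_right has_derivative_ddir[OF assms]]])
  then show ?thesis by (simp add: dz_def vec_eq_iff algebra_simps)
qed

text \<open>The factors \<open>cnj l\<close> of the z-derivative and \<open>l\<close> of the
  conjugate derivative cancel in their bilinear product, so the same phase \<phi> normalises the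
  rotated lift. In \<alpha> the factor \<open>cnj l\<close> occurs twice.\<close>

lemma quadratic_differential_Tg:
  assumes V': "open V'" "V' \<subseteq> V" and q: "quadratic_differential g V' \<alpha>"
  shows "quadratic_differential Tg V' (\<lambda>p. l powi (-2) * \<alpha> p)"
proof -
  obtain G \<phi> where G: "horizontal_lift g V' G"
    "\<And>p. p \<in> V' \<Longrightarrow> bil (dz G p) (dzbar G p) = of_real (cmod (bil (dz G p) (dzbar G p))) * cis \<phi>"
    "\<And>p. p \<in> V' \<Longrightarrow> \<alpha> p = bil (dz (\<lambda>p. cis (- \<phi> / 2) *s G p) p) (dz (\<lambda>p. cis (- \<phi> / 2) *s G p) p)"
    using q unfolding quadratic_differential_def hat_lift_def by auto
  have uG: "unit_lift g V' G" using G(1) by (simp add: horizontal_lift_def)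
  interpret rotated_lift G V' T l by (rule rotated_liftI[OF V' uG])
  interpret TF: isotropic_lift TF V' by (rule isotropic_TF)
  have hor: "herm (ddir X G p) (G p) = 0" if p: "p \<in> V'" for X p
  proof -
    have "herm (dz G p) (G p) = 0" "herm (dzbar G p) (G p) = 0"
      using G(1) p by (auto simp: horizontal_lift_def herm_def)
    then have "herm (ddir 1 G p) (G p) = 0" "herm (ddir \<i> G p) (G p) = 0"
      by (simp_all add: dz_def dzbar_def herm_scale herm_add herm_diff)
    then show ?thesis
      using ddir_expand[OF diff_F[OF p], of X] by (simp add: scaleR_eq_scale herm_scale herm_add)
  qed
  note dTF = dz_TF[OF _ hor]
  have ll: "cnj l * l = 1" using l by (simp add: complex_norm_square[symmetric] mult.commute)
  have "horizontal_lift Tg V' TF"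
    unfolding horizontal_lift_def
  proof (intro conjI ballI)
    show "unit_lift Tg V' TF" by (rule unit_lift_Tg[OF V' uG])
    fix p assume p: "p \<in> V'"
    show "bil (dz TF p) (cnjv (TF p)) = 0" "bil (dzbar TF p) (cnjv (TF p)) = 0"
      using hor[OF p] unfolding dTF[OF p p] herm_def[symmetric]
      by (simp_all add: herm_scale herm_real_act T_orth dz_def dzbar_def herm_add herm_diff)
  qed
  moreover have b: "bil (dz TF p) (dzbar TF p) = bil (dz G p) (dzbar G p)" if p: "p \<in> V'" for p
    using ll by (simp add: dTF[OF p p] bil_scale bil_real_act T_orth mult.commute)
  have "\<forall>p\<in>V'. bil (dz TF p) (dzbar TF p) = of_real (cmod (bil (dz TF p) (dzbar TF p))) * cis \<phi>"
    using G(2) b by simp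
  ultimately have "hat_lift Tg V' (\<lambda>p. cis (- \<phi> / 2) *s TF p)"
    unfolding hat_lift_def by blast
  moreover have "l powi (-2) * \<alpha> p =
      bil (dz (\<lambda>p. cis (- \<phi> / 2) *s TF p) p) (dz (\<lambda>p. cis (- \<phi> / 2) *s TF p) p)" if p: "p \<in> V'" for p
  proof -
    have "inverse l = cnj l" using ll by (metis inverse_unique mult.commute)
    then have "l powi (-2) = cnj l * cnj l" by (simp add: power_int_minus power2_eq_square)
    then show ?thesis
      unfolding G(3)[OF p] dz_cscale[OF diff_F[OF p]] dz_cscale[OF TF.diff_F[OF p]] dTF[OF p p]
      by (simp add: bil_scale bil_real_act T_orth)
  qed
  ultimately show ?thesis unfolding quadratic_differential_def by blast
qed

end

section \<open>Patching over the atlas\<close>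

lemma riemann_surface_chart:
  assumes A: "riemann_surface A" "(U, z) \<in> A"
  shows "open U" "open (z ` U)" "\<And>x. x \<in> U \<Longrightarrow> inv_into U z (z x) = x"
    "continuous_on U z" "continuous_on (z ` U) (inv_into U z)"
    "\<And>N. open N \<Longrightarrow> open (z ` (U \<inter> N))" "\<And>N. open N \<Longrightarrow> open (U \<inter> z -` N)"
proof -
  have h: "open U" "open (z ` U)" "homeomorphism U (z ` U) z (inv_into U z)"
    using A unfolding riemann_surface_def by auto
  then show "open U" "open (z ` U)" "continuous_on U z" "continuous_on (z ` U) (inv_into U z)"
    by (auto simp: homeomorphism_def)
  show i: "inv_into U z (z x) = x" if "x \<in> U" for x
    using h(3) that by (auto simp: homeomorphism_def)
  show "open (U \<inter> z -` N)" if "open N" for N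
    using h by (auto simp: homeomorphism_def intro!: continuous_open_preimage that)
  show "open (z ` (U \<inter> N))" if "open N" for N
  proof -
    have "z ` (U \<inter> N) = z ` U \<inter> inv_into U z -` N" using i by auto
    then show ?thesis using h that by (auto simp: homeomorphism_def intro!: continuous_open_preimage)
  qed
qed

text \<open>The chart change is holomorphic, so its differential is multiplication by a complex
  number \<open>d\<close>, which commutes with \<open>cnj l - 1\<close>. This makes the rotation
  equation independent of the chart.\<close>

lemma rotation_transition:
  assumes A: "riemann_surface A" "(U, z) \<in> A" "(U', z') \<in> A"
    and f: "minimal_lagrangian_map (f \<circ> inv_into U z) (z ` U)"
    and B: "B \<subseteq> z ` U" and T: "rotation (f \<circ> inv_into U z) l B T"
  shows "rotation (f \<circ> inv_into U' z') l (z' ` (U' \<inter> (U \<inter> z -` B))) (T \<circ> z \<circ> inv_into U' z')"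
  unfolding rotation_def
proof
  note c = riemann_surface_chart[OF A(1,2)] and c' = riemann_surface_chart[OF A(1,3)]
  define \<phi> where "\<phi> = z \<circ> inv_into U' z'"
  fix p assume p: "p \<in> z' ` (U' \<inter> (U \<inter> z -` B))"
  have "open (z' ` (U' \<inter> U))" by (rule c'(6)[OF c(1)])
  moreover have pU: "p \<in> z' ` (U' \<inter> U)" using p by auto
  moreover have "\<phi> holomorphic_on (z' ` (U' \<inter> U))"
    using A unfolding riemann_surface_def \<phi>_def by fast
  ultimately obtain d where d: "(\<phi> has_field_derivative d) (at p)"
    by (metis holomorphic_derivI)
  have \<phi>p: "\<phi> p \<in> B" using p c'(3) by (auto simp: \<phi>_def)
  have con: "connection (f \<circ> inv_into U' z') X p = connection (f \<circ> inv_into U z) (d * X) (\<phi> p)" for X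
  proof (rule connection_compose[OF _ d c'(6)[OF c(1)] pU])
    show "(\<lambda>q. line_proj ((f \<circ> inv_into U z) q)) differentiable at (\<phi> p)"
      by (rule minimal_lagrangian_map_connection(2)[OF f c(2)]) (use \<phi>p B in blast)
    show "(f \<circ> inv_into U' z') q = (f \<circ> inv_into U z) (\<phi> q)" if "q \<in> z' ` (U' \<inter> U)" for q
      using that c(3) c'(3) by (auto simp: \<phi>_def)
  qed
  have "((\<lambda>q. T (\<phi> q)) has_derivative (\<lambda>X. T (\<phi> p) ** connection (f \<circ> inv_into U z) ((cnj l - 1) * (d * X)) (\<phi> p))) (at p)"
    using T \<phi>p unfolding rotation_def
    by (intro has_derivative_compose[OF d[unfolded has_field_derivative_def], of T]) blast
  then show "orthogonal_matrix ((T \<circ> z \<circ> inv_into U' z') p) \<and> (T \<circ> z \<circ> inv_into U' z' has_derivative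
      (\<lambda>X. (T \<circ> z \<circ> inv_into U' z') p ** connection (f \<circ> inv_into U' z') ((cnj l - 1) * X) p)) (at p)"
    using T \<phi>p unfolding con by (simp add: rotation_def \<phi>_def comp_def mult.left_commute)
qed

text \<open>The equation is demanded in all charts of the atlas at once, so that restriction and
  gluing of sections involve no choice of chart.\<close>

definition rotation_section ::
  "('m::t2_space set \<times> ('m \<Rightarrow> complex)) set \<Rightarrow> ('m \<Rightarrow> (complex ^ 4) set) \<Rightarrow> complex \<Rightarrow> 'm set \<Rightarrow> ('m \<Rightarrow> real ^ 4 ^ 4) \<Rightarrow> bool" where
  "rotation_section A f l W s \<longleftrightarrow> (\<forall>x\<in>W. orthogonal_matrix (s x)) \<and>
     (\<forall>(U, z)\<in>A. rotation (f \<circ> inv_into U z) l (z ` (U \<inter> W)) (s \<circ> inv_into U z))"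

lemma rotation_section_chart:
  "rotation_section A f l W s \<Longrightarrow> (U, z) \<in> A \<Longrightarrow> rotation (f \<circ> inv_into U z) l (z ` (U \<inter> W)) (s \<circ> inv_into U z)"
  unfolding rotation_section_def by blast

lemma rotation_cong_open:
  assumes "open V" "p \<in> V" "\<And>q. q \<in> V \<Longrightarrow> T q = S q" "rotation g l V T"
  shows "orthogonal_matrix (S p) \<and> (S has_derivative (\<lambda>X. S p ** connection g ((cnj l - 1) * X) p)) (at p)"
proof -
  have "(T has_derivative (\<lambda>X. T p ** connection g ((cnj l - 1) * X) p)) (at p)" "orthogonal_matrix (T p)"
    using assms(2,4) by (auto simp: rotation_def)
  then show ?thesis
    using has_derivative_transform_within_open[OF _ assms(1,2), of T _ UNIV S] assms(2,3) by simp
qed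

text \<open>The substance is the existence of flat neighbourhoods. One chart and a ball in it
  suffice: local existence gives one solution there, left multiplication by constants gives all
  initial values, and convexity of the ball gives uniqueness and path-connectedness.\<close>

lemma flat_sections_rotation:
  fixes A :: "('m::t2_space set \<times> ('m \<Rightarrow> complex)) set"
  assumes A: "riemann_surface A" and D: "open D" and l: "cmod l = 1"
    and f: "\<And>U z. (U, z) \<in> A \<Longrightarrow> minimal_lagrangian_map (f \<circ> inv_into U z) (z ` U)"
  shows "flat_sections (rotation_section A f l) D (Collect orthogonal_matrix)"
proof
  show "open D" by fact
  show "rotation_section A f l W' s" if "rotation_section A f l W s" "open W'" "W' \<subseteq> W" for W W' s
    using that unfolding rotation_section_def
    by (fastforce intro: rotation_subset)
  show "s q \<in> Collect orthogonal_matrix" if "rotation_section A f l W s" "q \<in> W" for W s q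
    using that by (auto simp: rotation_section_def)
next
  fix W s assume W: "open W"
    and loc: "\<And>p. p \<in> W \<Longrightarrow> \<exists>N t. open N \<and> p \<in> N \<and> rotation_section A f l N t \<and> (\<forall>q\<in>N. t q = s q)"
  show "rotation_section A f l W s"
    unfolding rotation_section_def
  proof (intro conjI ballI)
    show "orthogonal_matrix (s x)" if "x \<in> W" for x
      using loc[OF that] by (metis rotation_section_def)
    fix Uz assume "Uz \<in> A"
    then obtain U z where Uz: "Uz = (U, z)" "(U, z) \<in> A" by (cases Uz) auto
    note c = riemann_surface_chart[OF A Uz(2)]
    have "rotation (f \<circ> inv_into U z) l (z ` (U \<inter> W)) (s \<circ> inv_into U z)"
      unfolding rotation_def
    proof
      fix p assume "p \<in> z ` (U \<inter> W)"
      then obtain x where x: "x \<in> U" "x \<in> W" "p = z x" by auto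
      obtain N t where N: "open N" "x \<in> N" "rotation_section A f l N t" "\<And>q. q \<in> N \<Longrightarrow> t q = s q"
        using loc[OF x(2)] by blast
      show "orthogonal_matrix ((s \<circ> inv_into U z) p) \<and> (s \<circ> inv_into U z has_derivative
          (\<lambda>X. (s \<circ> inv_into U z) p ** connection (f \<circ> inv_into U z) ((cnj l - 1) * X) p)) (at p)"
        by (rule rotation_cong_open[OF c(6)[OF N(1)] _ _ rotation_section_chart[OF N(3) Uz(2)]])
          (use x N c(3) in auto)
    qed
    then show "case Uz of (U, z) \<Rightarrow> rotation (f \<circ> inv_into U z) l (z ` (U \<inter> W)) (s \<circ> inv_into U z)"
      using Uz by simp
  qed
next
  fix Y p assume Y: "open Y" "p \<in> Y" "Y \<subseteq> D"
  have "p \<in> \<Union> (fst ` A)" using A by (simp add: riemann_surface_def)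
  then obtain U z where Uz: "(U, z) \<in> A" "p \<in> U" by auto
  note c = riemann_surface_chart[OF A Uz(1)]
  let ?g = "f \<circ> inv_into U z"
  note fU = f[OF Uz(1)]
  obtain W F u where W: "open W" "z p \<in> W" "W \<subseteq> z ` U" "minimal_lagrangian_lift F W u" "\<And>q. q \<in> W \<Longrightarrow> ?g q = cline (F q)"
    by (rule minimal_lagrangian_map_lift[OF fU c(2) imageI[OF Uz(2)]]) (rule that; assumption)
  obtain r T where T: "r > 0" "ball (z p) r \<subseteq> W" "rotation ?g l (ball (z p) r) T"
    by (rule rotation_exists_local[OF W(4,5) l W(2)]) (assumption, (rule that; assumption))
  have "open (z ` (U \<inter> Y))" "z p \<in> z ` (U \<inter> Y)" using c(6) Y Uz by auto
  then obtain r' where r': "r' > 0" "ball (z p) r' \<subseteq> z ` (U \<inter> Y)" using open_contains_ball by blast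
  define B where "B = ball (z p) (min r r')"
  have B: "open B" "convex B" "B \<subseteq> z ` (U \<inter> Y)" "z p \<in> B" using T(1) r' by (auto simp: B_def)
  have BU: "B \<subseteq> z ` U" using B by blast
  have TB: "rotation ?g l B T" by (rule rotation_subset[OF T(3)]) (auto simp: B_def)
  define N where "N = U \<inter> z -` B"
  have zN: "z ` (U \<inter> N) = B" "inv_into U z ` B = N" using B(3) c(3) by (auto simp: N_def image_iff) force+
  have sec: "rotation_section A f l N (\<lambda>x. C ** T (z x))" if C: "orthogonal_matrix C" for C
    unfolding rotation_section_def
  proof (intro conjI ballI)
    show "orthogonal_matrix (C ** T (z x))" if "x \<in> N" for x
      using rotation_mult_left[OF C TB] that by (auto simp: rotation_def N_def)
    show "case Uz of (U', z') \<Rightarrow> rotation (f \<circ> inv_into U' z') l (z' ` (U' \<inter> N)) ((\<lambda>x. C ** T (z x)) \<circ> inv_into U' z')"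
      if "Uz \<in> A" for Uz
      using rotation_transition[OF A Uz(1) _ fU BU rotation_mult_left[OF C TB]] that
      by (auto simp: N_def comp_def)
  qed
  have ex: "\<exists>s. rotation_section A f l N s \<and> s q = v" if q: "q \<in> N" and v: "orthogonal_matrix v" for q v
  proof -
    have Tq: "orthogonal_matrix (T (z q))" using TB q by (auto simp: rotation_def N_def)
    \<comment> \<open>This constant left factor turns the value \<open>T (z q)\<close> into
      \<open>v\<close>.\<close>
    then have "orthogonal_matrix (v ** transpose (T (z q)))"
      using v by (simp add: orthogonal_matrix_mul orthogonal_matrix_transpose)
    from sec[OF this] have "rotation_section A f l N (\<lambda>x. v ** transpose (T (z q)) ** T (z x))" .
    moreover have "v ** transpose (T (z q)) ** T (z q) = v"
      using Tq by (simp add: matrix_mul_assoc[symmetric] orthogonal_matrix_def)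
    ultimately show ?thesis by blast
  qed
  have un: "s q = s' q"
    if s: "rotation_section A f l N s" "rotation_section A f l N s'" and q0: "q0 \<in> N" "s q0 = s' q0" and q: "q \<in> N" for s s' q0 q
  proof -
    have "(s \<circ> inv_into U z) (z q) = (s' \<circ> inv_into U z) (z q)"
    proof (rule rotation_unique[OF B(2,1), where g="?g" and l=l and S="s \<circ> inv_into U z" and T="s' \<circ> inv_into U z" and q="z q0" and p="z q"])
      show "rotation ?g l B (s \<circ> inv_into U z)" "rotation ?g l B (s' \<circ> inv_into U z)"
        using rotation_section_chart[OF s(1) Uz(1)] rotation_section_chart[OF s(2) Uz(1)] by (simp_all add: zN)
      show "transpose (connection ?g X p) = - connection ?g X p" if "p \<in> B" for p X
        by (rule minimal_lagrangian_map_connection(1)[OF fU c(2)]) (use that BU in blast)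
    qed (use q q0 c(3) in \<open>auto simp: N_def\<close>)
    then show ?thesis using q c(3) by (auto simp: N_def)
  qed
  have "open N" unfolding N_def by (rule c(7)[OF B(1)])
  moreover have "p \<in> N" using B(4) Uz(2) by (simp add: N_def)
  moreover have "N \<subseteq> Y"
  proof
    fix x assume x: "x \<in> N"
    then have "z x \<in> z ` (U \<inter> Y)" using B(3) by (auto simp: N_def)
    then obtain y where y: "y \<in> U" "y \<in> Y" "z x = z y" by auto
    have "x = y" using c(3)[of x] c(3)[OF y(1)] x y(3) by (simp add: N_def)
    then show "x \<in> Y" using y(2) by simp
  qed
  moreover have "path_connected N"
    unfolding zN(2)[symmetric]
    by (rule path_connected_continuous_image[OF continuous_on_subset[OF c(5) BU] convex_imp_path_connected[OF B(2)]])
  moreover have "\<forall>q\<in>N. \<forall>v\<in>Collect orthogonal_matrix. \<exists>s. rotation_section A f l N s \<and> s q = v"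
    using ex by auto
  moreover have "\<forall>s s'. rotation_section A f l N s \<and> rotation_section A f l N s' \<and> (\<exists>q\<in>N. s q = s' q) \<longrightarrow> (\<forall>q\<in>N. s q = s' q)"
    using un by blast
  ultimately show "\<exists>W. open W \<and> p \<in> W \<and> W \<subseteq> Y \<and> path_connected W \<and>
        (\<forall>q\<in>W. \<forall>v\<in>Collect orthogonal_matrix. \<exists>s. rotation_section A f l W s \<and> s q = v) \<and>
        (\<forall>s s'. rotation_section A f l W s \<and> rotation_section A f l W s' \<and> (\<exists>q\<in>W. s q = s' q) \<longrightarrow> (\<forall>q\<in>W. s q = s' q))"
    by (intro exI[of _ N] conjI)
qed

theorem theorem1p8:
  fixes A :: "('m::t2_space set \<times> ('m \<Rightarrow> complex)) set"
    and f :: "'m \<Rightarrow> (complex ^ 4) set"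
    and D :: "'m set"
  assumes "riemann_surface A"
    and "minimal_lagrangian_immersion A UNIV f"
    and "open D" and "simply_connected D"
  shows "\<exists>f' :: complex \<Rightarrow> 'm \<Rightarrow> (complex ^ 4) set.
    \<forall>l. cmod l = 1 \<longrightarrow>
      minimal_lagrangian_immersion A D (f' l) \<and>
      (\<forall>(U, z)\<in>A. \<forall>V. open V \<and> V \<subseteq> z ` (U \<inter> D) \<longrightarrow>
         (\<forall>u. induced_metric (f \<circ> inv_into U z) V u \<longrightarrow>
              induced_metric (f' l \<circ> inv_into U z) V u) \<and>
         (\<forall>\<alpha>. quadratic_differential (f \<circ> inv_into U z) V \<alpha> \<longrightarrow>
              quadratic_differential (f' l \<circ> inv_into U z) V (\<lambda>p. l powi (-2) * \<alpha> p)))"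
proof -
  have f: "minimal_lagrangian_map (f \<circ> inv_into U z) (z ` U)" if "(U, z) \<in> A" for U z
    using assms(2) that unfolding minimal_lagrangian_immersion_def minimal_lagrangian_map_def by fastforce
  have "\<exists>T. (\<forall>x. orthogonal_matrix (T x)) \<and> rotation_section A f l D T" if l: "cmod l = 1" for l
  proof -
    interpret flat_sections "rotation_section A f l" D "Collect orthogonal_matrix :: (real ^ 4 ^ 4) set"
      by (rule flat_sections_rotation[OF assms(1,3) l f])
    have "\<exists>T. rotation_section A f l D T"
    \<comment> \<open>Continuation needs a base point, so the empty domain is treated apart.\<close>
    proof (cases "D = {}")
      case True
      then have "rotation_section A f l D undefined" by (auto simp: rotation_section_def rotation_def)
      then show ?thesis by blast
    next
      case False
      then obtain p0 where "p0 \<in> D" by blast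
      moreover have "mat 1 \<in> Collect (orthogonal_matrix :: real ^ 4 ^ 4 \<Rightarrow> bool)"
        by (simp add: orthogonal_matrix_id)
      ultimately show ?thesis by (rule flat_section_exists[OF assms(4)]) blast
    qed
    then obtain T where T: "rotation_section A f l D T" by blast
    \<comment> \<open>Outside \<open>D\<close> the section satisfies no equation; the value
      \<open>mat 1\<close> there supplies the orthogonality at all points that
      \<open>rotated_map\<close> requires.\<close>
    define T' where "T' x = (if x \<in> D then T x else mat 1)" for x
    have "rotation_section A f l D T'"
      by (rule Par_local[OF assms(3)]) (use assms(3) T in \<open>auto simp: T'_def intro!: exI[of _ D] exI[of _ T]\<close>)
    moreover have "orthogonal_matrix (T' x)" for x
      using T by (auto simp: T'_def rotation_section_def orthogonal_matrix_id)
    ultimately show ?thesis by blast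
  qed
  then obtain T where T: "\<And>l x. cmod l = 1 \<Longrightarrow> orthogonal_matrix (T l x)"
    "\<And>l. cmod l = 1 \<Longrightarrow> rotation_section A f l D (T l)"
    by metis
  define f' where "f' l x = real_act (T l x) ` f x" for l x
  show ?thesis
  proof (intro exI[of _ f'] allI impI)
    fix l assume l: "cmod l = 1"
    have rm: "rotated_map (f \<circ> inv_into U z) (z ` (U \<inter> D)) (T l \<circ> inv_into U z) l" if Uz: "(U, z) \<in> A" for U z
    proof
      show "open (z ` (U \<inter> D))" by (rule riemann_surface_chart(6)[OF assms(1) Uz assms(3)])
      show "minimal_lagrangian_map (f \<circ> inv_into U z) (z ` (U \<inter> D))"
        by (rule minimal_lagrangian_map_subset[OF f[OF Uz] riemann_surface_chart(6)[OF assms(1) Uz assms(3)]]) auto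
      show "rotation (f \<circ> inv_into U z) l (z ` (U \<inter> D)) (T l \<circ> inv_into U z)"
        by (rule rotation_section_chart[OF T(2)[OF l] Uz])
    qed (use l T in auto)
    have f'_eq: "f' l \<circ> inv_into U z = (\<lambda>p. real_act ((T l \<circ> inv_into U z) p) ` (f \<circ> inv_into U z) p)" for U z
      by (auto simp: f'_def)
    have "minimal_lagrangian_immersion A D (f' l)"
      using rotated_map.minimal_lagrangian_map_Tg[OF rm]
      unfolding minimal_lagrangian_immersion_def f'_eq minimal_lagrangian_map_def by blast
    moreover have "\<forall>(U, z)\<in>A. \<forall>V. open V \<and> V \<subseteq> z ` (U \<inter> D) \<longrightarrow>
         (\<forall>u. induced_metric (f \<circ> inv_into U z) V u \<longrightarrow> induced_metric (f' l \<circ> inv_into U z) V u) \<and>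
         (\<forall>\<alpha>. quadratic_differential (f \<circ> inv_into U z) V \<alpha> \<longrightarrow>
              quadratic_differential (f' l \<circ> inv_into U z) V (\<lambda>p. l powi (-2) * \<alpha> p))"
      unfolding f'_eq
      using rotated_map.induced_metric_Tg[OF rm] rotated_map.quadratic_differential_Tg[OF rm] by blast
    ultimately show "minimal_lagrangian_immersion A D (f' l) \<and> (\<forall>(U, z)\<in>A. \<forall>V. open V \<and> V \<subseteq> z ` (U \<inter> D) \<longrightarrow>
         (\<forall>u. induced_metric (f \<circ> inv_into U z) V u \<longrightarrow> induced_metric (f' l \<circ> inv_into U z) V u) \<and>
         (\<forall>\<alpha>. quadratic_differential (f \<circ> inv_into U z) V \<alpha> \<longrightarrow>
              quadratic_differential (f' l \<circ> inv_into U z) V (\<lambda>p. l powi (-2) * \<alpha> p)))" by blast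
  qed
qed

end
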